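(* For each multiplying sequence $\mathfrak{s}$, the group $G_{\mathfrak{s}}$ is finitely generated and residually finite. Moreover, if $\mathfrak{s}$ and $\mathfrak{t}$ are multiplying sequences with $\mathfrak{s}\neq\mathfrak{t}$, then $G_{\mathfrak{s}}\not\cong G_{\mathfrak{t}}$.
   Context: A sequence $\mathfrak{s}=(s_n)_{n=0}^\infty$ is multiplying if $s_n$ and $s_{n+1}/s_n$ are positive integers for all $n\ge 0$, and $\lim_{n\to\infty} s_n=\infty$. Let $F=\langle a,b\rangle$ be the free group of rank $2$ with basis $\{a,b\}$, and let $\bar F=\langle \bar a,\bar b\rangle$ be an isomorphic copy of $F$, with isomorphism $F\to\bar F$ given by $a\mapsto\bar a$, $b\mapsto\bar b$. For a multiplying sequence $\mathfrak{s}$, let $H_{\mathfrak{s}}=\langle b^n a^{s_n} b^{-n}: n\geq 0\rangle\leq F$ and let $\bar H_{\mathfrak{s}}=\langle \bar b^n \bar a^{s_n} \bar b^{-n}: n\geq 0\rangle\leq\bar F$ be the corresponding subgroup. The group $G_{\mathfrak{s}}$ is the double of $F$ along $H_{\mathfrak{s}}$, i.e. the amalgamated product $G_{\mathfrak{s}}=F*_{H_{\mathfrak{s}}=\bar H_{\mathfrak{s}}}\bar F$, where $H_{\mathfrak{s}}$ is identified with $\bar H_{\mathfrak{s}}$ via the restriction of the isomorphism $F\to\bar F$. A group $G$ is residually finite if for each $g\in G$ with $g\neq 1$ there is a finite quotient of $G$ in which the image of $g$ is nontrivial. *)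

theory Defs
  imports Complex_Main "HOL-Algebra.Generated_Groups"
begin

section \<open>Free groups\<close>

text \<open>
  The letter \<open>(True, x)\<close> stands for the generator \<open>x\<close>, the letter \<open>(False, x)\<close> for its
  formal inverse. The free group whose basis is the type \<open>'g\<close> consists of the freely reduced words;
  the product of two reduced words is the reduced form of their concatenation.
\<close>

type_synonym 'g letter = "bool \<times> 'g"

definition letter_inv :: "'g letter \<Rightarrow> 'g letter" where
  "letter_inv l = (\<not> fst l, snd l)"

definition reduced :: "'g letter list \<Rightarrow> bool" where
  "reduced w \<longleftrightarrow> successively (\<lambda>l m. m \<noteq> letter_inv l) w"

fun cancel_cons :: "'g letter \<Rightarrow> 'g letter list \<Rightarrow> 'g letter list" where
  "cancel_cons l [] = [l]"
| "cancel_cons l (m # w) = (if m = letter_inv l then w else l # m # w)"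

definition free_reduce :: "'g letter list \<Rightarrow> 'g letter list" where
  "free_reduce w = foldr cancel_cons w []"

definition free_group :: "'g letter list monoid" where
  "free_group = \<lparr>carrier = {w. reduced w}, mult = (\<lambda>u v. free_reduce (u @ v)), one = []\<rparr>"

definition basis_elem :: "'g \<Rightarrow> 'g letter list" where
  "basis_elem x = [(True, x)]"

lemma letter_inv_letter_inv [simp]: "letter_inv (letter_inv l) = l"
  by (simp add: letter_inv_def)

lemma letter_inv_neq [simp]: "letter_inv l \<noteq> l" "l \<noteq> letter_inv l"
  by (auto simp: letter_inv_def prod_eq_iff)

lemma reduced_Nil [simp]: "reduced []"
  by (simp add: reduced_def)

lemma reduced_ConsD: "reduced (l # w) \<Longrightarrow> reduced w"
  by (cases w) (auto simp: reduced_def)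

lemma reduced_cancel_cons: "reduced w \<Longrightarrow> reduced (cancel_cons l w)"
  by (cases w) (auto simp: reduced_def dest: reduced_ConsD[unfolded reduced_def])

lemma reduced_foldr_cancel_cons: "reduced v \<Longrightarrow> reduced (foldr cancel_cons u v)"
  by (induction u) (auto simp: reduced_cancel_cons)

lemma reduced_free_reduce: "reduced (free_reduce w)"
  by (simp add: free_reduce_def reduced_foldr_cancel_cons)

lemma cancel_cons_reduced: "reduced (l # w) \<Longrightarrow> cancel_cons l w = l # w"
  by (cases w) (auto simp: reduced_def)

lemma free_reduce_id: "reduced w \<Longrightarrow> free_reduce w = w"
proof (induction w)
  case (Cons l w)
  then show ?case
    using reduced_ConsD[OF Cons.prems] by (simp add: free_reduce_def cancel_cons_reduced)
qed (simp add: free_reduce_def)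

lemma cancel_cons_cancel:
  assumes "reduced w"
  shows "cancel_cons l (cancel_cons (letter_inv l) w) = w"
proof (cases w)
  case (Cons m v)
  then show ?thesis
    using assms by (cases v) (auto simp: reduced_def)
qed simp

lemma foldr_cancel_cons_cancel_cons:
  assumes "reduced v"
  shows "foldr cancel_cons (cancel_cons l u) v = cancel_cons l (foldr cancel_cons u v)"
proof (cases u)
  case (Cons m w)
  then show ?thesis
    using cancel_cons_cancel[OF reduced_foldr_cancel_cons[OF assms, of w], of l] by simp
qed simp

lemma foldr_free_reduce:
  "reduced v \<Longrightarrow> foldr cancel_cons (free_reduce u) v = foldr cancel_cons u v"
  by (induction u) (auto simp: free_reduce_def foldr_cancel_cons_cancel_cons)

lemma free_reduce_append_left: "free_reduce (free_reduce u @ v) = free_reduce (u @ v)"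
  using foldr_free_reduce[of "foldr cancel_cons v []" u]
  by (simp add: free_reduce_def reduced_foldr_cancel_cons)

lemma free_reduce_append_right: "free_reduce (u @ free_reduce v) = free_reduce (u @ v)"
  using free_reduce_id[OF reduced_free_reduce[of v]] by (simp add: free_reduce_def)

lemma free_reduce_inverse: "free_reduce (map letter_inv (rev w) @ w) = []"
proof -
  have "foldr cancel_cons (map letter_inv (rev w)) (foldr cancel_cons w v) = v"
    if "reduced v" for v
    using that
  proof (induction w arbitrary: v)
    case (Cons l w)
    then show ?case
      using cancel_cons_cancel[OF reduced_foldr_cancel_cons[OF Cons.prems, of w], of "letter_inv l"]
      by simp
  qed simp
  from this[of "[]"] show ?thesis
    by (simp add: free_reduce_def)
qed

lemma group_free_group: "group free_group"
proof (rule groupI)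
  fix x y z :: "'a letter list"
  show "x \<otimes>\<^bsub>free_group\<^esub> y \<otimes>\<^bsub>free_group\<^esub> z = x \<otimes>\<^bsub>free_group\<^esub> (y \<otimes>\<^bsub>free_group\<^esub> z)"
    by (simp add: free_group_def free_reduce_append_left free_reduce_append_right)
next
  fix x :: "'a letter list"
  show "\<exists>y\<in>carrier free_group. y \<otimes>\<^bsub>free_group\<^esub> x = \<one>\<^bsub>free_group\<^esub>"
    by (rule bexI[of _ "free_reduce (map letter_inv (rev x))"])
      (simp_all add: free_group_def free_reduce_append_left free_reduce_inverse reduced_free_reduce)
qed (auto simp: free_group_def reduced_free_reduce free_reduce_id)


section \<open>Amalgamated products\<close>

text \<open>
  For a subgroup \<open>H\<close> of \<open>G\<close> and an injective homomorphism \<open>\<phi>\<close> from \<open>H\<close> to \<open>K\<close>, the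
  amalgamated product of \<open>G\<close> and \<open>K\<close> in which each \<open>h \<in> H\<close> is identified with \<open>\<phi> h\<close>. It is
  the group of words in the disjoint union of \<open>G\<close> and \<open>K\<close>, modulo the multiplication tables of both
  groups and the relations \<open>h = \<phi> h\<close>. No formal inverses of letters are needed, since every
  letter already has an inverse letter.
\<close>

definition amalg_words :: "('a, 'c) monoid_scheme \<Rightarrow> ('b, 'd) monoid_scheme \<Rightarrow> ('a + 'b) list set"
  where "amalg_words G K = lists (carrier G <+> carrier K)"

inductive amalg_step ::
  "('a, 'c) monoid_scheme \<Rightarrow> ('b, 'd) monoid_scheme \<Rightarrow> 'a set \<Rightarrow> ('a \<Rightarrow> 'b) \<Rightarrow>
    ('a + 'b) list \<Rightarrow> ('a + 'b) list \<Rightarrow> bool"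
  for G K H \<phi> where
  one_left: "amalg_step G K H \<phi> (u @ [Inl \<one>\<^bsub>G\<^esub>] @ v) (u @ v)"
| one_right: "amalg_step G K H \<phi> (u @ [Inr \<one>\<^bsub>K\<^esub>] @ v) (u @ v)"
| mult_left: "x \<in> carrier G \<Longrightarrow> y \<in> carrier G \<Longrightarrow>
    amalg_step G K H \<phi> (u @ [Inl x, Inl y] @ v) (u @ [Inl (x \<otimes>\<^bsub>G\<^esub> y)] @ v)"
| mult_right: "x \<in> carrier K \<Longrightarrow> y \<in> carrier K \<Longrightarrow>
    amalg_step G K H \<phi> (u @ [Inr x, Inr y] @ v) (u @ [Inr (x \<otimes>\<^bsub>K\<^esub> y)] @ v)"
| glue: "h \<in> H \<Longrightarrow> amalg_step G K H \<phi> (u @ [Inl h] @ v) (u @ [Inr (\<phi> h)] @ v)"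

definition amalg_rel ::
  "('a, 'c) monoid_scheme \<Rightarrow> ('b, 'd) monoid_scheme \<Rightarrow> 'a set \<Rightarrow> ('a \<Rightarrow> 'b) \<Rightarrow>
    (('a + 'b) list \<times> ('a + 'b) list) set"
  where "amalg_rel G K H \<phi> =
    {(u, v). u \<in> amalg_words G K \<and> v \<in> amalg_words G K \<and> equivclp (amalg_step G K H \<phi>) u v}"

definition amalgamated_product ::
  "('a, 'c) monoid_scheme \<Rightarrow> ('b, 'd) monoid_scheme \<Rightarrow> 'a set \<Rightarrow> ('a \<Rightarrow> 'b) \<Rightarrow>
    ('a + 'b) list set monoid"
  where "amalgamated_product G K H \<phi> =
    \<lparr>carrier = amalg_words G K // amalg_rel G K H \<phi>,
     mult = (\<lambda>U V. \<Union>u\<in>U. \<Union>v\<in>V. amalg_rel G K H \<phi> `` {u @ v}),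
     one = amalg_rel G K H \<phi> `` {[]}\<rparr>"

lemma equiv_amalg_rel: "equiv (amalg_words G K) (amalg_rel G K H \<phi>)"
  by (rule equivI)
    (auto simp: amalg_rel_def refl_on_def sym_def trans_def intro: equivclp_sym equivclp_trans)

lemma amalg_step_context:
  assumes "amalg_step G K H \<phi> u v"
  shows "amalg_step G K H \<phi> (p @ u @ q) (p @ v @ q)"
  using assms
proof cases
  case (one_left u' v')
  then show ?thesis using amalg_step.one_left[of G K H \<phi> "p @ u'" "v' @ q"] by simp
next
  case (one_right u' v')
  then show ?thesis using amalg_step.one_right[of G K H \<phi> "p @ u'" "v' @ q"] by simp
next
  case (mult_left x y u' v')
  then show ?thesis using amalg_step.mult_left[of x G y K H \<phi> "p @ u'" "v' @ q"] by simp
next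
  case (mult_right x y u' v')
  then show ?thesis using amalg_step.mult_right[of x K y G H \<phi> "p @ u'" "v' @ q"] by simp
next
  case (glue h u' v')
  then show ?thesis using amalg_step.glue[of h H G K \<phi> "p @ u'" "v' @ q"] by simp
qed

lemma equivclp_amalg_step_context:
  assumes "equivclp (amalg_step G K H \<phi>) u v"
  shows "equivclp (amalg_step G K H \<phi>) (p @ u @ q) (p @ v @ q)"
  using assms
proof (induction rule: equivclp_induct)
  case (step v w)
  then have "equivclp (amalg_step G K H \<phi>) (p @ v @ q) (p @ w @ q)"
    by (meson amalg_step_context r_into_equivclp converse_r_into_equivclp)
  with step.IH show ?case by (rule equivclp_trans)
qed simp

lemma amalg_words_append: "u \<in> amalg_words G K \<Longrightarrow> v \<in> amalg_words G K \<Longrightarrow> u @ v \<in> amalg_words G K"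
  by (auto simp: amalg_words_def)

lemma Nil_amalg_words [simp]: "[] \<in> amalg_words G K"
  by (simp add: amalg_words_def)

lemma amalg_rel_append:
  assumes "(u, u') \<in> amalg_rel G K H \<phi>" "(v, v') \<in> amalg_rel G K H \<phi>"
  shows "(u @ v, u' @ v') \<in> amalg_rel G K H \<phi>"
proof -
  have "equivclp (amalg_step G K H \<phi>) (u @ v) (u' @ v)"
    using equivclp_amalg_step_context[of G K H \<phi> u u' "[]" v] assms by (simp add: amalg_rel_def)
  moreover have "equivclp (amalg_step G K H \<phi>) (u' @ v) (u' @ v')"
    using equivclp_amalg_step_context[of G K H \<phi> v v' u' "[]"] assms by (simp add: amalg_rel_def)
  ultimately show ?thesis
    using assms by (auto simp: amalg_rel_def intro: equivclp_trans amalg_words_append)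
qed

lemma amalgamated_product_mult:
  assumes "u \<in> amalg_words G K" "v \<in> amalg_words G K"
  shows "amalg_rel G K H \<phi> `` {u} \<otimes>\<^bsub>amalgamated_product G K H \<phi>\<^esub> amalg_rel G K H \<phi> `` {v}
    = amalg_rel G K H \<phi> `` {u @ v}"
proof -
  have "congruent2 (amalg_rel G K H \<phi>) (amalg_rel G K H \<phi>) (\<lambda>u v. amalg_rel G K H \<phi> `` {u @ v})"
    by (rule congruent2I')
      (metis amalg_rel_append equiv_amalg_rel equiv_class_eq)
  from UN_equiv_class2[OF equiv_amalg_rel equiv_amalg_rel this assms] show ?thesis
    by (simp add: amalgamated_product_def)
qed

lemma group_amalgamated_product:
  fixes G :: "('a, 'c) monoid_scheme" and K :: "('b, 'd) monoid_scheme"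
  assumes "group G" "group K"
  shows "group (amalgamated_product G K H \<phi>)"
proof -
  interpret G: group G by fact
  interpret K: group K by fact
  let ?P = "amalgamated_product G K H \<phi>" and ?W = "amalg_words G K"
  let ?c = "\<lambda>w. amalg_rel G K H \<phi> `` {w}"
  have carrier: "carrier ?P = ?c ` ?W"
    by (auto simp: amalgamated_product_def quotient_def)
  have one: "\<one>\<^bsub>?P\<^esub> = ?c []"
    by (simp add: amalgamated_product_def)
  note mult = amalgamated_product_mult[of _ G K]
  have step: "?c u = ?c v" if "u \<in> ?W" "v \<in> ?W" "amalg_step G K H \<phi> u v" for u v
    using that by (intro equiv_class_eq[OF equiv_amalg_rel]) (auto simp: amalg_rel_def)
  have letter: "\<exists>m. [m] \<in> ?W \<and> ?c [m, l] = ?c []" if l: "[l] \<in> ?W" for l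
  proof (cases l)
    case (Inl x)
    with l have x: "x \<in> carrier G" by (auto simp: amalg_words_def)
    have "?c [Inl (inv\<^bsub>G\<^esub> x), Inl x] = ?c [Inl \<one>\<^bsub>G\<^esub>]"
      using amalg_step.mult_left[of "inv\<^bsub>G\<^esub> x" G x K H \<phi> "[]" "[]"] x
      by (intro step) (auto simp: amalg_words_def)
    also have "\<dots> = ?c []"
      using amalg_step.one_left[of G K H \<phi> "[]" "[]"] by (intro step) (auto simp: amalg_words_def)
    finally show ?thesis
      using Inl x by (intro exI[of _ "Inl (inv\<^bsub>G\<^esub> x)"]) (auto simp: amalg_words_def)
  next
    case (Inr x)
    with l have x: "x \<in> carrier K" by (auto simp: amalg_words_def)
    have "?c [Inr (inv\<^bsub>K\<^esub> x), Inr x] = ?c [Inr \<one>\<^bsub>K\<^esub>]"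
      using amalg_step.mult_right[of "inv\<^bsub>K\<^esub> x" K x G H \<phi> "[]" "[]"] x
      by (intro step) (auto simp: amalg_words_def)
    also have "\<dots> = ?c []"
      using amalg_step.one_right[of G K H \<phi> "[]" "[]"] by (intro step) (auto simp: amalg_words_def)
    finally show ?thesis
      using Inr x by (intro exI[of _ "Inr (inv\<^bsub>K\<^esub> x)"]) (auto simp: amalg_words_def)
  qed
  have inverse: "\<exists>v\<in>?W. ?c (v @ w) = ?c []" if "w \<in> ?W" for w
    using that
  proof (induction w)
    case (Cons l w)
    then have l: "[l] \<in> ?W" and w: "w \<in> ?W" by (auto simp: amalg_words_def)
    from letter[OF l] obtain m where m: "[m] \<in> ?W" "?c [m, l] = ?c []" by blast
    from Cons.IH[OF w] obtain v where v: "v \<in> ?W" "?c (v @ w) = ?c []" by blast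
    have lw: "[m, l] \<in> ?W" using l m by (auto simp: amalg_words_def)
    have "?c ((v @ [m]) @ l # w) = (?c v \<otimes>\<^bsub>?P\<^esub> ?c [m, l]) \<otimes>\<^bsub>?P\<^esub> ?c w"
      using v w lw by (simp add: mult amalg_words_append)
    also have "\<dots> = ?c (v @ w)"
      using v w m by (simp add: mult amalg_words_append)
    finally show ?case
      using v m by (intro bexI[of _ "v @ [m]"]) (auto intro: amalg_words_append)
  qed (auto intro: bexI[of _ "[]"])
  show ?thesis
  proof (rule groupI)
    fix x assume "x \<in> carrier ?P"
    then obtain w where w: "w \<in> ?W" "x = ?c w" by (auto simp: carrier)
    from inverse[OF w(1)] obtain v where v: "v \<in> ?W" "?c (v @ w) = ?c []" by blast
    with w show "\<exists>y\<in>carrier ?P. y \<otimes>\<^bsub>?P\<^esub> x = \<one>\<^bsub>?P\<^esub>"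
      by (intro bexI[of _ "?c v"]) (auto simp: carrier one mult)
  qed (auto simp: carrier one mult amalg_words_append)
qed

text \<open>
  The second copy of \<open>G\<close> is \<open>G\<close> itself: the two factors of an amalgamated product are already
  kept apart by the tags \<open>Inl\<close> and \<open>Inr\<close>, and the isomorphism onto the copy is the identity.
\<close>

definition double_along :: "('a, 'c) monoid_scheme \<Rightarrow> 'a set \<Rightarrow> ('a + 'a) list set monoid" where
  "double_along G H = amalgamated_product G G H id"


section \<open>Finiteness properties of groups\<close>

definition finitely_generated_group :: "('a, 'b) monoid_scheme \<Rightarrow> bool" where
  "finitely_generated_group G \<longleftrightarrow>
    group G \<and> (\<exists>S. finite S \<and> S \<subseteq> carrier G \<and> generate G S = carrier G)"

definition residually_finite :: "('a, 'b) monoid_scheme \<Rightarrow> bool" where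
  "residually_finite G \<longleftrightarrow>
    group G \<and>
    (\<forall>g\<in>carrier G. g \<noteq> \<one>\<^bsub>G\<^esub> \<longrightarrow>
      (\<exists>N. N \<lhd> G \<and> finite (carrier (G Mod N)) \<and> N #>\<^bsub>G\<^esub> g \<noteq> \<one>\<^bsub>G Mod N\<^esub>))"


section \<open>The groups associated with multiplying sequences\<close>

definition multiplying :: "(nat \<Rightarrow> nat) \<Rightarrow> bool" where
  "multiplying s \<longleftrightarrow>
    (\<forall>n. s n > 0) \<and> (\<forall>n. s n dvd s (Suc n)) \<and> filterlim s at_top sequentially"

datatype basis = gen_a | gen_b

abbreviation F2 :: "basis letter list monoid" where
  "F2 \<equiv> free_group"

definition H_seq :: "(nat \<Rightarrow> nat) \<Rightarrow> basis letter list set" where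
  "H_seq s = generate F2
    (range (\<lambda>n. (basis_elem gen_b [^]\<^bsub>F2\<^esub> n) \<otimes>\<^bsub>F2\<^esub> (basis_elem gen_a [^]\<^bsub>F2\<^esub> s n) \<otimes>\<^bsub>F2\<^esub>
      inv\<^bsub>F2\<^esub> (basis_elem gen_b [^]\<^bsub>F2\<^esub> n)))"

definition G_seq :: "(nat \<Rightarrow> nat) \<Rightarrow> (basis letter list + basis letter list) list set monoid" where
  "G_seq s = double_along F2 (H_seq s)"

lemma group_G_seq: "group (G_seq s)"
  by (simp add: G_seq_def double_along_def group_amalgamated_product group_free_group)

end

theory Submission
  imports Defs "HOL-Algebra.Elementary_Groups" "HOL-Combinatorics.Permutations"
begin

text \<open>
  Write \<open>D\<close> for the double of the free group \<open>F\<close> along \<open>H\<close>, with its two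
  embeddings \<open>left\<close> and \<open>right\<close> of \<open>F\<close>. Everything is governed by two
  homomorphisms from \<open>D\<close> onto \<open>F\<close>: the folding map \<open>fold\<close>, which
  identifies the two copies, and the map \<open>stable\<close>, which kills both images of \<open>a\<close> and
  sends the two images of \<open>b\<close> to a basis.

  The kernel of \<open>fold\<close> is generated by the elements \<open>diff x = left x (right
  x)\<inverse>\<close>, which only depend on the coset \<open>x H\<close> and are otherwise independent:
  homomorphisms with arbitrary values on the nontrivial cosets are constructed in wreath products
  (\<open>twisted_double_hom\<close>).

  For residual finiteness, an element outside the kernel of \<open>fold\<close> is detected in \<open>F\<close>.
  An element of the kernel is a reduced word in the \<open>diff x\<close>; finitely many cosets are involved,
  and they stay distinct in a finite permutation representation of \<open>F\<close> in which \<open>H\<close>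
  fixes a point (\<open>separating_representation\<close>). This is where \<open>s n\<close> has to divide
  \<open>s (n + 1)\<close> and to tend to infinity. Since free groups are residually finite, the letters of the
  word can be given values in a finite group in which the word does not vanish, and a finite wreath product
  combines the two (\<open>residually_finite_double\<close>).

  To distinguish the groups, recall that in a free group roots are unique, commutation is transitive on
  nontrivial elements, and an element that commutes with a conjugate of itself commutes with the conjugating
  element; these facts follow by linear algebra from the embedding into the integral matrices of size two. Hence
  every homomorphism from \<open>D\<close> onto \<open>F\<close> either kills both images of \<open>a\<close> or
  factors through \<open>fold\<close> (\<open>surjection_to_F2\<close>). The kernels of \<open>fold\<close> and
  of \<open>stable\<close> cannot be interchanged by an isomorphism, because the abelianization of the second
  one has torsion and that of the first one has none (\<open>no_kernel_exchange\<close>). Thus an isomorphism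
  carries the kernel of one map \<open>stable\<close> into that of the other (\<open>iso_kills_a\<close>).

  It follows that, for a finite group \<open>Q\<close> with a normal subgroup \<open>V\<close>, the number of
  homomorphisms from \<open>D\<close> to \<open>Q\<close> that send both images of \<open>a\<close> into
  \<open>V\<close> is an invariant. Such a homomorphism amounts to \<open>A, A' \<in> V\<close> and \<open>B, B'
  \<in> Q\<close> with \<open>B ^ n A ^ (s n) B ^ (- n) = B' ^ n A' ^ (s n) B' ^ (- n)\<close> for all
  \<open>n\<close>. Let \<open>n\<close> be the first index at which \<open>s\<close> and \<open>t\<close>
  differ, say with \<open>k = t n\<close> not dividing \<open>s n\<close>. If \<open>V\<close> has exponent
  \<open>k\<close>, then the relations for \<open>t\<close> beyond the first \<open>n\<close> ones are void, so
  every solution for \<open>s\<close> is one for \<open>t\<close>. For a suitable wreath product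
  \<open>Q\<close> with base \<open>V\<close> there is a solution for \<open>t\<close> that violates the
  \<open>n\<close>th relation for \<open>s\<close>; so the numbers differ (\<open>solutions_psubset\<close>).
\<close>


section \<open>Homomorphisms out of a free group\<close>

lemmas group_hom_defs = group_hom_def group_hom_axioms_def

context group
begin

definition letter_value :: "('g \<Rightarrow> 'a) \<Rightarrow> 'g letter \<Rightarrow> 'a" where
  "letter_value g l = (if fst l then g (snd l) else inv (g (snd l)))"

definition word_value :: "('g \<Rightarrow> 'a) \<Rightarrow> 'g letter list \<Rightarrow> 'a" where
  "word_value g w = foldr (\<lambda>l y. letter_value g l \<otimes> y) w \<one>"

lemma letter_value_closed [simp]: "range g \<subseteq> carrier G \<Longrightarrow> letter_value g l \<in> carrier G"
  by (auto simp: letter_value_def)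

lemma word_value_Nil [simp]: "word_value g [] = \<one>"
  by (simp add: word_value_def)

lemma word_value_Cons [simp]: "word_value g (l # w) = letter_value g l \<otimes> word_value g w"
  by (simp add: word_value_def)

lemma word_value_closed [simp]: "range g \<subseteq> carrier G \<Longrightarrow> word_value g w \<in> carrier G"
  by (induction w) auto

lemma word_value_append:
  "range g \<subseteq> carrier G \<Longrightarrow> word_value g (u @ v) = word_value g u \<otimes> word_value g v"
  by (induction u) (auto simp: m_assoc)

lemma letter_value_letter_inv:
  "range g \<subseteq> carrier G \<Longrightarrow> letter_value g (letter_inv l) = inv (letter_value g l)"
  by (auto simp: letter_value_def letter_inv_def image_subset_iff)

lemma word_value_inverse:
  "range g \<subseteq> carrier G \<Longrightarrow> word_value g (map letter_inv (rev w)) = inv (word_value g w)"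
  by (induction w) (auto simp: word_value_append letter_value_letter_inv inv_mult_group)

lemma word_value_cancel_cons:
  assumes "range g \<subseteq> carrier G"
  shows "word_value g (cancel_cons l w) = letter_value g l \<otimes> word_value g w"
proof (cases w)
  case (Cons m v)
  then show ?thesis
    using assms by (auto simp: letter_value_letter_inv m_assoc [symmetric])
qed simp

lemma word_value_free_reduce:
  "range g \<subseteq> carrier G \<Longrightarrow> word_value g (free_reduce w) = word_value g w"
  by (induction w) (auto simp: free_reduce_def word_value_cancel_cons)

lemma word_value_hom: "range g \<subseteq> carrier G \<Longrightarrow> word_value g \<in> hom free_group G"
  by (rule homI) (auto simp: free_group_def word_value_free_reduce word_value_append)

lemma word_value_basis_elem [simp]:
  "range g \<subseteq> carrier G \<Longrightarrow> word_value g (basis_elem x) = g x"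
  by (auto simp: basis_elem_def letter_value_def image_subset_iff)

end

lemma carrier_free_group: "carrier free_group = {w. reduced w}"
  by (simp add: free_group_def)

lemma one_free_group: "\<one>\<^bsub>free_group\<^esub> = []"
  by (simp add: free_group_def)

lemma basis_elem_closed [simp]: "basis_elem x \<in> carrier free_group"
  by (simp add: basis_elem_def carrier_free_group reduced_def)

lemma mult_letter_free_group: "[l] \<otimes>\<^bsub>free_group\<^esub> w = cancel_cons l w" if "reduced w"
  using free_reduce_id[OF that] by (simp add: free_group_def free_reduce_def)

lemma inv_basis_elem: "inv\<^bsub>free_group\<^esub> basis_elem x = [(False, x)]"
proof (rule group.inv_equality[OF group_free_group])
  show "[(False, x)] \<otimes>\<^bsub>free_group\<^esub> basis_elem x = \<one>\<^bsub>free_group\<^esub>"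
    by (subst mult_letter_free_group)
      (auto simp: basis_elem_def reduced_def one_free_group letter_inv_def)
qed (auto simp: carrier_free_group reduced_def basis_elem_def)

lemma letter_value_basis_elem: "group.letter_value free_group basis_elem l = [l]"
  by (cases l) (auto simp: group.letter_value_def[OF group_free_group] inv_basis_elem,
      simp add: basis_elem_def)

lemma word_value_basis: "reduced w \<Longrightarrow> group.word_value free_group basis_elem w = w"
proof (induction w)
  case Nil
  show ?case by (simp add: group.word_value_Nil[OF group_free_group] one_free_group)
next
  case (Cons l w)
  have w: "reduced w" by (rule reduced_ConsD[OF Cons.prems])
  have "group.word_value free_group basis_elem (l # w) = [l] \<otimes>\<^bsub>free_group\<^esub> w"
    by (simp add: group.word_value_Cons[OF group_free_group] letter_value_basis_elem Cons.IH[OF w])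
  then show ?case
    by (simp add: mult_letter_free_group w cancel_cons_reduced Cons.prems)
qed

lemma (in group_hom) hom_letter_value:
  "range g \<subseteq> carrier G \<Longrightarrow> h (G.letter_value g l) = H.letter_value (\<lambda>x. h (g x)) l"
  by (auto simp: G.letter_value_def H.letter_value_def image_subset_iff)

lemma (in group_hom) hom_word_value:
  "range g \<subseteq> carrier G \<Longrightarrow> h (G.word_value g w) = H.word_value (\<lambda>x. h (g x)) w"
  by (induction w) (auto simp: hom_letter_value)

lemma hom_free_group_eq_word_value:
  assumes "group Q" "\<alpha> \<in> hom free_group Q" "w \<in> carrier free_group"
  shows "\<alpha> w = group.word_value Q (\<lambda>x. \<alpha> (basis_elem x)) w"
proof -
  interpret group_hom free_group Q \<alpha>
    using assms by (simp add: group_hom_defs group_free_group)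
  show ?thesis
    using hom_word_value[of basis_elem w] word_value_basis[of w] assms(3)
    by (simp add: carrier_free_group [symmetric] image_subset_iff) (simp add: carrier_free_group)
qed

lemma hom_free_group_eqI:
  assumes "group Q" "\<alpha> \<in> hom free_group Q" "\<beta> \<in> hom free_group Q"
    and "\<And>x. \<alpha> (basis_elem x) = \<beta> (basis_elem x)" and "w \<in> carrier free_group"
  shows "\<alpha> w = \<beta> w"
  using hom_free_group_eq_word_value[OF assms(1,2,5)] hom_free_group_eq_word_value[OF assms(1,3,5)]
  by (simp add: assms(4))

lemma generate_free_group: "generate free_group (range basis_elem) = carrier free_group"
proof -
  interpret F: group free_group by (rule group_free_group)
  have "F.letter_value basis_elem l \<in> generate free_group (range basis_elem)" for l :: "'a letter"
    by (auto simp: F.letter_value_def intro: generate.incl generate.inv)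
  then have "F.word_value basis_elem w \<in> generate free_group (range basis_elem)" for w :: "'a letter list"
    by (induction w) (simp_all add: generate.one generate.eng)
  then have "carrier free_group \<subseteq> generate free_group (range (basis_elem :: 'a \<Rightarrow> _))"
    using word_value_basis by (metis carrier_free_group mem_Collect_eq subsetI)
  moreover have "generate free_group (range (basis_elem :: 'a \<Rightarrow> _)) \<subseteq> carrier free_group"
    by (rule F.generate_incl) auto
  ultimately show ?thesis by blast
qed


section \<open>Powers and commutation in the free group of rank two\<close>

abbreviation F2_mult :: "basis letter list \<Rightarrow> basis letter list \<Rightarrow> basis letter list" (infixl "\<cdot>" 70) where
  "x \<cdot> y \<equiv> x \<otimes>\<^bsub>F2\<^esub> y"

abbreviation F2_coset :: "basis letter list \<Rightarrow> basis letter list set \<Rightarrow> basis letter list set" (infixl "\<bullet>" 60) where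
  "x \<bullet> c \<equiv> x <#\<^bsub>F2\<^esub> c"

type_synonym mat2 = "int \<times> int \<times> int \<times> int"

fun mat_mult :: "mat2 \<Rightarrow> mat2 \<Rightarrow> mat2" where
  "mat_mult (a, b, c, d) (a', b', c', d') =
    (a * a' + b * c', a * b' + b * d', c * a' + d * c', c * b' + d * d')"

text \<open>
  The level 3 excludes the matrix \<open>- 1\<close> and makes the trace congruent to 2 modulo 9, hence of
  absolute value at least 2.
\<close>

definition congruence_group :: "mat2 monoid" where
  "congruence_group =
    \<lparr>carrier = {(a, b, c, d). a * d - b * c = 1 \<and> 3 dvd a - 1 \<and> 3 dvd b \<and> 3 dvd c \<and> 3 dvd d - 1},
     monoid.mult = mat_mult, one = (1, 0, 0, 1)\<rparr>"

abbreviation "\<Gamma> \<equiv> congruence_group"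

lemma mat_mult_assoc: "mat_mult (mat_mult x y) z = mat_mult x (mat_mult y z)"
  by (cases x; cases y; cases z) (simp add: algebra_simps)

lemma mult_congruence_group [simp]: "x \<otimes>\<^bsub>\<Gamma>\<^esub> y = mat_mult x y"
  and one_congruence_group [simp]: "\<one>\<^bsub>\<Gamma>\<^esub> = (1, 0, 0, 1)"
  by (simp_all add: congruence_group_def)

lemma carrier_congruence_group:
  "(a, b, c, d) \<in> carrier \<Gamma> \<longleftrightarrow>
    a * d - b * c = 1 \<and> 3 dvd a - 1 \<and> 3 dvd b \<and> 3 dvd c \<and> 3 dvd d - 1"
  by (simp add: congruence_group_def)

lemma group_congruence_group: "group \<Gamma>"
proof (rule groupI)
  fix x y assume x: "x \<in> carrier \<Gamma>" and y: "y \<in> carrier \<Gamma>"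
  obtain a b c d where x': "x = (a, b, c, d)" by (cases x)
  obtain a' b' c' d' where y': "y = (a', b', c', d')" by (cases y)
  have "(a * a' + b * c') * (c * b' + d * d') - (a * b' + b * d') * (c * a' + d * c')
      = (a * d - b * c) * (a' * d' - b' * c')"
    by (simp add: algebra_simps)
  then have "(a * a' + b * c') * (c * b' + d * d') - (a * b' + b * d') * (c * a' + d * c') = 1"
    using x y by (simp add: x' y' carrier_congruence_group)
  moreover have "3 dvd (a - 1) * a' + (a' - 1) + b * c'" "3 dvd c * b' + (d - 1) * d' + (d' - 1)"
    "3 dvd a * b' + b * d'" "3 dvd c * a' + d * c'"
    using x y unfolding x' y' carrier_congruence_group by (auto intro!: dvd_add)
  ultimately show "x \<otimes>\<^bsub>\<Gamma>\<^esub> y \<in> carrier \<Gamma>"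
    unfolding x' y' mult_congruence_group mat_mult.simps carrier_congruence_group
    by (simp add: left_diff_distrib add_diff_eq diff_add_eq)
next
  fix x assume "x \<in> carrier \<Gamma>"
  then show "\<exists>y\<in>carrier \<Gamma>. y \<otimes>\<^bsub>\<Gamma>\<^esub> x = \<one>\<^bsub>\<Gamma>\<^esub>"
    by (cases x) (rule bexI[of _ "(\<lambda>(a, b, c, d). (d, - b, - c, a)) x"],
        auto simp: carrier_congruence_group algebra_simps)
qed (auto simp: carrier_congruence_group mat_mult_assoc)

interpretation \<Gamma>: group \<Gamma>
  by (rule group_congruence_group)

lemma inv_congruence_group:
  "(a, b, c, d) \<in> carrier \<Gamma> \<Longrightarrow> inv\<^bsub>\<Gamma>\<^esub> (a, b, c, d) = (d, - b, - c, a)"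
  by (rule \<Gamma>.inv_equality) (auto simp: carrier_congruence_group algebra_simps)

text \<open>
  Commutation only depends on the traceless parts \<open>(b, c, a - d)\<close>: two matrices commute iff these
  vectors are parallel. As the identity is the only matrix of the group with vanishing traceless part,
  commutation is transitive on the other ones.
\<close>

lemma mat_commute_iff:
  "mat_mult (a, b, c, d) (a', b', c', d') = mat_mult (a', b', c', d') (a, b, c, d) \<longleftrightarrow>
    b * c' = b' * c \<and> b * (a' - d') = b' * (a - d) \<and> c * (a' - d') = c' * (a - d)"
  by (simp add: algebra_simps) (auto simp: algebra_simps)

lemma scalar_congruence_group:
  assumes "(a, 0, 0, a) \<in> carrier \<Gamma>"
  shows "a = 1"
proof -
  have "a * a = 1" and a: "3 dvd a - 1"
    using assms by (simp_all add: carrier_congruence_group)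
  then have "a = 1 \<or> a = - 1"
    by (metis dvd_triv_left zdvd1_eq abs_eq_iff')
  with a show ?thesis by auto
qed

lemma parallel_trans:
  fixes p q r p1 q1 r1 p2 q2 r2 :: int
  assumes "(p, q, r) \<noteq> (0, 0, 0)"
    and "p * q1 = p1 * q" "p * r1 = p1 * r" "q * r1 = q1 * r"
    and "p * q2 = p2 * q" "p * r2 = p2 * r" "q * r2 = q2 * r"
  shows "p1 * q2 = p2 * q1 \<and> p1 * r2 = p2 * r1 \<and> q1 * r2 = q2 * r1"
proof -
  have "p * (p1 * q2 - p2 * q1) = 0" "q * (p1 * q2 - p2 * q1) = 0" "r * (p1 * q2 - p2 * q1) = 0"
    "p * (p1 * r2 - p2 * r1) = 0" "q * (p1 * r2 - p2 * r1) = 0" "r * (p1 * r2 - p2 * r1) = 0"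
    "p * (q1 * r2 - q2 * r1) = 0" "q * (q1 * r2 - q2 * r1) = 0" "r * (q1 * r2 - q2 * r1) = 0"
    using assms(2-7) by algebra+
  with assms(1) show ?thesis by auto
qed

lemma congruence_group_commute_trans:
  assumes "x \<in> carrier \<Gamma>" "x \<noteq> (1, 0, 0, 1)"
    and "mat_mult x y = mat_mult y x" "mat_mult x z = mat_mult z x"
  shows "mat_mult y z = mat_mult z y"
proof -
  obtain a b c d where x: "x = (a, b, c, d)" by (cases x)
  obtain a1 b1 c1 d1 where y: "y = (a1, b1, c1, d1)" by (cases y)
  obtain a2 b2 c2 d2 where z: "z = (a2, b2, c2, d2)" by (cases z)
  have "(b, c, a - d) \<noteq> (0, 0, 0)"
    using assms(1,2) scalar_congruence_group by (auto simp: x)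
  from parallel_trans[OF this, where ?p1.0 = b1 and ?q1.0 = c1 and ?r1.0 = "a1 - d1"
      and ?p2.0 = b2 and ?q2.0 = c2 and ?r2.0 = "a2 - d2"] assms(3,4) show ?thesis
    unfolding x y z mat_commute_iff by blast
qed

text \<open>
  Powers of \<open>x\<close> are combinations \<open>u x - v\<close> of \<open>x\<close> and the identity. As
  the trace of \<open>x\<close> has absolute value at least 2, the coefficients \<open>u\<close> of successive
  powers strictly increase in absolute value. Hence \<open>u \<noteq> 0\<close>, and a power can only be the
  identity if \<open>x\<close> is scalar.
\<close>

lemma congruence_group_pow:
  assumes "(a, b, c, d) \<in> carrier \<Gamma>"
  shows "\<exists>u v. (a, b, c, d) [^]\<^bsub>\<Gamma>\<^esub> Suc k = (u * a - v, u * b, u * c, u * d - v) \<and> \<bar>v\<bar> < \<bar>u\<bar>"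
proof (induction k)
  case 0
  have "(a, b, c, d) [^]\<^bsub>\<Gamma>\<^esub> Suc 0 = (1 * a - 0, 1 * b, 1 * c, 1 * d - 0)"
    by (simp add: \<Gamma>.nat_pow_Suc)
  then show ?case by (intro exI[of _ 1] exI[of _ 0]) simp
next
  case (Suc k)
  have det: "a * d - b * c = 1" and dv: "3 dvd a - 1" "3 dvd b" "3 dvd c" "3 dvd d - 1"
    using assms by (simp_all add: carrier_congruence_group)
  have "9 dvd (a - 1) * (d - 1) - b * c"
    using mult_dvd_mono[OF dv(1,4)] mult_dvd_mono[OF dv(2,3)] by (simp add: dvd_diff)
  then have "9 dvd 2 - (a + d)"
    using det by (simp add: algebra_simps)
  then have tr: "\<bar>a + d\<bar> \<ge> 2" by presburger
  from Suc obtain u v where uv: "(a, b, c, d) [^]\<^bsub>\<Gamma>\<^esub> Suc k = (u * a - v, u * b, u * c, u * d - v)" "\<bar>v\<bar> < \<bar>u\<bar>"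
    by blast
  have ad: "a * d = 1 + b * c" using det by simp
  have "(a, b, c, d) [^]\<^bsub>\<Gamma>\<^esub> Suc (Suc k) = mat_mult (u * a - v, u * b, u * c, u * d - v) (a, b, c, d)"
    using uv(1) by (simp only: nat_pow_Suc mult_congruence_group)
  also have "\<dots> = ((u * (a + d) - v) * a - u, (u * (a + d) - v) * b, (u * (a + d) - v) * c, (u * (a + d) - v) * d - u)"
    using ad by simp (algebra)
  finally have pow: "(a, b, c, d) [^]\<^bsub>\<Gamma>\<^esub> Suc (Suc k) =
    ((u * (a + d) - v) * a - u, (u * (a + d) - v) * b, (u * (a + d) - v) * c, (u * (a + d) - v) * d - u)" .
  have "2 * \<bar>u\<bar> \<le> \<bar>u * (a + d)\<bar>"
    using mult_left_mono[OF tr, of "\<bar>u\<bar>"] by (simp add: abs_mult)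
  then have "\<bar>u\<bar> < \<bar>u * (a + d) - v\<bar>" using uv(2) by linarith
  with pow show ?case by blast
qed

lemma congruence_group_torsion_free:
  fixes k :: nat
  assumes "x \<in> carrier \<Gamma>" "x [^]\<^bsub>\<Gamma>\<^esub> k = (1, 0, 0, 1)" "k > 0"
  shows "x = (1, 0, 0, 1)"
proof -
  obtain a b c d where x: "x = (a, b, c, d)" by (cases x)
  obtain k' where "k = Suc k'" using assms(3) by (cases k) auto
  then obtain u v where uv: "(u * a - v, u * b, u * c, u * d - v) = (1, 0, 0, 1)" "\<bar>v\<bar> < \<bar>u\<bar>"
    using congruence_group_pow[of a b c d k'] assms(1,2) x by (metis (no_types, lifting))
  moreover have "u * a = u * d"
    using uv(1) by (auto simp: algebra_simps)
  ultimately have "b = 0" "c = 0" "a = d" by auto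
  with assms(1) show ?thesis
    using scalar_congruence_group x by blast
qed

lemma gcd3_mult_distrib:
  fixes n b c e :: int
  shows "\<bar>n\<bar> * gcd b (gcd c e) = gcd (n * b) (gcd (n * c) (n * e))"
proof -
  have "gcd (n * b) (gcd (n * c) (n * e)) = gcd (\<bar>n\<bar> * b) (\<bar>n\<bar> * gcd c e)"
    by (simp add: gcd_mult_distrib_int [symmetric] abs_if)
  then show ?thesis
    by (simp add: gcd_mult_distrib_int [symmetric])
qed

text \<open>
  Conjugation by an integral matrix preserves the greatest common divisor of the entries of the traceless part.
  Hence a conjugate of \<open>x\<close> that is parallel to \<open>x\<close> has the same traceless part up to
  sign, and being of the same trace and determinant it is \<open>x\<close> or the inverse of \<open>x\<close>.
\<close>

lemma congruence_group_commute_conj: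
  assumes x: "x \<in> carrier \<Gamma>" and y: "y \<in> carrier \<Gamma>"
    and comm: "mat_mult x (inv\<^bsub>\<Gamma>\<^esub> y \<otimes>\<^bsub>\<Gamma>\<^esub> x \<otimes>\<^bsub>\<Gamma>\<^esub> y) = mat_mult (inv\<^bsub>\<Gamma>\<^esub> y \<otimes>\<^bsub>\<Gamma>\<^esub> x \<otimes>\<^bsub>\<Gamma>\<^esub> y) x"
  shows "inv\<^bsub>\<Gamma>\<^esub> y \<otimes>\<^bsub>\<Gamma>\<^esub> x \<otimes>\<^bsub>\<Gamma>\<^esub> y = x \<or> inv\<^bsub>\<Gamma>\<^esub> y \<otimes>\<^bsub>\<Gamma>\<^esub> x \<otimes>\<^bsub>\<Gamma>\<^esub> y = inv\<^bsub>\<Gamma>\<^esub> x"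
proof -
  obtain a b c d where x': "x = (a, b, c, d)" by (cases x)
  obtain p q r t where y': "y = (p, q, r, t)" by (cases y)
  have inv_x: "inv\<^bsub>\<Gamma>\<^esub> x = (d, - b, - c, a)" and inv_y: "inv\<^bsub>\<Gamma>\<^esub> y = (t, - q, - r, p)"
    using x y by (simp_all add: x' y' inv_congruence_group)
  have det: "p * t = 1 + q * r"
    using y by (simp add: y' carrier_congruence_group)
  define b' where "b' = t * t * b - q * q * c + t * q * (a - d)"
  define c' where "c' = p * p * c - r * r * b - r * p * (a - d)"
  define e' where "e' = 2 * t * r * b - 2 * q * p * c + (p * t + q * r) * (a - d)"
  obtain a1 b1 c1 d1 where z: "inv\<^bsub>\<Gamma>\<^esub> y \<otimes>\<^bsub>\<Gamma>\<^esub> x \<otimes>\<^bsub>\<Gamma>\<^esub> y = (a1, b1, c1, d1)"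
    by (cases "inv\<^bsub>\<Gamma>\<^esub> y \<otimes>\<^bsub>\<Gamma>\<^esub> x \<otimes>\<^bsub>\<Gamma>\<^esub> y")
  have z': "a1 = (t * a - q * c) * p + (t * b - q * d) * r" "b1 = (t * a - q * c) * q + (t * b - q * d) * t"
    "c1 = (p * c - r * a) * p + (p * d - r * b) * r" "d1 = (p * c - r * a) * q + (p * d - r * b) * t"
    using z[unfolded inv_y, unfolded x' y'] by auto
  have conj: "b1 = b'" "c1 = c'" "a1 - d1 = e'" "a1 + d1 = a + d"
    using det unfolding z' b'_def c'_def e'_def by algebra+
  \<comment> \<open>the traceless part of \<open>x\<close> is recovered by conjugating back\<close>
  have undo: "b = p * p * b' - q * q * c' - p * q * e'" "c = t * t * c' - r * r * b' + r * t * e'"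
    "a - d = - 2 * p * r * b' + 2 * q * t * c' + (p * t + q * r) * e'"
    using det unfolding b'_def c'_def e'_def by algebra+
  define g where "g = gcd b (gcd c (a - d))"
  define g' where "g' = gcd b' (gcd c' e')"
  have "g dvd b" "g dvd c" "g dvd a - d"
    unfolding g_def by (meson gcd_dvd1 gcd_dvd2 dvd_trans)+
  then have "g dvd b'" "g dvd c'" "g dvd e'"
    unfolding b'_def c'_def e'_def by (auto intro!: dvd_diff dvd_add)
  then have gg': "g dvd g'" unfolding g'_def by simp
  have "g' dvd b'" "g' dvd c'" "g' dvd e'"
    unfolding g'_def by (meson gcd_dvd1 gcd_dvd2 dvd_trans)+
  then have "g' dvd b" "g' dvd c" "g' dvd a - d"
    unfolding undo by (auto intro!: dvd_diff dvd_add)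
  then have "g' dvd g" unfolding g_def by simp
  with gg' have g: "g = g'"
    by (metis g_def g'_def gcd_ge_0_int zdvd_antisym_nonneg)
  have par: "b * c' = b' * c" "b * e' = b' * (a - d)" "c * e' = c' * (a - d)"
    using comm[unfolded z, unfolded x' mat_commute_iff conj] by simp_all
  \<comment> \<open>proportional vectors of the same content agree up to sign\<close>
  have scale: "\<bar>n\<bar> * g = \<bar>m\<bar> * g'" if "n * b = m * b'" "n * c = m * c'" "n * (a - d) = m * e'" for n m
  proof -
    have "\<bar>n\<bar> * g = gcd (n * b) (gcd (n * c) (n * (a - d)))"
      unfolding g_def by (rule gcd3_mult_distrib)
    also have "\<dots> = \<bar>m\<bar> * g'"
      unfolding that g'_def by (rule gcd3_mult_distrib [symmetric])
    finally show ?thesis .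
  qed
  have sign: "(b', c', e') = (b, c, a - d) \<or> (b', c', e') = (- b, - c, - (a - d))"
  proof (cases "g = 0")
    case True
    then have "b = 0" "c = 0" "a - d = 0" "b' = 0" "c' = 0" "e' = 0"
      using g unfolding g_def g'_def by auto
    then show ?thesis by simp
  next
    case False
    have *: ?thesis if "n * b = m * b'" "n * c = m * c'" "n * (a - d) = m * e'" "n \<noteq> 0" for n m
    proof -
      have "\<bar>n\<bar> = \<bar>m\<bar>" using scale[OF that(1-3)] False g by simp
      then have "n = m \<or> n = - m" by linarith
      then show ?thesis
      proof
        assume "n = m" then show ?thesis using that by simp
      next
        assume "n = - m"
        then have "m * (b + b') = 0" "m * (c + c') = 0" "m * (a - d + e') = 0" "m \<noteq> 0"
          using that by (auto simp: algebra_simps)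
        then have "b' = - b" "c' = - c" "e' = - (a - d)" by auto
        then show ?thesis by simp
      qed
    qed
    have "b' \<noteq> 0 \<or> c' \<noteq> 0 \<or> e' \<noteq> 0"
      using False g by (auto simp: g'_def)
    then show ?thesis
      using *[of b' b] *[of c' c] *[of e' "a - d"] par by (auto simp: mult.commute)
  qed
  then show ?thesis
  proof
    assume "(b', c', e') = (b, c, a - d)"
    then have "(a1, b1, c1, d1) = x" using conj by (auto simp: x')
    then show ?thesis unfolding z by simp
  next
    assume "(b', c', e') = (- b, - c, - (a - d))"
    then have "(a1, b1, c1, d1) = inv\<^bsub>\<Gamma>\<^esub> x" using conj by (auto simp: inv_x)
    then show ?thesis unfolding z by simp
  qed
qed

text \<open>
  The matrices of the generators play ping-pong on the plane: each of the four letters sends every vector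
  outside the sector of its inverse into its own sector. The vector \<open>(1, 1)\<close> lies in none of the
  sectors, so that no nonempty reduced word fixes it.
\<close>

fun sanov :: "basis \<Rightarrow> mat2" where
  "sanov gen_a = (1, 3, 0, 1)"
| "sanov gen_b = (1, 0, 3, 1)"

fun mat_apply :: "mat2 \<Rightarrow> int \<times> int \<Rightarrow> int \<times> int" where
  "mat_apply (a, b, c, d) (x, y) = (a * x + b * y, c * x + d * y)"

fun sector :: "basis letter \<Rightarrow> (int \<times> int) set" where
  "sector (p, gen_a) = {(x, y). \<bar>y\<bar> < \<bar>x\<bar> \<and> (if p then 0 < x * y else x * y < 0)}"
| "sector (p, gen_b) = {(x, y). \<bar>x\<bar> < \<bar>y\<bar> \<and> (if p then 0 < x * y else x * y < 0)}"

lemma mat_apply_mult: "mat_apply (mat_mult m n) v = mat_apply m (mat_apply n v)"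
  by (cases m; cases n; cases v) (simp add: algebra_simps)

lemma range_sanov [simp]: "range sanov \<subseteq> carrier \<Gamma>"
proof -
  have "sanov x \<in> carrier \<Gamma>" for x
    by (cases x) (auto simp: carrier_congruence_group)
  then show ?thesis by auto
qed

lemma letter_value_sanov:
  "\<Gamma>.letter_value sanov (p, x) =
    (case x of gen_a \<Rightarrow> (1, if p then 3 else - 3, 0, 1) | gen_b \<Rightarrow> (1, 0, if p then 3 else - 3, 1))"
proof -
  have "(1, 3, 0, 1) \<in> carrier \<Gamma>" "(1, 0, 3, 1) \<in> carrier \<Gamma>"
    by (auto simp: carrier_congruence_group)
  then show ?thesis
    by (cases x) (auto simp: \<Gamma>.letter_value_def inv_congruence_group)
qed

lemma shear_sector:
  fixes x y :: int
  assumes "x * y > 0 \<or> x * y < 0 \<and> \<bar>x\<bar> \<le> \<bar>y\<bar>"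
  shows "\<bar>y\<bar> < \<bar>x + 3 * y\<bar> \<and> 0 < (x + 3 * y) * y"
proof -
  have "\<bar>y\<bar> < \<bar>x + 3 * y\<bar> \<and> (0 < x + 3 * y \<and> 0 < y \<or> x + 3 * y < 0 \<and> y < 0)"
    using assms unfolding zero_less_mult_iff mult_less_0_iff by arith
  then show ?thesis by (simp add: zero_less_mult_iff)
qed

lemma letter_sector:
  assumes "m \<noteq> letter_inv l" "v \<in> sector m \<or> v = (1, 1)"
  shows "mat_apply (\<Gamma>.letter_value sanov l) v \<in> sector l"
proof -
  obtain p g where l: "l = (p, g)" by (cases l)
  obtain q g' where m: "m = (q, g')" by (cases m)
  obtain x y where v: "v = (x, y)" by (cases v)
  define e :: int where "e = (if p then 1 else - 1)"
  show ?thesis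
  proof (cases g)
    case gen_a
    have "x * (e * y) > 0 \<or> x * (e * y) < 0 \<and> \<bar>x\<bar> \<le> \<bar>e * y\<bar>"
      using assms unfolding l m v gen_a e_def letter_inv_def
      by (cases g'; cases p; cases q) auto
    from shear_sector[OF this] show ?thesis
      unfolding l v gen_a letter_value_sanov e_def by (cases p) auto
  next
    case gen_b
    have "y * (e * x) > 0 \<or> y * (e * x) < 0 \<and> \<bar>y\<bar> \<le> \<bar>e * x\<bar>"
      using assms unfolding l m v gen_b e_def letter_inv_def
      by (cases g'; cases p; cases q) (auto simp: mult.commute)
    from shear_sector[OF this] show ?thesis
      unfolding l v gen_b letter_value_sanov e_def by (cases p) (auto simp: algebra_simps)
  qed
qed

lemma word_sector: "reduced (l # w) \<Longrightarrow> mat_apply (\<Gamma>.word_value sanov (l # w)) (1, 1) \<in> sector l"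
proof (induction w arbitrary: l)
  case Nil
  then show ?case
    using letter_sector[of l l "(1, 1)"] by (auto simp: mat_apply_mult)
next
  case (Cons m w)
  have "mat_apply (\<Gamma>.word_value sanov (m # w)) (1, 1) \<in> sector m"
    by (rule Cons.IH[OF reduced_ConsD[OF Cons.prems]])
  moreover have "m \<noteq> letter_inv l" using Cons.prems by (simp add: reduced_def)
  ultimately show ?case
    using letter_sector[of m l] by (auto simp: mat_apply_mult)
qed

lemma sanov_faithful:
  assumes "w \<in> carrier F2" "\<Gamma>.word_value sanov w = (1, 0, 0, 1)"
  shows "w = \<one>\<^bsub>F2\<^esub>"
proof (cases w)
  case (Cons l v)
  have "(1, 1) \<in> sector l"
    using word_sector[of l v] assms by (simp add: Cons carrier_free_group)
  then show ?thesis
    by (cases l rule: sector.cases) auto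
qed (simp add: one_free_group)

interpretation F: group free_group
  by (rule group_free_group)

interpretation sanov: group_hom F2 \<Gamma> "\<Gamma>.word_value sanov"
  by (simp add: group_hom_defs group_free_group group_congruence_group \<Gamma>.word_value_hom)

lemma sanov_inj:
  assumes "x \<in> carrier F2" "y \<in> carrier F2" "\<Gamma>.word_value sanov x = \<Gamma>.word_value sanov y"
  shows "x = y"
proof -
  have "\<Gamma>.word_value sanov (x \<cdot> inv\<^bsub>F2\<^esub> y) = \<one>\<^bsub>\<Gamma>\<^esub>"
    using assms by (simp only: sanov.hom_mult sanov.hom_inv F.inv_closed \<Gamma>.r_inv sanov.hom_closed)
  then have "x \<cdot> inv\<^bsub>F2\<^esub> y = \<one>\<^bsub>F2\<^esub>"
    using sanov_faithful assms by simp
  then show ?thesis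
    using assms by (metis F.inv_equality F.inv_inv F.inv_closed)
qed

lemma sanov_commute_iff:
  assumes "x \<in> carrier F2" "y \<in> carrier F2"
  shows "x \<cdot> y = y \<cdot> x \<longleftrightarrow>
    mat_mult (\<Gamma>.word_value sanov x) (\<Gamma>.word_value sanov y) =
    mat_mult (\<Gamma>.word_value sanov y) (\<Gamma>.word_value sanov x)"
  using assms sanov_inj[of "x \<cdot> y" "y \<cdot> x"] sanov.hom_mult[of x y] sanov.hom_mult[of y x]
  by (metis F.m_closed mult_congruence_group)

lemma F2_torsion_free:
  fixes k :: nat
  assumes "x \<in> carrier F2" "x [^]\<^bsub>F2\<^esub> k = \<one>\<^bsub>F2\<^esub>" "k > 0"
  shows "x = \<one>\<^bsub>F2\<^esub>"
proof -
  have "\<Gamma>.word_value sanov x [^]\<^bsub>\<Gamma>\<^esub> k = (1, 0, 0, 1)"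
    using assms sanov.hom_nat_pow[of x k] sanov.hom_one by simp
  then show ?thesis
    using congruence_group_torsion_free assms sanov_faithful sanov.hom_closed by blast
qed

lemma F2_commute_trans:
  assumes "x \<in> carrier F2" "y \<in> carrier F2" "z \<in> carrier F2" "x \<noteq> \<one>\<^bsub>F2\<^esub>"
    and "x \<cdot> y = y \<cdot> x" "x \<cdot> z = z \<cdot> x"
  shows "y \<cdot> z = z \<cdot> y"
proof -
  have "\<Gamma>.word_value sanov x \<noteq> (1, 0, 0, 1)"
    using assms(1,4) sanov_faithful by blast
  from congruence_group_commute_trans[OF sanov.hom_closed[OF assms(1)] this] show ?thesis
    using assms(5,6) unfolding sanov_commute_iff[OF assms(1,2)] sanov_commute_iff[OF assms(1,3)]
      sanov_commute_iff[OF assms(2,3)] by blast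
qed

lemma (in group) pow_mult_commuting:
  fixes k :: nat
  assumes "x \<in> carrier G" "y \<in> carrier G" "x \<otimes> y = y \<otimes> x"
  shows "(x \<otimes> inv y) [^] k = x [^] k \<otimes> inv (y [^] k)"
proof -
  have "x \<otimes> inv y = inv y \<otimes> x"
    using assms inv_solve_left[of "x \<otimes> inv y" y x] inv_solve_right[of x "y \<otimes> x" y]
    by (simp add: m_assoc)
  then have "(x \<otimes> inv y) [^] k = x [^] k \<otimes> (inv y) [^] k"
    using assms by (intro pow_mult_distrib) auto
  then show ?thesis
    using assms by (simp add: nat_pow_inv)
qed

lemma (in group) pow_commutes_self:
  fixes k :: nat
  assumes "x \<in> carrier G"
  shows "x [^] k \<otimes> x = x \<otimes> x [^] k"
  using assms by (metis nat_pow_Suc nat_pow_Suc2)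

text \<open>
  Both \<open>x\<close> and \<open>y\<close> commute with their common power; so they commute with each other,
  and \<open>x y\<inverse>\<close> is a torsion element.
\<close>

lemma F2_unique_roots:
  fixes k :: nat
  assumes x: "x \<in> carrier F2" and y: "y \<in> carrier F2" and eq: "x [^]\<^bsub>F2\<^esub> k = y [^]\<^bsub>F2\<^esub> k" and k: "k > 0"
  shows "x = y"
proof (cases "x [^]\<^bsub>F2\<^esub> k = \<one>\<^bsub>F2\<^esub>")
  case True
  then have "x = \<one>\<^bsub>F2\<^esub>" "y = \<one>\<^bsub>F2\<^esub>"
    using F2_torsion_free[OF x _ k] F2_torsion_free[OF y _ k] eq by auto
  then show ?thesis by simp
next
  case False
  have "x [^]\<^bsub>F2\<^esub> k \<cdot> y = y \<cdot> x [^]\<^bsub>F2\<^esub> k"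
    unfolding eq by (rule F.pow_commutes_self[OF y])
  then have "x \<cdot> y = y \<cdot> x"
    by (rule F2_commute_trans[OF F.nat_pow_closed[OF x] x y False F.pow_commutes_self[OF x]])
  then have "(x \<cdot> inv\<^bsub>F2\<^esub> y) [^]\<^bsub>F2\<^esub> k = \<one>\<^bsub>F2\<^esub>"
    using F.pow_mult_commuting[OF x y] x y eq by simp
  then have "x \<cdot> inv\<^bsub>F2\<^esub> y = \<one>\<^bsub>F2\<^esub>"
    using F2_torsion_free[OF _ _ k] x y by simp
  then show ?thesis
    using x y F.inv_solve_right[of "\<one>\<^bsub>F2\<^esub>" x y] by simp
qed

lemma F2_commute_pow:
  fixes k :: nat
  assumes x: "x \<in> carrier F2" and y: "y \<in> carrier F2"
    and comm: "x [^]\<^bsub>F2\<^esub> k \<cdot> y = y \<cdot> x [^]\<^bsub>F2\<^esub> k" and k: "k > 0"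
  shows "x \<cdot> y = y \<cdot> x"
proof (cases "x = \<one>\<^bsub>F2\<^esub>")
  case False
  then have "x [^]\<^bsub>F2\<^esub> k \<noteq> \<one>\<^bsub>F2\<^esub>" using F2_torsion_free[OF x _ k] by blast
  then show ?thesis
    by (rule F2_commute_trans[rotated 3]) (use x y comm F.pow_commutes_self[of x k] in auto)
qed (use y in simp)

text \<open>
  The conjugate is \<open>x\<close> or its inverse, as this holds for matrices, and the second case only occurs
  for trivial \<open>x\<close>.
\<close>

lemma F2_commute_conj:
  assumes x: "x \<in> carrier F2" and y: "y \<in> carrier F2"
    and comm: "x \<cdot> (inv\<^bsub>F2\<^esub> y \<cdot> x \<cdot> y) = (inv\<^bsub>F2\<^esub> y \<cdot> x \<cdot> y) \<cdot> x"
  shows "x \<cdot> y = y \<cdot> x"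
proof -
  let ?z = "inv\<^bsub>F2\<^esub> y \<cdot> x \<cdot> y"
  have z: "?z \<in> carrier F2" using x y by simp
  have val: "\<Gamma>.word_value sanov ?z =
    inv\<^bsub>\<Gamma>\<^esub> (\<Gamma>.word_value sanov y) \<otimes>\<^bsub>\<Gamma>\<^esub> \<Gamma>.word_value sanov x \<otimes>\<^bsub>\<Gamma>\<^esub> \<Gamma>.word_value sanov y"
    using x y by (simp only: sanov.hom_mult sanov.hom_inv F.inv_closed F.m_closed)
  have "\<Gamma>.word_value sanov ?z = \<Gamma>.word_value sanov x \<or>
      \<Gamma>.word_value sanov ?z = inv\<^bsub>\<Gamma>\<^esub> (\<Gamma>.word_value sanov x)"
    using comm unfolding sanov_commute_iff[OF x z] val
    by (intro congruence_group_commute_conj sanov.hom_closed x y)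
  then have "?z = x \<or> ?z = inv\<^bsub>F2\<^esub> x"
    using x z sanov_inj[OF z x] sanov_inj[OF z F.inv_closed[OF x]] by (auto simp: sanov.hom_inv)
  moreover have conj: "x \<cdot> y = y \<cdot> ?z"
    using x y by (simp add: F.m_assoc [symmetric])
  moreover have ?thesis if inv: "?z = inv\<^bsub>F2\<^esub> x"
  proof -
    \<comment> \<open>here \<open>y\<^sup>2\<close> commutes with \<open>x\<close>, hence so does its root \<open>y\<close>\<close>
    have xy: "x \<cdot> y = y \<cdot> inv\<^bsub>F2\<^esub> x"
      using conj unfolding inv .
    then have "y = x \<cdot> (y \<cdot> x)"
      using x y by (simp add: F.m_assoc F.m_assoc [of x y x, symmetric])
    then have yx: "inv\<^bsub>F2\<^esub> x \<cdot> y = y \<cdot> x"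
      using x y F.inv_solve_left[of "y \<cdot> x" x y] by simp
    have sq: "y [^]\<^bsub>F2\<^esub> (2::nat) = y \<cdot> y"
      using y by (simp add: numeral_2_eq_2)
    have "x \<cdot> (y \<cdot> y) = y \<cdot> (inv\<^bsub>F2\<^esub> x \<cdot> y)"
      using x y xy F.m_assoc[of x y y] F.m_assoc[of y "inv\<^bsub>F2\<^esub> x" y] by simp
    also have "\<dots> = y \<cdot> y \<cdot> x"
      using x y unfolding yx by (simp add: F.m_assoc)
    finally have "(y [^]\<^bsub>F2\<^esub> (2::nat)) \<cdot> x = x \<cdot> (y [^]\<^bsub>F2\<^esub> (2::nat))"
      unfolding sq by simp
    from F2_commute_pow[OF y x this] show ?thesis by simp
  qed
  ultimately show ?thesis by auto
qed

lemma F2_noncommutative: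
  "basis_elem gen_a \<cdot> basis_elem gen_b \<noteq> basis_elem gen_b \<cdot> basis_elem gen_a"
  by (simp add: free_group_def basis_elem_def free_reduce_def letter_inv_def)

section \<open>Finite permutation representations\<close>

definition perm_group :: "'a set \<Rightarrow> ('a \<Rightarrow> 'a) monoid" where
  "perm_group S = \<lparr>carrier = {p. p permutes S}, monoid.mult = (\<circ>), one = id\<rparr>"

lemma carrier_perm_group [simp]: "p \<in> carrier (perm_group S) \<longleftrightarrow> p permutes S"
  and mult_perm_group [simp]: "p \<otimes>\<^bsub>perm_group S\<^esub> q = p \<circ> q"
  and one_perm_group [simp]: "\<one>\<^bsub>perm_group S\<^esub> = id"
  by (simp_all add: perm_group_def)

lemma group_perm_group: "group (perm_group S)"
proof (rule groupI)
  fix p assume "p \<in> carrier (perm_group S)"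
  then show "\<exists>q\<in>carrier (perm_group S). q \<otimes>\<^bsub>perm_group S\<^esub> p = \<one>\<^bsub>perm_group S\<^esub>"
    by (intro bexI[of _ "inv_into UNIV p"]) (auto simp: permutes_inv permutes_inv_o)
qed (auto simp: permutes_compose permutes_id comp_assoc)

lemma inv_perm_group:
  assumes "p permutes S"
  shows "inv\<^bsub>perm_group S\<^esub> p = inv_into UNIV p"
  using assms by (intro group.inv_equality[OF group_perm_group]) (auto simp: permutes_inv permutes_inv_o)

lemma finite_perm_group: "finite S \<Longrightarrow> finite (carrier (perm_group S))"
  by (simp add: perm_group_def finite_permutations)

lemma partial_injection_extends:
  assumes S: "finite S" and D: "D \<subseteq> S" and inj: "inj_on g D" and im: "g ` D \<subseteq> S"
  obtains \<pi> where "\<pi> permutes S" "\<And>x. x \<in> D \<Longrightarrow> \<pi> x = g x"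
proof -
  have "card (S - D) = card (S - g ` D)"
    using S D im card_image[OF inj] by (simp add: card_Diff_subset finite_subset)
  then obtain h where h: "bij_betw h (S - D) (S - g ` D)"
    using S finite_same_card_bij[of "S - D" "S - g ` D"] by auto
  define \<pi> where "\<pi> x = (if x \<in> D then g x else if x \<in> S then h x else x)" for x
  have "bij_betw \<pi> D (g ` D)"
    using inj by (auto simp: bij_betw_def \<pi>_def inj_on_def)
  moreover have "bij_betw \<pi> (S - D) (S - g ` D)"
    using h by (rule bij_betw_cong[THEN iffD1, rotated]) (auto simp: \<pi>_def)
  ultimately have "bij_betw \<pi> (D \<union> (S - D)) (g ` D \<union> (S - g ` D))"
    by (rule bij_betw_combine) auto
  then have "bij_betw \<pi> S S"
    using D im by (simp add: Un_absorb1 Un_Diff_cancel)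
  then have "\<pi> permutes S"
    using D by (intro bij_imp_permutes) (auto simp: \<pi>_def)
  then show thesis
    by (rule that) (simp add: \<pi>_def)
qed

text \<open>
  To follow a word it suffices that the permutations agree with a given action of the letters as long as one
  stays within a set \<open>T\<close> of points.
\<close>

lemma perm_word_follows:
  assumes perm: "\<And>x. \<pi> x permutes S"
    and agree: "\<And>g x. x \<in> T \<Longrightarrow> act (True, g) x \<in> T \<Longrightarrow> \<pi> g x = act (True, g) x"
    and inverse: "\<And>l x. x \<in> T \<Longrightarrow> act (letter_inv l) (act l x) = x"
    and suffixes: "\<And>u v. w = u @ v \<Longrightarrow> foldr act v x \<in> T"
  shows "group.word_value (perm_group S) \<pi> w x = foldr act w x"
proof -
  interpret P: group "perm_group S" by (rule group_perm_group)
  have letter: "P.letter_value \<pi> l y = act l y" if "y \<in> T" "act l y \<in> T" for l y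
  proof (cases l)
    case (Pair p g)
    show ?thesis
    proof (cases p)
      case True
      then show ?thesis using that agree by (simp add: Pair P.letter_value_def)
    next
      case False
      then have "act (True, g) (act l y) = y"
        using inverse[OF that(1), of l] by (simp add: Pair letter_inv_def)
      with agree[OF that(2), of g] that(1) have "\<pi> g (act l y) = y" by simp
      then show ?thesis
        using False by (simp add: Pair P.letter_value_def inv_perm_group[OF perm] permutes_inv_eq[OF perm])
    qed
  qed
  from suffixes show ?thesis
  proof (induction w)
    case (Cons l w)
    have "P.word_value \<pi> w x = foldr act w x"
      by (rule Cons.IH) (metis Cons.prems append_Cons)
    moreover have "foldr act w x \<in> T" "act l (foldr act w x) \<in> T"
      using Cons.prems[of "[l]" w] Cons.prems[of "[]" "l # w"] by auto
    ultimately show ?case using letter by simp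
  qed simp
qed

lemma finite_suffixes: "finite {v. \<exists>u. w = u @ v}"
proof -
  have "{v. \<exists>u. w = u @ v} \<subseteq> (\<lambda>n. drop n w) ` {..length w}"
  proof
    fix v assume "v \<in> {v. \<exists>u. w = u @ v}"
    then obtain u where "w = u @ v" by auto
    then show "v \<in> (\<lambda>n. drop n w) ` {..length w}"
      by (intro image_eqI[of _ _ "length u"]) auto
  qed
  then show ?thesis by (rule finite_subset) simp
qed

lemma reduced_appendD: "reduced (u @ v) \<Longrightarrow> reduced v"
  by (induction u) (auto dest: reduced_ConsD)

lemma foldr_cancel_cons_id: "reduced w \<Longrightarrow> foldr cancel_cons w [] = w"
  using free_reduce_id[of w] by (simp add: free_reduce_def)

text \<open>
  Left multiplication by the generators restricts to partial injections of the finite set of suffixes of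
  \<open>w\<close>, and permutations extending them send the empty word to \<open>w\<close>.
\<close>

lemma free_group_residually_finite:
  fixes w :: "'g letter list"
  assumes w: "reduced w" "w \<noteq> []"
  obtains S :: "'g letter list set" and \<pi>
  where "finite S" "\<And>x. \<pi> x permutes S" "group.word_value (perm_group S) \<pi> w \<noteq> id"
proof -
  define S where "S = {v. \<exists>u. w = u @ v}"
  have S: "finite S" unfolding S_def by (rule finite_suffixes)
  have red: "reduced v" if "v \<in> S" for v
    using that w reduced_appendD by (auto simp: S_def)
  have inverse: "cancel_cons (letter_inv l) (cancel_cons l v) = v" if "v \<in> S" for l v
    using cancel_cons_cancel[OF red[OF that], of "letter_inv l"] by simp
  have "\<exists>p. p permutes S \<and> (\<forall>v\<in>S. cancel_cons (True, x) v \<in> S \<longrightarrow> p v = cancel_cons (True, x) v)" for x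
  proof -
    have "inj_on (cancel_cons (True, x)) {v \<in> S. cancel_cons (True, x) v \<in> S}"
      by (rule inj_on_inverseI[of _ "cancel_cons (letter_inv (True, x))"]) (use inverse in auto)
    from partial_injection_extends[OF S _ this] obtain p where "p permutes S"
      "\<And>v. v \<in> {v \<in> S. cancel_cons (True, x) v \<in> S} \<Longrightarrow> p v = cancel_cons (True, x) v"
      by auto
    then show ?thesis by auto
  qed
  then obtain \<pi> where \<pi>: "\<And>x. \<pi> x permutes S"
    "\<And>x v. v \<in> S \<Longrightarrow> cancel_cons (True, x) v \<in> S \<Longrightarrow> \<pi> x v = cancel_cons (True, x) v"
    by metis
  have "group.word_value (perm_group S) \<pi> w [] = foldr cancel_cons w []"
  proof (rule perm_word_follows[OF \<pi>(1), of S])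
    show "foldr cancel_cons v [] \<in> S" if "w = u @ v" for u v
      using that w reduced_appendD[of u v] by (auto simp: foldr_cancel_cons_id S_def)
  qed (use \<pi>(2) inverse in auto)
  then have "group.word_value (perm_group S) \<pi> w \<noteq> id"
    using w by (auto simp: foldr_cancel_cons_id)
  with S \<pi>(1) show thesis by (rule that)
qed


section \<open>Regular wreath products\<close>

text \<open>
  The pair \<open>(f, r)\<close> stands for the permutation \<open>(x, y) \<mapsto> (r x, f x y)\<close> of the
  product of \<open>R\<close> and \<open>P\<close>; multiplication is composition. Functions are extensional, so
  that the group is finite if \<open>P\<close> and \<open>R\<close> are.
\<close>

definition wreath :: "('p, 'c) monoid_scheme \<Rightarrow> ('r, 'd) monoid_scheme \<Rightarrow> (('r \<Rightarrow> 'p) \<times> 'r) monoid" where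
  "wreath P R =
    \<lparr>carrier = (carrier R \<rightarrow>\<^sub>E carrier P) \<times> carrier R,
     monoid.mult = (\<lambda>(f, r) (g, s). (\<lambda>x\<in>carrier R. f (s \<otimes>\<^bsub>R\<^esub> x) \<otimes>\<^bsub>P\<^esub> g x, r \<otimes>\<^bsub>R\<^esub> s)),
     one = (\<lambda>x\<in>carrier R. \<one>\<^bsub>P\<^esub>, \<one>\<^bsub>R\<^esub>)\<rparr>"

definition wreath_base :: "('p, 'c) monoid_scheme \<Rightarrow> ('r, 'd) monoid_scheme \<Rightarrow> (('r \<Rightarrow> 'p) \<times> 'r) set" where
  "wreath_base P R = (carrier R \<rightarrow>\<^sub>E carrier P) \<times> {\<one>\<^bsub>R\<^esub>}"

definition wreath_top :: "('p, 'c) monoid_scheme \<Rightarrow> ('r, 'd) monoid_scheme \<Rightarrow> 'r \<Rightarrow> ('r \<Rightarrow> 'p) \<times> 'r" where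
  "wreath_top P R r = (\<lambda>x\<in>carrier R. \<one>\<^bsub>P\<^esub>, r)"

text \<open>
  These elements of the base are permuted by conjugation with \<open>R\<close> in the way in which
  \<open>R\<close> permutes itself by left multiplication, whereas the function \<open>p\<close> lets their
  values at the identity be arbitrary elements of \<open>P\<close>.
\<close>

definition wreath_translate ::
    "('p, 'c) monoid_scheme \<Rightarrow> ('r, 'd) monoid_scheme \<Rightarrow> ('r \<Rightarrow> 'p) \<Rightarrow> 'r \<Rightarrow> ('r \<Rightarrow> 'p) \<times> 'r" where
  "wreath_translate P R p r = (\<lambda>x\<in>carrier R. p (inv\<^bsub>R\<^esub> x \<otimes>\<^bsub>R\<^esub> r), \<one>\<^bsub>R\<^esub>)"

lemma mult_wreath:
  "(f, r) \<otimes>\<^bsub>wreath P R\<^esub> (g, s) = (\<lambda>x\<in>carrier R. f (s \<otimes>\<^bsub>R\<^esub> x) \<otimes>\<^bsub>P\<^esub> g x, r \<otimes>\<^bsub>R\<^esub> s)"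
  by (simp add: wreath_def)

lemma one_wreath: "\<one>\<^bsub>wreath P R\<^esub> = (\<lambda>x\<in>carrier R. \<one>\<^bsub>P\<^esub>, \<one>\<^bsub>R\<^esub>)"
  by (simp add: wreath_def)

lemma carrier_wreath: "carrier (wreath P R) = (carrier R \<rightarrow>\<^sub>E carrier P) \<times> carrier R"
  by (simp add: wreath_def)

locale wreath_product = P: group P + R: group R
  for P :: "('p, 'c) monoid_scheme" and R :: "('r, 'd) monoid_scheme"
begin

sublocale W: group "wreath P R"
proof (rule groupI)
  fix x y z assume "x \<in> carrier (wreath P R)" "y \<in> carrier (wreath P R)" "z \<in> carrier (wreath P R)"
  then show "x \<otimes>\<^bsub>wreath P R\<^esub> y \<otimes>\<^bsub>wreath P R\<^esub> z = x \<otimes>\<^bsub>wreath P R\<^esub> (y \<otimes>\<^bsub>wreath P R\<^esub> z)"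
    by (auto simp: carrier_wreath mult_wreath PiE_iff R.m_assoc P.m_assoc intro!: restrict_ext)
next
  fix x assume x: "x \<in> carrier (wreath P R)"
  then obtain f r where fr: "x = (f, r)" "f \<in> carrier R \<rightarrow>\<^sub>E carrier P" "r \<in> carrier R"
    by (auto simp: carrier_wreath)
  have *: "inv\<^bsub>R\<^esub> r \<otimes>\<^bsub>R\<^esub> (r \<otimes>\<^bsub>R\<^esub> y) = y" if "y \<in> carrier R" for y
    using fr that by (simp add: R.m_assoc [symmetric])
  show "\<exists>y\<in>carrier (wreath P R). y \<otimes>\<^bsub>wreath P R\<^esub> x = \<one>\<^bsub>wreath P R\<^esub>"
    using fr by (intro bexI[of _ "(\<lambda>y\<in>carrier R. inv\<^bsub>P\<^esub> (f (inv\<^bsub>R\<^esub> r \<otimes>\<^bsub>R\<^esub> y)), inv\<^bsub>R\<^esub> r)"])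
      (auto simp: carrier_wreath mult_wreath one_wreath PiE_iff * intro!: restrict_ext)
next
  fix x assume "x \<in> carrier (wreath P R)"
  then show "\<one>\<^bsub>wreath P R\<^esub> \<otimes>\<^bsub>wreath P R\<^esub> x = x"
    by (auto simp: carrier_wreath mult_wreath one_wreath PiE_iff extensional_def fun_eq_iff restrict_def)
qed (auto simp: carrier_wreath mult_wreath one_wreath PiE_iff)

lemma finite_wreath: "finite (carrier P) \<Longrightarrow> finite (carrier R) \<Longrightarrow> finite (carrier (wreath P R))"
  by (simp add: carrier_wreath finite_PiE)

lemma wreath_top_hom: "wreath_top P R \<in> hom R (wreath P R)"
  by (rule homI) (auto simp: wreath_top_def carrier_wreath PiE_iff mult_wreath intro!: restrict_ext)

lemma snd_hom: "snd \<in> hom (wreath P R) R"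
  by (rule homI) (auto simp: carrier_wreath mult_wreath)

lemma base_subset: "wreath_base P R \<subseteq> carrier (wreath P R)"
  by (auto simp: wreath_base_def carrier_wreath)

lemma base_iff: "v \<in> wreath_base P R \<longleftrightarrow> v \<in> carrier (wreath P R) \<and> snd v = \<one>\<^bsub>R\<^esub>"
  by (auto simp: wreath_base_def carrier_wreath)

lemma base_normal: "wreath_base P R \<lhd> wreath P R"
proof -
  interpret snd: group_hom "wreath P R" R snd
    by (simp add: group_hom_defs W.is_group R.is_group snd_hom)
  have "kernel (wreath P R) R snd = wreath_base P R"
    by (auto simp: kernel_def base_iff)
  then show ?thesis using snd.normal_kernel by simp
qed

lemma base_mult:
  "u \<in> wreath_base P R \<Longrightarrow> v \<in> wreath_base P R \<Longrightarrow>
    u \<otimes>\<^bsub>wreath P R\<^esub> v = (\<lambda>x\<in>carrier R. fst u x \<otimes>\<^bsub>P\<^esub> fst v x, \<one>\<^bsub>R\<^esub>)"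
  by (auto simp: wreath_base_def mult_wreath intro!: restrict_ext)

lemma translate_base:
  "p \<in> carrier R \<rightarrow> carrier P \<Longrightarrow> r \<in> carrier R \<Longrightarrow> wreath_translate P R p r \<in> wreath_base P R"
  by (auto simp: wreath_translate_def wreath_base_def)

lemma translate_conj:
  assumes p: "p \<in> carrier R \<rightarrow> carrier P" and "r \<in> carrier R" "s \<in> carrier R"
  shows "wreath_top P R r \<otimes>\<^bsub>wreath P R\<^esub> wreath_translate P R p s =
    wreath_translate P R p (r \<otimes>\<^bsub>R\<^esub> s) \<otimes>\<^bsub>wreath P R\<^esub> wreath_top P R r"
proof -
  have "inv\<^bsub>R\<^esub> (r \<otimes>\<^bsub>R\<^esub> x) \<otimes>\<^bsub>R\<^esub> (r \<otimes>\<^bsub>R\<^esub> s) = inv\<^bsub>R\<^esub> x \<otimes>\<^bsub>R\<^esub> s" if "x \<in> carrier R" for x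
    using assms that by (simp add: R.inv_mult_group R.m_assoc R.m_assoc [of "inv\<^bsub>R\<^esub> r" r, symmetric])
  moreover have "p (inv\<^bsub>R\<^esub> x \<otimes>\<^bsub>R\<^esub> s) \<in> carrier P" if "x \<in> carrier R" for x
    using assms that by auto
  ultimately show ?thesis
    using assms by (auto simp: wreath_top_def wreath_translate_def mult_wreath intro!: restrict_ext)
qed

lemma base_eval_one: "x \<in> carrier R \<Longrightarrow> fst \<one>\<^bsub>wreath P R\<^esub> x = \<one>\<^bsub>P\<^esub>"
  by (simp add: one_wreath)

lemma base_eval_mult:
  "u \<in> wreath_base P R \<Longrightarrow> v \<in> wreath_base P R \<Longrightarrow> x \<in> carrier R \<Longrightarrow>
    fst (u \<otimes>\<^bsub>wreath P R\<^esub> v) x = fst u x \<otimes>\<^bsub>P\<^esub> fst v x"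
  by (simp add: base_mult)

lemma base_eval_closed: "u \<in> wreath_base P R \<Longrightarrow> x \<in> carrier R \<Longrightarrow> fst u x \<in> carrier P"
  by (auto simp: wreath_base_def PiE_iff)

lemma base_subgroup: "subgroup (wreath_base P R) (wreath P R)"
  using base_normal by (simp add: normal_imp_subgroup)

lemma base_eval_inv:
  assumes "u \<in> wreath_base P R" "x \<in> carrier R"
  shows "fst (inv\<^bsub>wreath P R\<^esub> u) x = inv\<^bsub>P\<^esub> (fst u x)"
proof -
  have u: "inv\<^bsub>wreath P R\<^esub> u \<in> wreath_base P R" "u \<in> carrier (wreath P R)"
    using assms base_subset subgroup.m_inv_closed[OF base_subgroup] by auto
  then have "fst (inv\<^bsub>wreath P R\<^esub> u) x \<otimes>\<^bsub>P\<^esub> fst u x = \<one>\<^bsub>P\<^esub>"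
    using assms base_eval_mult[OF u(1) assms] base_eval_one W.l_inv by simp
  then show ?thesis
    using P.inv_equality base_eval_closed u assms by metis
qed

lemma base_eval_pow:
  fixes k :: nat
  assumes "u \<in> wreath_base P R" "x \<in> carrier R"
  shows "u [^]\<^bsub>wreath P R\<^esub> k \<in> wreath_base P R \<and> fst (u [^]\<^bsub>wreath P R\<^esub> k) x = fst u x [^]\<^bsub>P\<^esub> k"
proof (induction k)
  case 0
  then show ?case
    using assms subgroup.one_closed[OF base_subgroup] by (simp add: base_eval_one)
next
  case (Suc k)
  then show ?case
    using assms subgroup.m_closed[OF base_subgroup] by (simp add: base_eval_mult)
qed

lemma base_ext:
  assumes "u \<in> wreath_base P R" "v \<in> wreath_base P R" "\<And>x. x \<in> carrier R \<Longrightarrow> fst u x = fst v x"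
  shows "u = v"
  using assms by (auto simp: wreath_base_def intro: PiE_ext)

end

section \<open>Amalgamated products and doubles\<close>

lemma Cons_amalg_words [simp]:
  "Inl x # w \<in> amalg_words G K \<longleftrightarrow> x \<in> carrier G \<and> w \<in> amalg_words G K"
  "Inr y # w \<in> amalg_words G K \<longleftrightarrow> y \<in> carrier K \<and> w \<in> amalg_words G K"
  by (auto simp: amalg_words_def)

definition amalg_inl where
  "amalg_inl G K H \<phi> x = amalg_rel G K H \<phi> `` {[Inl x]}"

definition amalg_inr where
  "amalg_inr G K H \<phi> y = amalg_rel G K H \<phi> `` {[Inr y]}"

lemma carrier_amalgamated_product:
  "carrier (amalgamated_product G K H \<phi>) = (\<lambda>w. amalg_rel G K H \<phi> `` {w}) ` amalg_words G K"
  by (auto simp: amalgamated_product_def quotient_def)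

lemma amalg_class_eqI:
  "u \<in> amalg_words G K \<Longrightarrow> v \<in> amalg_words G K \<Longrightarrow> amalg_step G K H \<phi> u v \<Longrightarrow>
    amalg_rel G K H \<phi> `` {u} = amalg_rel G K H \<phi> `` {v}"
  by (intro equiv_class_eq[OF equiv_amalg_rel]) (auto simp: amalg_rel_def)

lemma amalg_inl_hom: "group G \<Longrightarrow> amalg_inl G K H \<phi> \<in> hom G (amalgamated_product G K H \<phi>)"
proof (rule homI)
  fix x y assume G: "group G" and x: "x \<in> carrier G" and y: "y \<in> carrier G"
  then have "x \<otimes>\<^bsub>G\<^esub> y \<in> carrier G" by (simp add: group.is_monoid monoid.m_closed)
  then show "amalg_inl G K H \<phi> (x \<otimes>\<^bsub>G\<^esub> y) =
      amalg_inl G K H \<phi> x \<otimes>\<^bsub>amalgamated_product G K H \<phi>\<^esub> amalg_inl G K H \<phi> y"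
    using x y amalg_class_eqI[OF _ _ amalg_step.mult_left[OF x y, of K H \<phi> "[]" "[]"]]
    by (simp add: amalg_inl_def amalgamated_product_mult)
qed (auto simp: amalg_inl_def carrier_amalgamated_product)

lemma amalg_inr_hom: "group K \<Longrightarrow> amalg_inr G K H \<phi> \<in> hom K (amalgamated_product G K H \<phi>)"
proof (rule homI)
  fix x y assume K: "group K" and x: "x \<in> carrier K" and y: "y \<in> carrier K"
  then have "x \<otimes>\<^bsub>K\<^esub> y \<in> carrier K" by (simp add: group.is_monoid monoid.m_closed)
  then show "amalg_inr G K H \<phi> (x \<otimes>\<^bsub>K\<^esub> y) =
      amalg_inr G K H \<phi> x \<otimes>\<^bsub>amalgamated_product G K H \<phi>\<^esub> amalg_inr G K H \<phi> y"
    using x y amalg_class_eqI[OF _ _ amalg_step.mult_right[OF x y, of G H \<phi> "[]" "[]"]]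
    by (simp add: amalg_inr_def amalgamated_product_mult)
qed (auto simp: amalg_inr_def carrier_amalgamated_product)

lemma amalg_glue:
  "h \<in> H \<Longrightarrow> h \<in> carrier G \<Longrightarrow> \<phi> h \<in> carrier K \<Longrightarrow> amalg_inl G K H \<phi> h = amalg_inr G K H \<phi> (\<phi> h)"
  using amalg_class_eqI[OF _ _ amalg_step.glue[of h H G K \<phi> "[]" "[]"]]
  by (simp add: amalg_inl_def amalg_inr_def)

lemma amalg_induct [consumes 1, case_names one inl inr]:
  assumes g: "g \<in> carrier (amalgamated_product G K H \<phi>)"
    and one: "Q \<one>\<^bsub>amalgamated_product G K H \<phi>\<^esub>"
    and inl: "\<And>x g. x \<in> carrier G \<Longrightarrow> g \<in> carrier (amalgamated_product G K H \<phi>) \<Longrightarrow> Q g \<Longrightarrow>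
      Q (amalg_inl G K H \<phi> x \<otimes>\<^bsub>amalgamated_product G K H \<phi>\<^esub> g)"
    and inr: "\<And>x g. x \<in> carrier K \<Longrightarrow> g \<in> carrier (amalgamated_product G K H \<phi>) \<Longrightarrow> Q g \<Longrightarrow>
      Q (amalg_inr G K H \<phi> x \<otimes>\<^bsub>amalgamated_product G K H \<phi>\<^esub> g)"
  shows "Q g"
proof -
  have "Q (amalg_rel G K H \<phi> `` {w})" if "w \<in> amalg_words G K" for w
    using that
  proof (induction w)
    case Nil
    then show ?case using one by (simp add: amalgamated_product_def)
  next
    case (Cons l w)
    then have w: "w \<in> amalg_words G K" and l: "[l] \<in> amalg_words G K"
      by (auto simp: amalg_words_def)
    have eq: "amalg_rel G K H \<phi> `` {l # w} =
        amalg_rel G K H \<phi> `` {[l]} \<otimes>\<^bsub>amalgamated_product G K H \<phi>\<^esub> amalg_rel G K H \<phi> `` {w}"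
      using l w by (simp add: amalgamated_product_mult)
    have "amalg_rel G K H \<phi> `` {w} \<in> carrier (amalgamated_product G K H \<phi>)"
      using w by (auto simp: carrier_amalgamated_product)
    with l Cons.IH[OF w] show ?case
      unfolding eq using inl inr by (cases l) (auto simp: amalg_inl_def amalg_inr_def)
  qed
  with g show ?thesis by (auto simp: carrier_amalgamated_product)
qed

lemma amalg_universal:
  fixes \<alpha> :: "'a \<Rightarrow> 'q" and Q :: "('q, 'z) monoid_scheme"
  assumes "group G" "group K" "group Q" and \<alpha>: "\<alpha> \<in> hom G Q" and \<beta>: "\<beta> \<in> hom K Q"
    and H: "H \<subseteq> carrier G" "\<phi> ` H \<subseteq> carrier K" and agree: "\<And>h. h \<in> H \<Longrightarrow> \<alpha> h = \<beta> (\<phi> h)"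
  obtains \<Phi> where "\<Phi> \<in> hom (amalgamated_product G K H \<phi>) Q"
    "\<And>x. x \<in> carrier G \<Longrightarrow> \<Phi> (amalg_inl G K H \<phi> x) = \<alpha> x"
    "\<And>y. y \<in> carrier K \<Longrightarrow> \<Phi> (amalg_inr G K H \<phi> y) = \<beta> y"
proof -
  interpret Q: group Q by fact
  interpret \<alpha>: group_hom G Q \<alpha> using assms by (simp add: group_hom_defs)
  interpret \<beta>: group_hom K Q \<beta> using assms by (simp add: group_hom_defs)
  define ev where "ev w = foldr (\<lambda>l y. case_sum \<alpha> \<beta> l \<otimes>\<^bsub>Q\<^esub> y) w \<one>\<^bsub>Q\<^esub>" for w
  have letter: "case_sum \<alpha> \<beta> l \<in> carrier Q" if "l \<in> carrier G <+> carrier K" for l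
    using that by auto
  have ev_closed: "ev w \<in> carrier Q" if "w \<in> amalg_words G K" for w
    using that by (induction w) (auto simp: ev_def amalg_words_def letter)
  have ev_append: "ev (u @ v) = ev u \<otimes>\<^bsub>Q\<^esub> ev v" if "u \<in> amalg_words G K" "v \<in> amalg_words G K" for u v
    using that
  proof (induction u)
    case Nil
    then show ?case using ev_closed by (simp add: ev_def)
  next
    case (Cons l u)
    then have "l \<in> carrier G <+> carrier K" and u: "u \<in> amalg_words G K"
      by (auto simp: amalg_words_def)
    then show ?case
      using Cons letter ev_closed[OF u] ev_closed[OF Cons.prems(2)] by (simp add: ev_def Q.m_assoc)
  qed
  \<comment> \<open>letters of the words along a chain of steps stay in the carriers, since \<open>H\<close> does\<close>
  have step: "(u \<in> amalg_words G K \<longleftrightarrow> v \<in> amalg_words G K) \<and> (u \<in> amalg_words G K \<longrightarrow> ev u = ev v)"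
    if "amalg_step G K H \<phi> u v" for u v
  proof -
    have split: "p @ q @ r \<in> amalg_words G K \<longleftrightarrow>
        p \<in> amalg_words G K \<and> q \<in> amalg_words G K \<and> r \<in> amalg_words G K" for p q r
      by (auto simp: amalg_words_def)
    have context_ev: "(p @ q @ r \<in> amalg_words G K \<longleftrightarrow> p @ q' @ r \<in> amalg_words G K) \<and>
        (p @ q @ r \<in> amalg_words G K \<longrightarrow> ev (p @ q @ r) = ev (p @ q' @ r))"
      if "q \<in> amalg_words G K" "q' \<in> amalg_words G K" "ev q = ev q'" for p q q' r
      using that unfolding split by (auto simp: ev_append amalg_words_append)
    show ?thesis
      using that
    proof cases
      case (one_left p r)
      then show ?thesis using context_ev[of "[Inl \<one>\<^bsub>G\<^esub>]" "[]" p r] by (auto simp: ev_def)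
    next
      case (one_right p r)
      then show ?thesis using context_ev[of "[Inr \<one>\<^bsub>K\<^esub>]" "[]" p r] by (auto simp: ev_def)
    next
      case (mult_left x y p r)
      then show ?thesis
        using context_ev[of "[Inl x, Inl y]" "[Inl (x \<otimes>\<^bsub>G\<^esub> y)]" p r] by (auto simp: ev_def)
    next
      case (mult_right x y p r)
      then show ?thesis
        using context_ev[of "[Inr x, Inr y]" "[Inr (x \<otimes>\<^bsub>K\<^esub> y)]" p r] by (auto simp: ev_def)
    next
      case (glue h p r)
      then show ?thesis
        using context_ev[of "[Inl h]" "[Inr (\<phi> h)]" p r] H agree[of h]
        by (auto simp: ev_def image_subset_iff)
    qed
  qed
  have equiv: "v \<in> amalg_words G K \<and> ev u = ev v"
    if "equivclp (amalg_step G K H \<phi>) u v" "u \<in> amalg_words G K" for u v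
    using that by (induction rule: equivclp_induct) (metis step)+
  define \<Phi> where "\<Phi> U = ev (SOME w. w \<in> U)" for U
  have ev_class: "\<Phi> (amalg_rel G K H \<phi> `` {w}) = ev w" if w: "w \<in> amalg_words G K" for w
  proof -
    have "w \<in> amalg_rel G K H \<phi> `` {w}" using w by (simp add: amalg_rel_def)
    then have "(SOME v. v \<in> amalg_rel G K H \<phi> `` {w}) \<in> amalg_rel G K H \<phi> `` {w}"
      by (rule someI)
    then show ?thesis
      using equiv by (auto simp: \<Phi>_def amalg_rel_def)
  qed
  show thesis
  proof (rule that)
    show "\<Phi> \<in> hom (amalgamated_product G K H \<phi>) Q"
      by (rule homI) (auto simp: carrier_amalgamated_product ev_class ev_closed
          amalgamated_product_mult amalg_words_append ev_append)
    show "\<Phi> (amalg_inl G K H \<phi> x) = \<alpha> x" if "x \<in> carrier G" for x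
      using that ev_class[of "[Inl x]"] by (simp add: amalg_inl_def ev_def)
    show "\<Phi> (amalg_inr G K H \<phi> y) = \<beta> y" if "y \<in> carrier K" for y
      using that ev_class[of "[Inr y]"] by (simp add: amalg_inr_def ev_def)
  qed
qed

locale group_double = G: group G + H: subgroup H G for G :: "('a, 'c) monoid_scheme" and H
begin

abbreviation "D \<equiv> double_along G H"

definition left :: "'a \<Rightarrow> ('a + 'a) list set" where "left = amalg_inl G G H id"
definition right :: "'a \<Rightarrow> ('a + 'a) list set" where "right = amalg_inr G G H id"

sublocale D: group D
  by (simp add: double_along_def group_amalgamated_product G.is_group)

sublocale left: group_hom G D left
  by (simp add: group_hom_defs G.is_group D.is_group)
    (simp add: left_def double_along_def amalg_inl_hom G.is_group)

sublocale right: group_hom G D right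
  by (simp add: group_hom_defs G.is_group D.is_group)
    (simp add: right_def double_along_def amalg_inr_hom G.is_group)

lemma left_eq_right: "h \<in> H \<Longrightarrow> left h = right h"
  using amalg_glue[of h H G id G] by (simp add: left_def right_def)

lemma double_induct [consumes 1, case_names one left right]:
  assumes "g \<in> carrier D" "Q \<one>\<^bsub>D\<^esub>"
    and "\<And>x g. x \<in> carrier G \<Longrightarrow> g \<in> carrier D \<Longrightarrow> Q g \<Longrightarrow> Q (left x \<otimes>\<^bsub>D\<^esub> g)"
    and "\<And>x g. x \<in> carrier G \<Longrightarrow> g \<in> carrier D \<Longrightarrow> Q g \<Longrightarrow> Q (right x \<otimes>\<^bsub>D\<^esub> g)"
  shows "Q g"
  using assms unfolding double_along_def left_def right_def by (rule amalg_induct)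

lemma double_universal:
  assumes "group Q" "\<alpha> \<in> hom G Q" "\<beta> \<in> hom G Q" "\<And>h. h \<in> H \<Longrightarrow> \<alpha> h = \<beta> h"
  obtains \<Phi> where "\<Phi> \<in> hom D Q" "\<And>x. x \<in> carrier G \<Longrightarrow> \<Phi> (left x) = \<alpha> x"
    "\<And>x. x \<in> carrier G \<Longrightarrow> \<Phi> (right x) = \<beta> x"
  using amalg_universal[OF G.is_group G.is_group assms(1-3), of H id] assms(4) H.subset
  unfolding double_along_def left_def right_def by auto

lemma double_hom_eqI:
  assumes "group Q" "\<Phi> \<in> hom D Q" "\<Psi> \<in> hom D Q" "g \<in> carrier D"
    and "\<And>x. x \<in> carrier G \<Longrightarrow> \<Phi> (left x) = \<Psi> (left x)"
    and "\<And>x. x \<in> carrier G \<Longrightarrow> \<Phi> (right x) = \<Psi> (right x)"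
  shows "\<Phi> g = \<Psi> g"
proof -
  interpret \<Phi>: group_hom D Q \<Phi> using assms by (simp add: group_hom_defs)
  interpret \<Psi>: group_hom D Q \<Psi> using assms by (simp add: group_hom_defs)
  show ?thesis
    using assms(4) by (induction rule: double_induct) (simp_all add: assms)
qed

definition fold :: "('a + 'a) list set \<Rightarrow> 'a" where
  "fold = (SOME \<Phi>. \<Phi> \<in> hom D G \<and> (\<forall>x\<in>carrier G. \<Phi> (left x) = x \<and> \<Phi> (right x) = x))"

lemma fold: "fold \<in> hom D G" "x \<in> carrier G \<Longrightarrow> fold (left x) = x" "x \<in> carrier G \<Longrightarrow> fold (right x) = x"
proof -
  have "(\<lambda>x. x) \<in> hom G G" by (simp add: hom_def)
  then obtain \<Phi> where "\<Phi> \<in> hom D G" "\<And>x. x \<in> carrier G \<Longrightarrow> \<Phi> (left x) = x"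
    "\<And>x. x \<in> carrier G \<Longrightarrow> \<Phi> (right x) = x"
    using double_universal[OF G.is_group, of "\<lambda>x. x" "\<lambda>x. x"] by metis
  then have "\<exists>\<Phi>. \<Phi> \<in> hom D G \<and> (\<forall>x\<in>carrier G. \<Phi> (left x) = x \<and> \<Phi> (right x) = x)" by blast
  from someI_ex[OF this] show "fold \<in> hom D G" "x \<in> carrier G \<Longrightarrow> fold (left x) = x"
    "x \<in> carrier G \<Longrightarrow> fold (right x) = x"
    unfolding fold_def by blast+
qed

sublocale fold: group_hom D G fold
  by (simp add: group_hom_defs G.is_group D.is_group fold(1))

text \<open>
  The value outside the carrier is a convention which allows words over the whole type to be evaluated.
\<close>

definition diff :: "'a \<Rightarrow> ('a + 'a) list set" where
  "diff x = (if x \<in> carrier G then left x \<otimes>\<^bsub>D\<^esub> inv\<^bsub>D\<^esub> (right x) else \<one>\<^bsub>D\<^esub>)"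

lemma range_diff [simp]: "range diff \<subseteq> carrier D"
  by (auto simp: diff_def)

lemma diff_closed [simp]: "diff x \<in> carrier D"
  by (simp add: diff_def)

lemma diff_coset:
  assumes "x \<in> carrier G" "h \<in> H"
  shows "diff (x \<otimes>\<^bsub>G\<^esub> h) = diff x"
proof -
  have h: "h \<in> carrier G" using assms by auto
  have "left x \<otimes>\<^bsub>D\<^esub> left h \<otimes>\<^bsub>D\<^esub> (inv\<^bsub>D\<^esub> (right h) \<otimes>\<^bsub>D\<^esub> inv\<^bsub>D\<^esub> (right x)) = left x \<otimes>\<^bsub>D\<^esub> inv\<^bsub>D\<^esub> (right x)"
    using assms h left_eq_right[of h]
    by (simp add: D.m_assoc) (simp add: D.m_assoc [symmetric])
  then show ?thesis
    using assms h by (simp add: diff_def D.inv_mult_group)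
qed

lemma diff_H: "h \<in> H \<Longrightarrow> diff h = \<one>\<^bsub>D\<^esub>"
  by (simp add: diff_def left_eq_right)

lemma left_diff_conj:
  assumes "x \<in> carrier G" "y \<in> carrier G"
  shows "left x \<otimes>\<^bsub>D\<^esub> diff y \<otimes>\<^bsub>D\<^esub> inv\<^bsub>D\<^esub> (left x) = diff (x \<otimes>\<^bsub>G\<^esub> y) \<otimes>\<^bsub>D\<^esub> inv\<^bsub>D\<^esub> (diff x)"
  using assms
  by (simp add: diff_def D.inv_mult_group D.m_assoc)
    (simp add: D.m_assoc [symmetric])

text \<open>
  Conjugation by the left copy preserves the subgroup generated by the differences, which together with the left
  copy generates the double. So every element is the product of a word in the differences and of an element of
  the left copy, the latter being determined by the folding map.
\<close>

lemma kernel_fold_word: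
  assumes "g \<in> carrier D" "fold g = \<one>\<^bsub>G\<^esub>"
  obtains w where "g = D.word_value diff w"
proof -
  let ?K = "{D.word_value diff w | w. True}"
  have mult: "u \<otimes>\<^bsub>D\<^esub> v \<in> ?K" if "u \<in> ?K" "v \<in> ?K" for u v
    using that by (auto simp flip: D.word_value_append)
  have inv: "inv\<^bsub>D\<^esub> u \<in> ?K" if "u \<in> ?K" for u
    using that by (auto simp flip: D.word_value_inverse)
  have diff: "diff x \<in> ?K" for x
  proof -
    have "diff x = D.word_value diff [(True, x)]" by (simp add: D.letter_value_def)
    then show ?thesis by blast
  qed
  have conj: "left x \<otimes>\<^bsub>D\<^esub> u \<otimes>\<^bsub>D\<^esub> inv\<^bsub>D\<^esub> (left x) \<in> ?K" if x: "x \<in> carrier G" and "u \<in> ?K" for x u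
  proof -
    have "left x \<otimes>\<^bsub>D\<^esub> D.word_value diff w \<otimes>\<^bsub>D\<^esub> inv\<^bsub>D\<^esub> (left x) \<in> ?K" for w
    proof (induction w)
      case Nil
      then show ?case using x by (auto intro: exI[of _ "[]"])
    next
      case (Cons l w)
      have dl: "left x \<otimes>\<^bsub>D\<^esub> diff y \<otimes>\<^bsub>D\<^esub> inv\<^bsub>D\<^esub> (left x) \<in> ?K" for y
      proof (cases "y \<in> carrier G")
        case True
        then show ?thesis using x by (simp only: left_diff_conj) (intro mult inv diff)
      next
        case False
        then have "left x \<otimes>\<^bsub>D\<^esub> diff y \<otimes>\<^bsub>D\<^esub> inv\<^bsub>D\<^esub> (left x) = D.word_value diff []"
          using x by (simp add: diff_def)
        then show ?thesis by blast
      qed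
      have "left x \<otimes>\<^bsub>D\<^esub> D.letter_value diff l \<otimes>\<^bsub>D\<^esub> inv\<^bsub>D\<^esub> (left x) \<in> ?K"
      proof (cases "fst l")
        case True
        then show ?thesis using dl[of "snd l"] by (simp only: D.letter_value_def if_True)
      next
        case False
        have "inv\<^bsub>D\<^esub> (left x \<otimes>\<^bsub>D\<^esub> diff (snd l) \<otimes>\<^bsub>D\<^esub> inv\<^bsub>D\<^esub> (left x)) \<in> ?K"
          by (rule inv[OF dl])
        also have "inv\<^bsub>D\<^esub> (left x \<otimes>\<^bsub>D\<^esub> diff (snd l) \<otimes>\<^bsub>D\<^esub> inv\<^bsub>D\<^esub> (left x)) =
            left x \<otimes>\<^bsub>D\<^esub> D.letter_value diff l \<otimes>\<^bsub>D\<^esub> inv\<^bsub>D\<^esub> (left x)"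
          using x False by (simp add: D.inv_mult_group D.m_assoc D.letter_value_def)
        finally show ?thesis .
      qed
      from mult[OF this Cons.IH] x show ?case
        by (simp add: D.m_assoc D.m_assoc [of "inv\<^bsub>D\<^esub> (left x)" "left x", symmetric])
    qed
    with \<open>u \<in> ?K\<close> show ?thesis by blast
  qed
  have "g \<otimes>\<^bsub>D\<^esub> inv\<^bsub>D\<^esub> (left (fold g)) \<in> ?K"
    using assms(1)
  proof (induction rule: double_induct)
    case one
    then show ?case by (auto intro: exI[of _ "[]"])
  next
    case (left x g)
    have "left x \<otimes>\<^bsub>D\<^esub> g \<otimes>\<^bsub>D\<^esub> inv\<^bsub>D\<^esub> (left (fold (left x \<otimes>\<^bsub>D\<^esub> g))) =
        left x \<otimes>\<^bsub>D\<^esub> (g \<otimes>\<^bsub>D\<^esub> inv\<^bsub>D\<^esub> (left (fold g))) \<otimes>\<^bsub>D\<^esub> inv\<^bsub>D\<^esub> (left x)"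
      using left by (simp add: fold D.inv_mult_group D.m_assoc)
    then show ?case using conj[OF left(1,3)] by simp
  next
    case (right x g)
    have "right x \<otimes>\<^bsub>D\<^esub> g \<otimes>\<^bsub>D\<^esub> inv\<^bsub>D\<^esub> (left (fold (right x \<otimes>\<^bsub>D\<^esub> g))) =
        inv\<^bsub>D\<^esub> (diff x) \<otimes>\<^bsub>D\<^esub> (left x \<otimes>\<^bsub>D\<^esub> (g \<otimes>\<^bsub>D\<^esub> inv\<^bsub>D\<^esub> (left (fold g))) \<otimes>\<^bsub>D\<^esub> inv\<^bsub>D\<^esub> (left x))"
      using right
      by (simp add: diff_def fold D.inv_mult_group D.m_assoc D.m_assoc [of "inv\<^bsub>D\<^esub> (left x)" "left x", symmetric])
    then show ?case using mult[OF inv[OF diff] conj[OF right(1,3)]] by simp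
  qed
  then have "g \<in> ?K" using assms by simp
  then show thesis using that by blast
qed

end

lemma (in group) conj_hom:
  assumes "\<alpha> \<in> hom K G" "t \<in> carrier G"
  shows "(\<lambda>x. t \<otimes> \<alpha> x \<otimes> inv t) \<in> hom K G"
proof (rule homI)
  show "t \<otimes> \<alpha> x \<otimes> inv t \<in> carrier G" if "x \<in> carrier K" for x
    using that assms by (auto simp: hom_def)
  show "t \<otimes> \<alpha> (x \<otimes>\<^bsub>K\<^esub> y) \<otimes> inv t = t \<otimes> \<alpha> x \<otimes> inv t \<otimes> (t \<otimes> \<alpha> y \<otimes> inv t)"
    if "x \<in> carrier K" "y \<in> carrier K" for x y
  proof -
    have "\<alpha> x \<in> carrier G" "\<alpha> y \<in> carrier G" "\<alpha> (x \<otimes>\<^bsub>K\<^esub> y) = \<alpha> x \<otimes> \<alpha> y"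
      using that assms by (auto simp: hom_def)
    then show ?thesis
      using assms by (simp add: m_assoc) (simp add: m_assoc [symmetric])
  qed
qed

text \<open>
  Given a homomorphism of \<open>G\<close> into \<open>R\<close> and a function \<open>p\<close> on
  \<open>R\<close> that is invariant under right multiplication with the image of \<open>H\<close>, the left
  copy of \<open>G\<close> is mapped into the wreath product by way of \<open>R\<close>, and the right copy
  likewise, but conjugated with \<open>t = wreath_translate P R p \<one>\<close>. This is consistent, since
  \<open>t\<close> commutes with the image of \<open>H\<close>. On the kernel of the folding map, evaluation at
  the identity then yields a homomorphism into \<open>P\<close> whose values on the differences \<open>diff
  x\<close> are prescribed by \<open>p\<close>.
\<close>

lemma (in group_double) twisted_double_hom:
  fixes P :: "('p, 'e) monoid_scheme" and R :: "('r, 'f) monoid_scheme"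
  assumes P: "group P" and R: "group R" and \<alpha>: "\<alpha> \<in> hom G R" and p: "p \<in> carrier R \<rightarrow> carrier P"
    and inv: "\<And>r h. r \<in> carrier R \<Longrightarrow> h \<in> H \<Longrightarrow> p (r \<otimes>\<^bsub>R\<^esub> \<alpha> h) = p r" and p1: "p \<one>\<^bsub>R\<^esub> = \<one>\<^bsub>P\<^esub>"
  obtains \<Psi> where "\<Psi> \<in> hom D (wreath P R)"
    "\<And>w. \<Psi> (D.word_value diff w) \<in> wreath_base P R"
    "\<And>w. fst (\<Psi> (D.word_value diff w)) \<one>\<^bsub>R\<^esub> =
      group.word_value P (\<lambda>x. if x \<in> carrier G then p (\<alpha> x) else \<one>\<^bsub>P\<^esub>) w"
proof -
  interpret wreath_product P R using P R by (simp add: wreath_product_def)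
  let ?W = "wreath P R"
  interpret \<alpha>: group_hom G R \<alpha> using \<alpha> by (simp add: group_hom_defs G.is_group R.is_group)
  interpret top: group_hom R ?W "wreath_top P R"
    by (simp add: group_hom_defs R.is_group W.is_group wreath_top_hom)
  define t where "t = wreath_translate P R p \<one>\<^bsub>R\<^esub>"
  have tB: "t \<in> wreath_base P R" unfolding t_def by (rule translate_base[OF p]) simp
  then have t: "t \<in> carrier ?W" using base_subset by blast
  have comp: "wreath_top P R \<circ> \<alpha> \<in> hom G ?W"
    using \<alpha> wreath_top_hom by (rule hom_compose)
  have h: "wreath_top P R (\<alpha> h) = t \<otimes>\<^bsub>?W\<^esub> wreath_top P R (\<alpha> h) \<otimes>\<^bsub>?W\<^esub> inv\<^bsub>?W\<^esub> t" if "h \<in> H" for h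
  proof -
    have hR: "\<alpha> h \<in> carrier R" using that by simp
    have "wreath_translate P R p (\<alpha> h) = t"
      using that inv hR by (auto simp: wreath_translate_def t_def intro!: restrict_ext)
    with translate_conj[OF p hR, of "\<one>\<^bsub>R\<^esub>"] hR
    have "wreath_top P R (\<alpha> h) \<otimes>\<^bsub>?W\<^esub> t = t \<otimes>\<^bsub>?W\<^esub> wreath_top P R (\<alpha> h)"
      by (simp add: t_def)
    then show ?thesis
      using t hR W.inv_solve_right[of "wreath_top P R (\<alpha> h)" "t \<otimes>\<^bsub>?W\<^esub> wreath_top P R (\<alpha> h)" t] by simp
  qed
  obtain \<Psi> where \<Psi>: "\<Psi> \<in> hom D ?W" "\<And>x. x \<in> carrier G \<Longrightarrow> \<Psi> (left x) = wreath_top P R (\<alpha> x)"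
    "\<And>x. x \<in> carrier G \<Longrightarrow> \<Psi> (right x) = t \<otimes>\<^bsub>?W\<^esub> wreath_top P R (\<alpha> x) \<otimes>\<^bsub>?W\<^esub> inv\<^bsub>?W\<^esub> t"
    using double_universal[OF W.is_group comp W.conj_hom[OF comp t]] h by auto
  interpret \<Psi>: group_hom D ?W \<Psi>
    using \<Psi>(1) by (simp add: group_hom_defs D.is_group W.is_group)
  have diff: "\<Psi> (diff x) \<in> wreath_base P R \<and>
      fst (\<Psi> (diff x)) \<one>\<^bsub>R\<^esub> = (if x \<in> carrier G then p (\<alpha> x) else \<one>\<^bsub>P\<^esub>)" for x
  proof (cases "x \<in> carrier G")
    case True
    then have xR: "\<alpha> x \<in> carrier R" by simp
    let ?e = "wreath_translate P R p (\<alpha> x)" and ?r = "wreath_top P R (\<alpha> x)"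
    have eB: "?e \<in> wreath_base P R" by (rule translate_base[OF p xR])
    then have e: "?e \<in> carrier ?W" using base_subset by blast
    have "?r \<otimes>\<^bsub>?W\<^esub> t = ?e \<otimes>\<^bsub>?W\<^esub> ?r"
      using translate_conj[OF p xR, of "\<one>\<^bsub>R\<^esub>"] xR by (simp add: t_def)
    then have "?r \<otimes>\<^bsub>?W\<^esub> t \<otimes>\<^bsub>?W\<^esub> inv\<^bsub>?W\<^esub> ?r = ?e"
      using e xR by (simp add: W.m_assoc)
    then have eq: "\<Psi> (diff x) = ?e \<otimes>\<^bsub>?W\<^esub> inv\<^bsub>?W\<^esub> t"
      using True t xR by (simp add: diff_def \<Psi>(2,3) W.inv_mult_group W.m_assoc [symmetric])
    have "p (\<alpha> x) \<in> carrier P" using p xR by auto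
    then have "fst (\<Psi> (diff x)) \<one>\<^bsub>R\<^esub> = p (\<alpha> x)"
      unfolding eq using eB tB xR p1
      by (simp add: base_eval_mult base_eval_inv subgroup.m_inv_closed[OF base_subgroup])
        (simp add: wreath_translate_def t_def)
    moreover have "\<Psi> (diff x) \<in> wreath_base P R"
      unfolding eq using eB tB
      by (intro subgroup.m_closed[OF base_subgroup] subgroup.m_inv_closed[OF base_subgroup])
    ultimately show ?thesis using True by simp
  next
    case False
    then show ?thesis
      using subgroup.one_closed[OF base_subgroup] by (simp add: diff_def base_eval_one)
  qed
  let ?q = "\<lambda>x. if x \<in> carrier G then p (\<alpha> x) else \<one>\<^bsub>P\<^esub>"
  have letter: "\<Psi> (D.letter_value diff l) \<in> wreath_base P R \<and>
      fst (\<Psi> (D.letter_value diff l)) \<one>\<^bsub>R\<^esub> = P.letter_value ?q l" for l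
    using diff[of "snd l"] by (auto simp: D.letter_value_def P.letter_value_def base_eval_inv
        subgroup.m_inv_closed[OF base_subgroup])
  have "\<Psi> (D.word_value diff w) \<in> wreath_base P R \<and>
      fst (\<Psi> (D.word_value diff w)) \<one>\<^bsub>R\<^esub> = P.word_value ?q w" for w
  proof (induction w)
    case Nil
    then show ?case using subgroup.one_closed[OF base_subgroup] by (simp add: base_eval_one)
  next
    case (Cons l w)
    then show ?case
      using letter[of l] by (simp add: base_eval_mult subgroup.m_closed[OF base_subgroup])
  qed
  then show thesis using that \<Psi>(1) by blast
qed


section \<open>Residual finiteness of doubles\<close>

lemma residually_finiteI:
  assumes G: "group G"
    and sep: "\<And>g. g \<in> carrier G \<Longrightarrow> g \<noteq> \<one>\<^bsub>G\<^esub> \<Longrightarrow> \<exists>N. N \<lhd> G \<and> finite (carrier (G Mod N)) \<and> g \<notin> N"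
  shows "residually_finite G"
  unfolding residually_finite_def
proof (intro conjI ballI impI G)
  fix g assume g: "g \<in> carrier G" "g \<noteq> \<one>\<^bsub>G\<^esub>"
  then obtain N where N: "N \<lhd> G" "finite (carrier (G Mod N))" "g \<notin> N"
    using sep by metis
  have "g \<in> N #>\<^bsub>G\<^esub> g"
    using group.rcos_self[OF G g(1)] N(1) by (simp add: normal_imp_subgroup)
  with N show "\<exists>N. N \<lhd> G \<and> finite (carrier (G Mod N)) \<and> N #>\<^bsub>G\<^esub> g \<noteq> \<one>\<^bsub>G Mod N\<^esub>"
    by (intro exI[of _ N]) auto
qed

lemma finite_hom_separates:
  assumes G: "group G" and Q: "group Q" "finite (carrier Q)" and \<Phi>: "\<Phi> \<in> hom G Q"
    and g: "g \<in> carrier G" "\<Phi> g \<noteq> \<one>\<^bsub>Q\<^esub>"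
  shows "\<exists>N. N \<lhd> G \<and> finite (carrier (G Mod N)) \<and> g \<notin> N"
proof (intro exI conjI)
  interpret group_hom G Q \<Phi> using assms by (simp add: group_hom_defs)
  show "kernel G Q \<Phi> \<lhd> G" by (rule normal_kernel)
  have "(\<lambda>X. the_elem (\<Phi> ` X)) ` carrier (G Mod kernel G Q \<Phi>) \<subseteq> carrier Q"
    using FactGroup_the_elem_mem by auto
  then show "finite (carrier (G Mod kernel G Q \<Phi>))"
    using Q(2) FactGroup_inj_on by (metis finite_imageD finite_subset)
  show "g \<notin> kernel G Q \<Phi>" using g by (simp add: kernel_def)
qed

lemma residually_finite_free_group: "residually_finite (free_group :: 'g letter list monoid)"
proof (rule residually_finiteI[OF group_free_group])
  fix w :: "'g letter list" assume w: "w \<in> carrier free_group" "w \<noteq> \<one>\<^bsub>free_group\<^esub>"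
  then have "reduced w" "w \<noteq> []" by (simp_all add: carrier_free_group one_free_group)
  then obtain S :: "'g letter list set" and \<pi> where S: "finite S" "\<And>x. \<pi> x permutes S"
    "group.word_value (perm_group S) \<pi> w \<noteq> id"
    by (rule free_group_residually_finite) blast
  have "group.word_value (perm_group S) \<pi> \<in> hom free_group (perm_group S)"
    using S(2) by (intro group.word_value_hom[OF group_perm_group]) auto
  with S w(1) show "\<exists>N. N \<lhd> free_group \<and> finite (carrier (free_group Mod N)) \<and> w \<notin> N"
    by (intro finite_hom_separates[OF group_free_group group_perm_group finite_perm_group]) auto
qed

lemma (in group) word_value_cong:
  "(\<And>l. l \<in> set w \<Longrightarrow> g (snd l) = g' (snd l)) \<Longrightarrow> word_value g w = word_value g' w"
  by (induction w) (auto simp: letter_value_def)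

lemma (in group) word_value_map:
  "word_value g (map (\<lambda>l. (fst l, f (snd l))) w) = word_value (\<lambda>x. g (f x)) w"
  by (induction w) (auto simp: letter_value_def)

lemma successivelyI:
  "(\<And>u x y v. xs = u @ x # y # v \<Longrightarrow> Q x y) \<Longrightarrow> successively Q xs"
proof (induction xs rule: induct_list012)
  case (3 x y zs)
  have "Q x y" using "3.prems"[of "[]" x y zs] by simp
  moreover have "successively Q (y # zs)"
    by (rule "3.IH"(2)) (metis "3.prems" append_Cons)
  ultimately show ?case by simp
qed auto

lemma (in group_double) self_coset: "x \<in> carrier G \<Longrightarrow> x \<in> x <#\<^bsub>G\<^esub> H"
  unfolding l_coset_def using H.one_closed by force

text \<open>
  An element of the kernel of the folding map is a word in the differences. In a shortest such word no letter
  and no pair of adjacent letters is trivial modulo \<open>H\<close>, so it yields a nonempty reduced word over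
  the cosets of \<open>H\<close>. Residual finiteness of the free group on the cosets provides values of the
  letters in a finite group, and a finite permutation representation that separates the finitely many cosets
  involved turns these values into a homomorphism of the double.
\<close>

lemma (in group_double) residually_finite_double:
  assumes RF: "residually_finite G"
    and sep: "\<And>T. finite T \<Longrightarrow> T \<subseteq> carrier G \<Longrightarrow> \<exists>S \<alpha>. finite S \<and> H \<in> S \<and> \<alpha> \<in> hom G (perm_group S) \<and>
      (\<forall>h\<in>H. \<alpha> h H = H) \<and> (\<forall>x\<in>T. \<alpha> x H = x <#\<^bsub>G\<^esub> H)"
  shows "residually_finite D"
proof (rule residually_finiteI[OF D.is_group])
  fix g assume g: "g \<in> carrier D" "g \<noteq> \<one>\<^bsub>D\<^esub>"
  show "\<exists>N. N \<lhd> D \<and> finite (carrier (D Mod N)) \<and> g \<notin> N"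
  proof (cases "fold g = \<one>\<^bsub>G\<^esub>")
    case False
    then obtain N where N: "N \<lhd> G" "finite (carrier (G Mod N))" "N #>\<^bsub>G\<^esub> fold g \<noteq> \<one>\<^bsub>G Mod N\<^esub>"
      using RF g unfolding residually_finite_def by (meson fold.hom_closed)
    interpret N: normal N G by (rule N(1))
    have "(\<lambda>x. N #>\<^bsub>G\<^esub> x) \<circ> fold \<in> hom D (G Mod N)"
      using fold(1) N.r_coset_hom_Mod by (rule hom_compose)
    from finite_hom_separates[OF D.is_group N.factorgroup_is_group N(2) this g(1)] N(3) show ?thesis
      by simp
  next
    case True
    define w where "w = arg_min length (\<lambda>w. g = D.word_value diff w)"
    obtain w0 where "g = D.word_value diff w0"
      by (rule kernel_fold_word[OF g(1) True])
    then have w: "g = D.word_value diff w"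
      unfolding w_def by (rule arg_min_natI)
    have min: "length w \<le> length v" if "g = D.word_value diff v" for v
      unfolding w_def using that by (rule arg_min_nat_le)
    have letters: "snd l \<in> carrier G - H" if "l \<in> set w" for l
    proof (rule ccontr)
      assume "snd l \<notin> carrier G - H"
      then have "diff (snd l) = \<one>\<^bsub>D\<^esub>" using diff_H by (auto simp: diff_def)
      then have l: "D.letter_value diff l = \<one>\<^bsub>D\<^esub>" by (simp add: D.letter_value_def)
      obtain u v where uv: "w = u @ l # v" using split_list[OF \<open>l \<in> set w\<close>] by blast
      have "g = D.word_value diff (u @ v)"
        using w l by (simp add: uv D.word_value_append)
      from min[OF this] show False by (simp add: uv)
    qed
    define w' where "w' = map (\<lambda>l. (fst l, snd l <#\<^bsub>G\<^esub> H)) w"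
    have "successively (\<lambda>l m. (fst m, snd m <#\<^bsub>G\<^esub> H) \<noteq> letter_inv (fst l, snd l <#\<^bsub>G\<^esub> H)) w"
    proof (rule successivelyI, rule notI)
      fix u l m v
      assume uv: "w = u @ l # m # v" and eq: "(fst m, snd m <#\<^bsub>G\<^esub> H) = letter_inv (fst l, snd l <#\<^bsub>G\<^esub> H)"
      have carr: "snd l \<in> carrier G" "snd m \<in> carrier G" using letters by (auto simp: uv)
      then have "snd m \<in> snd l <#\<^bsub>G\<^esub> H"
        using eq self_coset[of "snd m"] by (simp add: letter_inv_def)
      then obtain h where "h \<in> H" "snd m = snd l \<otimes>\<^bsub>G\<^esub> h" by (auto simp: l_coset_def)
      then have "diff (snd m) = diff (snd l)" using diff_coset carr by simp
      moreover have "fst m = (\<not> fst l)" using eq by (simp add: letter_inv_def)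
      ultimately have "D.letter_value diff l \<otimes>\<^bsub>D\<^esub> D.letter_value diff m = \<one>\<^bsub>D\<^esub>"
        by (simp add: D.letter_value_def)
      then have "D.letter_value diff l \<otimes>\<^bsub>D\<^esub> (D.letter_value diff m \<otimes>\<^bsub>D\<^esub> D.word_value diff v) = D.word_value diff v"
        by (simp add: D.m_assoc [symmetric])
      then have "g = D.word_value diff (u @ v)"
        using w by (simp add: uv D.word_value_append)
      from min[OF this] show False by (simp add: uv)
    qed
    then have red: "reduced w'" by (simp add: reduced_def w'_def successively_map)
    have "w \<noteq> []" using w g(2) by auto
    then have "w' \<noteq> []" by (simp add: w'_def)
    with red obtain S' :: "'a set letter list set" and \<pi> where S': "finite S'" "\<And>c. \<pi> c permutes S'"
      "group.word_value (perm_group S') \<pi> w' \<noteq> id"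
      by (rule free_group_residually_finite) blast
    have "snd ` set w \<subseteq> carrier G" using letters by auto
    from sep[OF finite_imageI[OF finite_set] this] obtain S \<alpha> where
      S_all: "finite S \<and> H \<in> S \<and> \<alpha> \<in> hom G (perm_group S) \<and> (\<forall>h\<in>H. \<alpha> h H = H) \<and>
        (\<forall>x\<in>snd ` set w. \<alpha> x H = x <#\<^bsub>G\<^esub> H)"
      by (elim exE) (rule that)
    note S = conjunct1[OF S_all] conjunct2[OF S_all, THEN conjunct1]
      conjunct2[OF S_all, THEN conjunct2, THEN conjunct1]
    note H_fixed = conjunct2[OF S_all, THEN conjunct2, THEN conjunct2, THEN conjunct1]
    note translates = conjunct2[OF S_all, THEN conjunct2, THEN conjunct2, THEN conjunct2]
    interpret P: group "perm_group S'" by (rule group_perm_group)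
    define q where "q c = (if c = H then id else \<pi> c)" for c
    have not_H: "x <#\<^bsub>G\<^esub> H \<noteq> H" if "x \<in> snd ` set w" for x
    proof -
      have "x \<in> x <#\<^bsub>G\<^esub> H" "x \<notin> H"
        using that letters self_coset[of x] by auto
      then show ?thesis by auto
    qed
    define p where "p \<sigma> = q (\<sigma> H)" for \<sigma> :: "'a set \<Rightarrow> 'a set"
    have q: "q c permutes S'" for c using S'(2) by (simp add: q_def permutes_id)
    have p1: "p \<in> carrier (perm_group S) \<rightarrow> carrier (perm_group S')"
      using q by (simp add: p_def)
    have p2: "p (r \<otimes>\<^bsub>perm_group S\<^esub> \<alpha> h) = p r" if "h \<in> H" for r h
      using bspec[OF H_fixed that] by (simp add: p_def)
    have p3: "p \<one>\<^bsub>perm_group S\<^esub> = \<one>\<^bsub>perm_group S'\<^esub>"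
      by (simp add: p_def q_def)
    obtain \<Psi> where \<Psi>: "\<Psi> \<in> hom D (wreath (perm_group S') (perm_group S))"
      "\<And>w. fst (\<Psi> (D.word_value diff w)) \<one>\<^bsub>perm_group S\<^esub> =
        P.word_value (\<lambda>x. if x \<in> carrier G then p (\<alpha> x) else \<one>\<^bsub>perm_group S'\<^esub>) w"
      by (rule twisted_double_hom[where p = p, OF P.is_group group_perm_group S(3) p1 p2 p3], assumption) (rule that)
    have "fst (\<Psi> g) id = P.word_value (\<lambda>x. if x \<in> carrier G then p (\<alpha> x) else id) w"
      using \<Psi>(2)[of w] unfolding one_perm_group w .
    also have "\<dots> = P.word_value (\<lambda>x. \<pi> (x <#\<^bsub>G\<^esub> H)) w"
    proof (rule P.word_value_cong)
      fix l assume "l \<in> set w"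
      then have "snd l \<in> carrier G" "snd l \<in> snd ` set w" using letters by auto
      then show "(if snd l \<in> carrier G then p (\<alpha> (snd l)) else id) = \<pi> (snd l <#\<^bsub>G\<^esub> H)"
        using bspec[OF translates] not_H by (simp add: p_def q_def)
    qed
    also have "\<dots> = P.word_value \<pi> w'"
      unfolding w'_def by (rule P.word_value_map [where f = "\<lambda>x. x <#\<^bsub>G\<^esub> H", symmetric])
    finally have "fst (\<Psi> g) id \<noteq> id" using S'(3) by simp
    moreover have "fst \<one>\<^bsub>wreath (perm_group S') (perm_group S)\<^esub> id = id"
      by (simp add: one_wreath permutes_id)
    ultimately have "\<Psi> g \<noteq> \<one>\<^bsub>wreath (perm_group S') (perm_group S)\<^esub>"
      by metis
    moreover interpret WP: wreath_product "perm_group S'" "perm_group S"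
      by (simp add: wreath_product_def group_perm_group)
    have "finite (carrier (wreath (perm_group S') (perm_group S)))"
      using S(1) S'(1) by (intro WP.finite_wreath finite_perm_group)
    ultimately show ?thesis
      by (intro finite_hom_separates[OF D.is_group WP.W.is_group _ \<Psi>(1) g(1)])
  qed
qed

section \<open>The subgroups of multiplying sequences\<close>

abbreviation "gA \<equiv> basis_elem gen_a"
abbreviation "gB \<equiv> basis_elem gen_b"

definition H_gen :: "(nat \<Rightarrow> nat) \<Rightarrow> nat \<Rightarrow> basis letter list" where
  "H_gen s n = gB [^]\<^bsub>F2\<^esub> n \<cdot> gA [^]\<^bsub>F2\<^esub> s n \<cdot> inv\<^bsub>F2\<^esub> (gB [^]\<^bsub>F2\<^esub> n)"

lemma H_seq_generate: "H_seq s = generate F2 (range (H_gen s))"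
  by (simp add: H_seq_def H_gen_def)

lemma H_gen_closed [simp]: "H_gen s n \<in> carrier F2"
  by (simp add: H_gen_def)

lemma H_gen_H_seq [simp]: "H_gen s n \<in> H_seq s"
  by (simp add: H_seq_generate generate.incl)

lemma subgroup_H_seq: "subgroup (H_seq s) F2"
  unfolding H_seq_generate by (rule F.generate_is_subgroup) auto

lemma H_seq_subset:
  assumes "subgroup K F2" "\<And>n. H_gen s n \<in> K"
  shows "H_seq s \<subseteq> K"
  unfolding H_seq_generate by (rule F.generate_subgroup_incl[OF _ assms(1)]) (use assms(2) in auto)

text \<open>
  If \<open>a\<close> is mapped to a function supported at 0 and \<open>b\<close> to the translation, the
  functions in the image of \<open>H_seq s\<close> vanish at all negative arguments. This separates the cosets
  of \<open>H_seq s\<close> considered below.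
\<close>

abbreviation "ZZ \<equiv> wreath integer_group integer_group"

interpretation ZZ: wreath_product integer_group integer_group
  by (simp add: wreath_product_def)

fun lamp :: "basis \<Rightarrow> (int \<Rightarrow> int) \<times> int" where
  "lamp gen_a = (\<lambda>x. if x = 0 then 1 else 0, 0)"
| "lamp gen_b = (\<lambda>x. 0, 1)"

lemma mult_ZZ: "(f, r) \<otimes>\<^bsub>ZZ\<^esub> (g, t) = (\<lambda>x. f (t + x) + g x, r + t)"
  by (simp add: mult_wreath restrict_UNIV)

lemma carrier_ZZ [simp]: "x \<in> carrier ZZ"
  by (cases x) (simp add: carrier_wreath)

lemma one_ZZ: "\<one>\<^bsub>ZZ\<^esub> = (\<lambda>x. 0, 0)"
  by (simp add: one_wreath restrict_UNIV)

lemma range_lamp: "range lamp \<subseteq> carrier ZZ"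
  by (simp add: image_subset_iff)

interpretation lamp: group_hom F2 ZZ "ZZ.W.word_value lamp"
  by (simp add: group_hom_defs F.is_group ZZ.W.is_group ZZ.W.word_value_hom range_lamp)

lemma inv_ZZ: "inv\<^bsub>ZZ\<^esub> (f, r) = (\<lambda>x. - f (x - r), - r)"
  by (rule ZZ.W.inv_equality) (simp_all add: mult_ZZ one_ZZ)

lemma lamp_gA: "ZZ.W.word_value lamp (gA [^]\<^bsub>F2\<^esub> (j::int)) = (\<lambda>x. if x = 0 then j else 0, 0)"
proof -
  have nat: "lamp gen_a [^]\<^bsub>ZZ\<^esub> n = (\<lambda>x. if x = 0 then int n else 0, 0)" for n :: nat
    by (induction n) (auto simp: one_ZZ mult_ZZ)
  have "lamp gen_a [^]\<^bsub>ZZ\<^esub> j = (\<lambda>x. if x = 0 then j else 0, 0)"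
    by (cases j) (simp_all add: int_pow_int ZZ.W.int_pow_neg_int nat del: lamp.simps of_nat_Suc,
        auto simp: mult_ZZ inv_ZZ)
  then show ?thesis by (simp add: lamp.hom_int_pow range_lamp del: lamp.simps)
qed

lemma lamp_gB: "ZZ.W.word_value lamp (gB [^]\<^bsub>F2\<^esub> (i::int)) = (\<lambda>x. 0, i)"
proof -
  have nat: "lamp gen_b [^]\<^bsub>ZZ\<^esub> n = (\<lambda>x. 0, int n)" for n :: nat
    by (induction n) (auto simp: one_ZZ mult_ZZ)
  have "lamp gen_b [^]\<^bsub>ZZ\<^esub> i = (\<lambda>x. 0, i)"
    by (cases i) (simp_all add: int_pow_int ZZ.W.int_pow_neg_int nat del: lamp.simps of_nat_Suc,
        auto simp: mult_ZZ inv_ZZ)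
  then show ?thesis by (simp add: lamp.hom_int_pow range_lamp del: lamp.simps)
qed

lemma lamp_H_seq:
  assumes "h \<in> H_seq s"
  shows "snd (ZZ.W.word_value lamp h) = 0 \<and> (\<forall>x<0. fst (ZZ.W.word_value lamp h) x = 0)"
proof -
  let ?L = "ZZ.W.word_value lamp"
  define K where "K = {x \<in> carrier F2. snd (?L x) = 0 \<and> (\<forall>y<0. fst (?L x) y = 0)}"
  have "subgroup K F2"
  proof (rule F.subgroupI)
    show "K \<subseteq> carrier F2" by (auto simp: K_def)
    have "\<one>\<^bsub>F2\<^esub> \<in> K" using lamp.hom_one by (simp add: K_def one_ZZ)
    then show "K \<noteq> {}" by blast
  next
    fix x assume "x \<in> K"
    then show "inv\<^bsub>F2\<^esub> x \<in> K"
      by (cases "?L x") (auto simp: K_def lamp.hom_inv inv_ZZ)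
  next
    fix x y assume "x \<in> K" "y \<in> K"
    then show "x \<cdot> y \<in> K"
      by (cases "?L x"; cases "?L y") (auto simp: K_def lamp.hom_mult mult_ZZ)
  qed
  moreover have "H_gen s n \<in> K" for n
    using lamp_gA[of "int (s n)"] lamp_gB[of "int n"]
    by (simp add: K_def H_gen_def lamp.hom_mult lamp.hom_inv inv_ZZ mult_ZZ int_pow_int)
  ultimately have "H_seq s \<subseteq> K" by (rule H_seq_subset)
  with assms show ?thesis by (auto simp: K_def)
qed

locale multiplying_sequence =
  fixes s :: "nat \<Rightarrow> nat"
  assumes multiplying: "multiplying s"
begin

lemma pos: "s n > 0"
  using multiplying by (simp add: multiplying_def)

lemma dvd: "m \<le> n \<Longrightarrow> s m dvd s n"
proof (induction rule: dec_induct)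
  case (step n)
  then show ?case using multiplying dvd_trans unfolding multiplying_def by blast
qed simp

lemma unbounded:
  obtains n where "n \<ge> m" "s n > k"
proof -
  have "filterlim s at_top sequentially" using multiplying by (simp add: multiplying_def)
  then have "eventually (\<lambda>n. s n \<ge> Suc k) sequentially" by (simp add: filterlim_at_top)
  then obtain N where "\<And>n. n \<ge> N \<Longrightarrow> s n \<ge> Suc k" by (auto simp: eventually_sequentially)
  then show thesis using that[of "max m N"] by (simp add: Suc_le_eq)
qed

abbreviation "H \<equiv> H_seq s"

sublocale group_double F2 H
  by (simp add: group_double_def F.is_group subgroup_H_seq)

text \<open>
  The cosets \<open>point j i\<close> are those that are relevant for the powers of the generators. The coset
  \<open>H\<close> lies on the line of the \<open>point 0 i\<close>, which \<open>b\<close> translates. The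
  orbits of \<open>a\<close> are finite, of length dividing \<open>s n\<close>, at \<open>point 0 (- n)\<close>,
  and infinite at \<open>point 0 i\<close> for \<open>i > 0\<close>.
\<close>

definition point :: "int \<Rightarrow> int \<Rightarrow> basis letter list set" where
  "point j i = (gA [^]\<^bsub>F2\<^esub> j \<cdot> gB [^]\<^bsub>F2\<^esub> i) \<bullet> H"

lemma coset_eq_iff:
  assumes "x \<in> carrier F2" "y \<in> carrier F2"
  shows "x \<bullet> H = y \<bullet> H \<longleftrightarrow> inv\<^bsub>F2\<^esub> y \<cdot> x \<in> H"
proof
  assume "x \<bullet> H = y \<bullet> H"
  then obtain h where "h \<in> H" "x = y \<cdot> h"
    using self_coset[OF assms(1)] by (auto simp: l_coset_def)
  then show "inv\<^bsub>F2\<^esub> y \<cdot> x \<in> H"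
    using assms by (simp add: F.m_assoc [symmetric])
next
  assume h: "inv\<^bsub>F2\<^esub> y \<cdot> x \<in> H"
  have "x \<in> y \<bullet> H"
    unfolding l_coset_def using h assms by (auto intro!: bexI[OF _ h] simp: F.m_assoc [symmetric])
  then show "x \<bullet> H = y \<bullet> H"
    using F.l_repr_independence[OF _ assms(2) subgroup_H_seq] by simp
qed

lemma coset_mult: "x \<in> carrier F2 \<Longrightarrow> y \<in> carrier F2 \<Longrightarrow> x \<bullet> (y \<bullet> H) = (x \<cdot> y) \<bullet> H"
  by (rule F.lcos_m_assoc[OF H.subset])

lemma coset_one: "\<one>\<^bsub>F2\<^esub> \<bullet> H = H"
  by (rule F.lcos_mult_one[OF H.subset])

lemma point_base: "point 0 0 = H"
  by (simp add: point_def coset_one)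

lemma point_a: "gA [^]\<^bsub>F2\<^esub> (k::int) \<bullet> point j i = point (k + j) i"
  by (simp add: point_def coset_mult F.m_assoc [symmetric] F.int_pow_mult)

lemma point_b: "gB \<bullet> point 0 i = point 0 (i + 1)"
  using F.int_pow_mult[of gB 1 i] by (simp add: point_def coset_mult add.commute)

lemma point_eqD:
  assumes "point j i = point j' i'"
  shows "i = i'" and "i > 0 \<Longrightarrow> j = j'"
proof -
  let ?L = "ZZ.W.word_value lamp"
  let ?x = "gA [^]\<^bsub>F2\<^esub> j \<cdot> gB [^]\<^bsub>F2\<^esub> i" and ?y = "gA [^]\<^bsub>F2\<^esub> j' \<cdot> gB [^]\<^bsub>F2\<^esub> i'"
  have "inv\<^bsub>F2\<^esub> ?y \<cdot> ?x \<in> H"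
    using assms by (simp add: point_def coset_eq_iff)
  note lamp_H_seq[OF this]
  moreover have "?L (inv\<^bsub>F2\<^esub> ?y \<cdot> ?x) =
      (\<lambda>x. - (if i + x = 0 then j' else 0) + (if i + x = 0 then j else 0), i - i')"
    by (auto simp: lamp.hom_mult lamp.hom_inv lamp_gA lamp_gB inv_ZZ mult_ZZ)
  ultimately have *: "i - i' = 0"
    "\<forall>x<0. - (if i + x = 0 then j' else 0) + (if i + x = 0 then j else 0) = 0" by auto
  show "i = i'" using *(1) by simp
  show "j = j'" if "i > 0"
    using *(2)[rule_format, of "- i"] that by simp
qed

lemma point_periodic: "point (j + int (s n)) (- int n) = point j (- int n)"
proof -
  have "gA [^]\<^bsub>F2\<^esub> s n \<cdot> inv\<^bsub>F2\<^esub> (gB [^]\<^bsub>F2\<^esub> n) = inv\<^bsub>F2\<^esub> (gB [^]\<^bsub>F2\<^esub> n) \<cdot> H_gen s n"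
    by (simp add: H_gen_def F.m_assoc [symmetric])
  then have "point (int (s n)) (- int n) = inv\<^bsub>F2\<^esub> (gB [^]\<^bsub>F2\<^esub> n) \<bullet> (H_gen s n \<bullet> H)"
    by (simp add: point_def int_pow_int F.int_pow_neg_int coset_mult)
  also have "H_gen s n \<bullet> H = H"
    using coset_eq_iff[of "H_gen s n" "\<one>\<^bsub>F2\<^esub>"] coset_one by simp
  also have "inv\<^bsub>F2\<^esub> (gB [^]\<^bsub>F2\<^esub> n) \<bullet> H = point 0 (- int n)"
    by (simp add: point_def int_pow_int F.int_pow_neg_int)
  finally have "gA [^]\<^bsub>F2\<^esub> j \<bullet> point (int (s n)) (- int n) = gA [^]\<^bsub>F2\<^esub> j \<bullet> point 0 (- int n)"
    by simp
  then show ?thesis by (simp only: point_a) simp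
qed

end

lemma singleton_closed [simp]: "[l] \<in> carrier free_group"
  by (simp add: carrier_free_group reduced_def)

lemma letter_inv_mult: "[letter_inv l] \<otimes>\<^bsub>free_group\<^esub> [l] = \<one>\<^bsub>free_group\<^esub>"
  by (subst mult_letter_free_group) (auto simp: reduced_def one_free_group)

context multiplying_sequence
begin

definition cosets :: "basis letter list set set" where
  "cosets = (\<lambda>x. x \<bullet> H) ` carrier F2"

lemma cosets_act:
  assumes "c \<in> cosets" "x \<in> carrier F2"
  shows "x \<bullet> c \<in> cosets" "inv\<^bsub>F2\<^esub> x \<bullet> (x \<bullet> c) = c"
proof -
  obtain y where y: "y \<in> carrier F2" "c = y \<bullet> H" using assms(1) by (auto simp: cosets_def)
  then show "x \<bullet> c \<in> cosets"
    using assms(2) by (auto simp: cosets_def coset_mult)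
  show "inv\<^bsub>F2\<^esub> x \<bullet> (x \<bullet> c) = c"
    using assms(2) y by (simp add: coset_mult F.m_assoc [symmetric])
qed

lemma cosets_cancel:
  "c \<in> cosets \<Longrightarrow> d \<in> cosets \<Longrightarrow> x \<in> carrier F2 \<Longrightarrow> x \<bullet> c = x \<bullet> d \<Longrightarrow> c = d"
  using cosets_act(2) by metis

lemma point_cosets: "point j i \<in> cosets"
  by (simp add: point_def cosets_def)

lemma foldr_coset:
  "reduced v \<Longrightarrow> foldr (\<lambda>l c. [l] \<bullet> c) v H = v \<bullet> H"
proof (induction v)
  case Nil
  then show ?case using coset_one by (simp add: one_free_group)
next
  case (Cons l v)
  have v: "reduced v" by (rule reduced_ConsD[OF Cons.prems])
  have "[l] \<cdot> v = l # v"
    using v Cons.prems by (simp add: mult_letter_free_group cancel_cons_reduced)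
  moreover have "[l] \<bullet> (v \<bullet> H) = ([l] \<cdot> v) \<bullet> H"
    using v by (intro coset_mult singleton_closed) (simp add: carrier_free_group)
  ultimately show ?case using Cons.IH[OF v] by simp
qed

lemma point_mod: "point (int j) (- int n) = point (int (j mod s n)) (- int n)"
proof (induction j rule: less_induct)
  case (less j)
  show ?case
  proof (cases "j < s n")
    case False
    then have "point (int (j - s n)) (- int n) = point (int ((j - s n) mod s n)) (- int n)"
      using pos[of n] by (intro less.IH) auto
    moreover have "(j - s n) mod s n = j mod s n" using False by (simp add: le_mod_geq)
    moreover have "point (int (j - s n) + int (s n)) (- int n) = point (int (j - s n)) (- int n)"
      by (rule point_periodic)
    ultimately show ?thesis using False by (simp add: of_nat_diff)
  qed simp
qed

text \<open>
  The subgroup is closed in the profinite topology. A finite set of cosets is enlarged to a finite set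
  \<open>S\<close> on which the generators act as partial injections, and these are completed to permutations in
  such a way that the cycle of \<open>b\<close> through \<open>H\<close> consists of the cosets \<open>point 0
  i\<close> for \<open>- N \<le> i \<le> K\<close>. At those with \<open>i \<le> 0\<close> the cycle of
  \<open>a\<close> has length dividing \<open>s (- i)\<close>, and at those with \<open>i > 0\<close> it is
  closed up artificially to length \<open>s N\<close>; this requires \<open>s N\<close> to be large. As
  \<open>n\<close> backward steps along \<open>b\<close> lead from \<open>H\<close> to a coset with \<open>i >
  0\<close> only if \<open>n > N\<close>, and to \<open>point 0 (- m)\<close> only if \<open>m \<le> n\<close>,
  divisibility within the sequence implies that every generator of \<open>H\<close> fixes the coset
  \<open>H\<close>.
\<close>

lemma separating_representation:
  assumes T: "finite T" "T \<subseteq> carrier F2"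
  shows "\<exists>S \<alpha>. finite S \<and> H \<in> S \<and> \<alpha> \<in> hom F2 (perm_group S) \<and>
    (\<forall>h\<in>H. \<alpha> h H = H) \<and> (\<forall>x\<in>T. \<alpha> x H = x \<bullet> H)"
proof -
  define S0 where "S0 = (\<lambda>v. v \<bullet> H) ` (insert \<one>\<^bsub>F2\<^esub> (\<Union>x\<in>T. {v. \<exists>u. x = u @ v}))"
  have fin_S0: "finite S0"
    unfolding S0_def using T(1) finite_suffixes by (intro finite_imageI) auto
  have suffix_carrier: "v \<in> carrier F2" if "u @ v \<in> T" for u v
    using that T(2) reduced_appendD by (auto simp: carrier_free_group)
  have S0_cosets: "S0 \<subseteq> cosets"
    using suffix_carrier by (auto simp: S0_def cosets_def)
  have H_S0: "H \<in> S0"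
    using coset_one by (auto simp: S0_def)
  \<comment> \<open>all relevant points of \<open>S0\<close> have coordinates at most \<open>K\<close>\<close>
  define P where "P = {(i, j). (i > 0 \<or> j = 0) \<and> point j i \<in> S0}"
  have "finite P"
  proof (rule finite_imageD)
    have "(\<lambda>(i, j). point j i) ` P \<subseteq> S0" by (auto simp: P_def)
    then show "finite ((\<lambda>(i, j). point j i) ` P)" using fin_S0 by (rule finite_subset)
    show "inj_on (\<lambda>(i, j). point j i) P"
      by (rule inj_onI) (auto simp: P_def dest: point_eqD)
  qed
  define K where "K = Max (insert 1 ((\<lambda>(i, j). max \<bar>i\<bar> \<bar>j\<bar>) ` P))"
  have "1 \<le> K"
    unfolding K_def using \<open>finite P\<close> by (intro Max_ge) auto
  moreover have "max \<bar>i\<bar> \<bar>j\<bar> \<le> K" if "(i, j) \<in> P" for i j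
    unfolding K_def using \<open>finite P\<close> that by (intro Max_ge) force+
  ultimately have K: "K \<ge> 1" "\<And>i j. (i, j) \<in> P \<Longrightarrow> max \<bar>i\<bar> \<bar>j\<bar> \<le> K" by auto
  have K_pos: "i \<le> K \<and> \<bar>j\<bar> \<le> K" if "i > 0" "point j i \<in> S0" for i j
    using K(2)[of i j] that by (auto simp: P_def)
  have K_line: "\<bar>i\<bar> \<le> K" if "point 0 i \<in> S0" for i
    using K(2)[of i 0] that by (auto simp: P_def)
  obtain N where "N \<ge> nat K" "s N > nat (2 * K + 1)" by (rule unbounded)
  define M where "M = int (s N)"
  have N: "int N \<ge> K" and M: "M > 2 * K + 1"
    using \<open>N \<ge> nat K\<close> \<open>s N > nat (2 * K + 1)\<close> K(1) by (auto simp: M_def)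
  define S where "S = S0 \<union> (\<lambda>(i, j). point j i) ` ({1..K} \<times> {- K..<M - K}) \<union>
    (\<lambda>(n, j). point j (- int n)) ` (SIGMA n:{..N}. {0..<int (s n)})"
  have fin_S: "finite S" unfolding S_def using fin_S0 by auto
  have S_cosets: "S \<subseteq> cosets" unfolding S_def using S0_cosets point_cosets by auto
  have S0_S: "S0 \<subseteq> S" by (auto simp: S_def)
  have S_pos: "point j i \<in> S" if "1 \<le> i" "i \<le> K" "- K \<le> j" "j < M - K" for i j
    using that by (force simp: S_def)
  have S_nonpos: "point (int j) (- int n) \<in> S" if "n \<le> N" for n j
  proof -
    have "j mod s n < s n" using pos by simp
    then have "point (int (j mod s n)) (- int n) \<in> S"
      using that unfolding S_def by (intro UnI2 image_eqI[of _ _ "(n, int (j mod s n))"]) auto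
    then show ?thesis using point_mod by simp
  qed
  have S_posD: "i \<le> K \<and> - K \<le> j \<and> j < M - K" if "point j i \<in> S" "i > 0" for i j
  proof -
    from that(1) consider "point j i \<in> S0"
      | i' j' where "point j i = point j' i'" "1 \<le> i'" "i' \<le> K" "- K \<le> j'" "j' < M - K"
      | n j' where "point j i = point j' (- int n)"
      by (auto simp: S_def)
    then show ?thesis
    proof cases
      case 1
      from K_pos[OF that(2) this] M show ?thesis by linarith
    next
      case 2
      then show ?thesis using point_eqD[OF 2(1)] that(2) by auto
    next
      case 3
      then show ?thesis using point_eqD(1)[OF 3] that(2) by auto
    qed
  qed
  have S_lineD: "- int N \<le> i \<and> i \<le> K" if "point 0 i \<in> S" for i
  proof -
    from that consider "point 0 i \<in> S0"
      | i' j' where "point 0 i = point j' i'" "1 \<le> i'" "i' \<le> K"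
      | n j' where "point 0 i = point j' (- int n)" "n \<le> N"
      by (auto simp: S_def)
    then show ?thesis
    proof cases
      case 1
      then show ?thesis using K_line N by fastforce
    next
      case 2
      then show ?thesis using point_eqD(1)[OF 2(1)] by auto
    next
      case 3
      then show ?thesis using point_eqD(1)[OF 3(1)] K(1) by auto
    qed
  qed
  note a_int = point_a[of 1, simplified]

  \<comment> \<open>the windows of the infinite orbits of \<open>a\<close> are closed up at the points of \<open>E\<close> to cycles of length \<open>M\<close>\<close>
  define E where "E = point (M - K - 1) ` {1..K}"
  have E_S: "E \<subseteq> S" using S_pos M K(1) by (auto simp: E_def)
  have E_iff: "point j i \<in> E \<longleftrightarrow> i \<in> {1..K} \<and> j = M - K - 1" for i j
  proof
    assume "point j i \<in> E"
    then obtain i' where i': "i' \<in> {1..K}" "point j i = point (M - K - 1) i'" by (auto simp: E_def)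
    then show "i \<in> {1..K} \<and> j = M - K - 1"
      using point_eqD[OF i'(2)] by auto
  qed (auto simp: E_def)
  have E_S0: "c \<notin> S0" if "c \<in> E" for c
  proof
    assume "c \<in> S0"
    with that obtain i where i: "i \<in> {1..K}" "point (M - K - 1) i \<in> S0" by (auto simp: E_def)
    from K_pos[OF _ i(2)] i(1) have "\<bar>M - K - 1\<bar> \<le> K" by auto
    with M show False by linarith
  qed
  define g where "g c = (if c \<in> E then gA [^]\<^bsub>F2\<^esub> (1 - M) \<bullet> c else gA \<bullet> c)" for c
  have g_E: "g (point (M - K - 1) i) = point (- K) i" if "i \<in> {1..K}" for i
    using that point_a[of "1 - M" "M - K - 1" i] by (auto simp: g_def E_def)
  define Da where "Da = E \<union> {c \<in> S. c \<notin> E \<and> gA \<bullet> c \<in> S}"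
  have Da [simp]: "c \<in> Da \<longleftrightarrow> c \<in> E \<or> c \<in> S \<and> c \<notin> E \<and> gA \<bullet> c \<in> S" for c
    by (auto simp: Da_def)
  have Da_S: "Da \<subseteq> S" using E_S by auto
  have "inj_on g Da"
  proof -
    have mixed: False if "c \<in> E" "d \<in> S" "d \<notin> E" "g c = g d" for c d
    proof -
      obtain i where i: "i \<in> {1..K}" "c = point (M - K - 1) i" using \<open>c \<in> E\<close> by (auto simp: E_def)
      then have "gA \<bullet> d = gA \<bullet> point (- K - 1) i"
        using that(3,4) g_E[OF i(1)] a_int[of "- K - 1" i] by (simp add: g_def)
      then have "d = point (- K - 1) i"
        by (rule cosets_cancel[OF subsetD[OF S_cosets that(2)] point_cosets basis_elem_closed])
      then show False using S_posD[of "- K - 1" i] that(2) i(1) by auto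
    qed
    show ?thesis
    proof (rule inj_onI)
      fix c d
      assume cd: "c \<in> Da" "d \<in> Da"
        and eq: "g c = g d"
      have "c \<in> S" "d \<in> S" using cd E_S by auto
      then have coset: "c \<in> cosets" "d \<in> cosets" using S_cosets by auto
      have "c \<in> E \<longleftrightarrow> d \<in> E" using cd eq mixed[of c d] mixed[of d c] by auto
      then show "c = d"
        using eq coset cosets_cancel[OF coset, of gA] cosets_cancel[OF coset, of "gA [^]\<^bsub>F2\<^esub> (1 - M)"]
        by (auto simp: g_def split: if_splits)
    qed
  qed
  moreover have "g ` Da \<subseteq> S"
  proof -
    have "g c \<in> S" if "c \<in> E" for c
      using that g_E S_pos M K(1) by (auto simp: E_def)
    then show ?thesis by (auto simp: g_def)
  qed
  ultimately obtain \<pi>a where \<pi>a: "\<pi>a permutes S"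
    "\<And>c. c \<in> Da \<Longrightarrow> \<pi>a c = g c"
    using partial_injection_extends[OF fin_S, of Da g] Da_S by metis
  have \<pi>a_step: "\<pi>a (point j i) = point (j + 1) i"
    if "point j i \<in> S" "point (j + 1) i \<in> S" "point j i \<notin> E" for i j
    using that \<pi>a(2)[of "point j i"] a_int[of j i] by (simp add: g_def add.commute)
  have \<pi>a_E: "\<pi>a (point (M - K - 1) i) = point (- K) i" if "i \<in> {1..K}" for i
    using that \<pi>a(2) g_E E_iff by auto
  have \<pi>a_S0: "\<pi>a c = gA \<bullet> c" if "c \<in> S0" "gA \<bullet> c \<in> S0" for c
  proof -
    have "c \<notin> E" using E_S0 that(1) by blast
    moreover have "c \<in> S" "gA \<bullet> c \<in> S" using that S0_S by blast+
    ultimately show ?thesis using \<pi>a(2)[of c] by (simp add: g_def)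
  qed

  \<comment> \<open>the segment from \<open>point 0 (- N)\<close> to \<open>point 0 K\<close> is closed up to a cycle of \<open>b\<close>\<close>
  define g' where "g' c = (if c = point 0 K then point 0 (- int N) else gB \<bullet> c)" for c
  define Db where "Db = insert (point 0 K) {c \<in> S. gB \<bullet> c \<in> S}"
  have Db [simp]: "c \<in> Db \<longleftrightarrow> c = point 0 K \<or> c \<in> S \<and> gB \<bullet> c \<in> S" for c
    by (auto simp: Db_def)
  have "inj_on g' Db"
  proof -
    have mixed: False if "d \<in> S" "gB \<bullet> d = point 0 (- int N)" for d
    proof -
      have "gB \<bullet> d = gB \<bullet> point 0 (- int N - 1)" using that point_b by simp
      then have "d = point 0 (- int N - 1)"
        by (rule cosets_cancel[OF subsetD[OF S_cosets that(1)] point_cosets basis_elem_closed])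
      then show False using S_lineD[of "- int N - 1"] that(1) by auto
    qed
    show ?thesis
    proof (rule inj_onI)
      fix c d
      assume cd: "c \<in> Db" "d \<in> Db"
        and eq: "g' c = g' d"
      have "c \<in> cosets" "d \<in> cosets" using cd S_cosets point_cosets by auto
      from cosets_cancel[OF this, of gB] show "c = d"
        using cd eq mixed[of c] mixed[of d] by (auto simp: g'_def split: if_splits)
    qed
  qed
  moreover have "g' ` Db \<subseteq> S"
    using S_nonpos[of N 0] by (auto simp: g'_def)
  moreover have top: "point 0 K \<in> S" using S_pos[of K 0] K(1) M by auto
  ultimately obtain \<pi>b where \<pi>b: "\<pi>b permutes S"
    "\<And>c. c \<in> Db \<Longrightarrow> \<pi>b c = g' c"
    using partial_injection_extends[OF fin_S, of Db g'] by (metis Db subsetI)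
  have line: "point 0 i \<in> S" if "- int N \<le> i" "i \<le> K" for i
  proof (cases "i \<le> 0")
    case True
    then show ?thesis using S_nonpos[of "nat (- i)" 0] that by auto
  next
    case False
    then show ?thesis using S_pos[of i 0] that K(1) M by auto
  qed
  have \<pi>b_step: "\<pi>b (point 0 i) = point 0 (i + 1)" if "- int N \<le> i" "i < K" for i
  proof -
    have "point 0 i \<noteq> point 0 K" using point_eqD(1) that(2) by blast
    then show ?thesis
      using \<pi>b(2)[of "point 0 i"] line[of i] line[of "i + 1"] that point_b by (simp add: g'_def)
  qed
  have \<pi>b_top: "\<pi>b (point 0 K) = point 0 (- int N)" using \<pi>b(2) by (simp add: g'_def)
  have \<pi>b_S0: "\<pi>b c = gB \<bullet> c" if "c \<in> S0" "gB \<bullet> c \<in> S0" for c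
  proof -
    have "c \<noteq> point 0 K" using K_line[of "K + 1"] that(2) K(1) by (auto simp: point_b)
    moreover have "c \<in> S" "gB \<bullet> c \<in> S" using that S0_S by blast+
    ultimately show ?thesis using \<pi>b(2)[of c] by (simp add: g'_def)
  qed

  define \<pi> where "\<pi> x = (case x of gen_a \<Rightarrow> \<pi>a | gen_b \<Rightarrow> \<pi>b)" for x
  have \<pi>: "\<pi> x permutes S" for x using \<pi>a(1) \<pi>b(1) by (cases x) (auto simp: \<pi>_def)
  interpret Q: group "perm_group S" by (rule group_perm_group)
  interpret \<alpha>: group_hom F2 "perm_group S" "Q.word_value \<pi>"
    using \<pi> by (simp add: group_hom_defs F.is_group Q.is_group)
      (intro Q.word_value_hom, auto)
  have pow: "p [^]\<^bsub>perm_group S\<^esub> n = p ^^ n" for p n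
    by (induction n) (auto simp: funpow_swap1 fun_eq_iff)
  have range_\<pi>: "range \<pi> \<subseteq> carrier (perm_group S)" using \<pi> by auto
  have \<alpha>_gA: "Q.word_value \<pi> (gA [^]\<^bsub>F2\<^esub> n) = \<pi>a ^^ n" for n :: nat
    using range_\<pi> by (simp add: \<alpha>.hom_nat_pow pow \<pi>_def)
  have \<alpha>_gB: "Q.word_value \<pi> (gB [^]\<^bsub>F2\<^esub> n) = \<pi>b ^^ n" for n :: nat
    using range_\<pi> by (simp add: \<alpha>.hom_nat_pow pow \<pi>_def)

  have nonpos_cycle: "(\<pi>a ^^ r) (point 0 (- int n)) = point (int r) (- int n)" if "n \<le> N" for n r
  proof (induction r)
    case (Suc r)
    have "point (int r) (- int n) \<notin> E" by (simp add: E_iff)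
    then show ?case
      using Suc \<pi>a_step[of "int r" "- int n"] S_nonpos[OF that, of r] S_nonpos[OF that, of "Suc r"]
      by (simp add: add.commute)
  qed simp
  have pos_walk: "(\<pi>a ^^ r) (point j i) = point (j + int r) i"
    if "i \<in> {1..K}" "- K \<le> j" "j + int r < M - K" for i j r
    using that(3)
  proof (induction r)
    case (Suc r)
    have "point (j + int r) i \<notin> E" using Suc.prems by (auto simp: E_iff)
    then show ?case
      using Suc \<pi>a_step[of "j + int r" i] S_pos[of i "j + int r"] S_pos[of i "j + int r + 1"] that
      by (simp add: algebra_simps)
  qed simp
  have pos_cycle: "(\<pi>a ^^ s N) (point 0 i) = point 0 i" if "i \<in> {1..K}" for i
  proof -
    define r where "r = nat (M - K - 1)"
    have r: "int r = M - K - 1" using M K(1) by (simp add: r_def)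
    have k: "int (nat K) = K" using K(1) by simp
    have "int (s N) = int (nat K + (Suc 0 + r))" using r k by (simp add: M_def)
    then have "s N = nat K + (Suc 0 + r)" by (simp only: of_nat_eq_iff)
    then have "(\<pi>a ^^ s N) (point 0 i) = (\<pi>a ^^ nat K) (\<pi>a ((\<pi>a ^^ r) (point 0 i)))"
      by (simp only: funpow_add o_apply) simp
    also have "(\<pi>a ^^ r) (point 0 i) = point (M - K - 1) i"
      using pos_walk[OF that, of 0 r] r K(1) by simp
    also have "\<pi>a (point (M - K - 1) i) = point (- K) i" by (rule \<pi>a_E[OF that])
    also have "(\<pi>a ^^ nat K) (point (- K) i) = point 0 i"
      using pos_walk[OF that, of "- K" "nat K"] k M K(1) by simp
    finally show ?thesis .
  qed
  have fixed_dvd: "(\<pi>a ^^ m) c = c" if "(\<pi>a ^^ k) c = c" "k dvd m" for k m c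
  proof -
    obtain r where m: "m = k * r" using \<open>k dvd m\<close> by blast
    have "((\<pi>a ^^ k) ^^ r) c = c" using that(1) by (induction r) auto
    then show ?thesis by (simp add: m funpow_mult mult.commute)
  qed
  \<comment> \<open>the position reached from \<open>H\<close> by \<open>n\<close> steps backwards along \<open>b\<close>\<close>
  have cycle: "\<exists>i. (\<pi>b ^^ n) (point 0 i) = H \<and>
      (- int N \<le> i \<and> i \<le> 0 \<and> - i \<le> int n \<or> i \<in> {1..K} \<and> N < n)" for n
  proof (induction n)
    case 0
    show ?case by (intro exI[of _ 0]) (simp add: point_base)
  next
    case (Suc n)
    then obtain i where i: "(\<pi>b ^^ n) (point 0 i) = H"
      "- int N \<le> i \<and> i \<le> 0 \<and> - i \<le> int n \<or> i \<in> {1..K} \<and> N < n" by blast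
    show ?case
    proof (cases "i = - int N")
      case True
      have "(\<pi>b ^^ Suc n) (point 0 K) = (\<pi>b ^^ n) (point 0 i)"
        unfolding True \<pi>b_top [symmetric] by (simp only: funpow_Suc_right o_apply)
      moreover have "N < Suc n" using i(2) unfolding True by auto
      ultimately show ?thesis using K(1) i(1) by (intro exI[of _ K]) simp
    next
      case False
      have "- int N \<le> i - 1" "i - 1 < K" using i(2) False K(1) by auto
      from \<pi>b_step[OF this] have "\<pi>b (point 0 (i - 1)) = point 0 i" by simp
      then have "(\<pi>b ^^ Suc n) (point 0 (i - 1)) = H"
        using i(1) by (simp only: funpow_Suc_right o_apply)
      moreover have "- int N \<le> i - 1 \<and> i - 1 \<le> 0 \<and> - (i - 1) \<le> int (Suc n) \<or> i - 1 \<in> {1..K} \<and> N < Suc n"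
        using i(2) False by auto
      ultimately show ?thesis by blast
    qed
  qed
  have gen_fixed: "Q.word_value \<pi> (H_gen s n) H = H" for n
  proof -
    obtain i where i: "(\<pi>b ^^ n) (point 0 i) = H"
      "- int N \<le> i \<and> i \<le> 0 \<and> - i \<le> int n \<or> i \<in> {1..K} \<and> N < n" using cycle by blast
    have fix_a: "(\<pi>a ^^ s n) (point 0 i) = point 0 i"
      using i(2)
    proof
      assume *: "- int N \<le> i \<and> i \<le> 0 \<and> - i \<le> int n"
      define m where "m = nat (- i)"
      have m: "i = - int m" "m \<le> N" "m \<le> n" using * by (auto simp: m_def)
      have "(\<pi>a ^^ s m) (point 0 i) = point 0 i"
        using nonpos_cycle[OF m(2), of "s m"] point_periodic[of 0 m] by (simp add: m(1))
      then show ?thesis using dvd[OF m(3)] by (rule fixed_dvd)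
    next
      assume *: "i \<in> {1..K} \<and> N < n"
      then have "s N dvd s n" by (intro dvd) simp
      moreover have "(\<pi>a ^^ s N) (point 0 i) = point 0 i" using pos_cycle * by simp
      ultimately show ?thesis by (rule fixed_dvd[rotated])
    qed
    have "H_gen s n \<cdot> gB [^]\<^bsub>F2\<^esub> n = gB [^]\<^bsub>F2\<^esub> n \<cdot> gA [^]\<^bsub>F2\<^esub> s n"
      by (simp add: H_gen_def F.m_assoc)
    then have "Q.word_value \<pi> (H_gen s n \<cdot> gB [^]\<^bsub>F2\<^esub> n) =
        Q.word_value \<pi> (gB [^]\<^bsub>F2\<^esub> n \<cdot> gA [^]\<^bsub>F2\<^esub> s n)" by simp
    then have "Q.word_value \<pi> (H_gen s n) \<circ> (\<pi>b ^^ n) = (\<pi>b ^^ n) \<circ> (\<pi>a ^^ s n)"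
      by (simp add: \<alpha>.hom_mult \<alpha>_gA \<alpha>_gB)
    then have "Q.word_value \<pi> (H_gen s n) ((\<pi>b ^^ n) (point 0 i)) = (\<pi>b ^^ n) ((\<pi>a ^^ s n) (point 0 i))"
      by (metis comp_apply)
    then show ?thesis using i(1) fix_a by simp
  qed
  have "subgroup {x \<in> carrier F2. Q.word_value \<pi> x H = H} F2"
  proof (rule F.subgroupI)
    have "\<one>\<^bsub>F2\<^esub> \<in> {x \<in> carrier F2. Q.word_value \<pi> x H = H}"
      using \<alpha>.hom_one by simp
    then show "{x \<in> carrier F2. Q.word_value \<pi> x H = H} \<noteq> {}" by blast
    fix x assume "x \<in> {x \<in> carrier F2. Q.word_value \<pi> x H = H}"
    then have x: "x \<in> carrier F2" "Q.word_value \<pi> x H = H" by auto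
    have "Q.word_value \<pi> x permutes S" using \<alpha>.hom_closed[OF x(1)] by simp
    then show "inv\<^bsub>F2\<^esub> x \<in> {x \<in> carrier F2. Q.word_value \<pi> x H = H}"
      using x by (simp add: \<alpha>.hom_inv inv_perm_group permutes_inv_eq)
  qed (auto simp: \<alpha>.hom_mult)
  then have fixes_H: "H \<subseteq> {x \<in> carrier F2. Q.word_value \<pi> x H = H}"
    by (rule H_seq_subset) (simp add: gen_fixed)
  have follows: "Q.word_value \<pi> x H = x \<bullet> H" if x: "x \<in> T" for x
  proof -
    have red: "reduced x" using x T(2) by (auto simp: carrier_free_group)
    have letter: "[(True, y)] = basis_elem y" for y :: basis by (simp add: basis_elem_def)
    have "Q.word_value \<pi> x H = foldr (\<lambda>l c. [l] \<bullet> c) x H"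
    proof (rule perm_word_follows[OF \<pi>, of S0])
      show "\<pi> y c = [(True, y)] \<bullet> c" if "c \<in> S0" "[(True, y)] \<bullet> c \<in> S0" for y c
        using that \<pi>a_S0 \<pi>b_S0 unfolding letter by (cases y) (auto simp: \<pi>_def)
      show "[letter_inv l] \<bullet> ([l] \<bullet> c) = c" if "c \<in> S0" for l c
      proof -
        have "[letter_inv l] = inv\<^bsub>F2\<^esub> [l]"
          by (rule F.inv_equality[symmetric]) (simp_all add: letter_inv_mult)
        then show ?thesis using cosets_act(2)[of c "[l]"] that S0_cosets by auto
      qed
      show "foldr (\<lambda>l c. [l] \<bullet> c) v H \<in> S0" if "x = u @ v" for u v
        using that red reduced_appendD[of u v] x by (auto simp: foldr_coset S0_def)
    qed
    then show ?thesis using foldr_coset[OF red] by simp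
  qed
  have "Q.word_value \<pi> \<in> hom F2 (perm_group S)" by (rule \<alpha>.homh)
  moreover have "\<forall>h\<in>H. Q.word_value \<pi> h H = H"
    using fixes_H by (intro ballI) (drule subsetD, assumption, simp)
  ultimately show ?thesis
    using fin_S subsetD[OF S0_S H_S0] follows
    by (intro exI[of _ S] exI[of _ "Q.word_value \<pi>"] conjI ballI) (simp_all only: )
qed

lemma residually_finite_G_seq: "residually_finite (G_seq s)"
  unfolding G_seq_def
  by (rule residually_finite_double[OF residually_finite_free_group]) (rule separating_representation)

end

section \<open>Homomorphisms out of the groups of multiplying sequences\<close>

lemma range_basis: "range f = {f gen_a, f gen_b}"
proof -
  have "f x \<in> {f gen_a, f gen_b}" for x by (cases x) auto
  then show ?thesis by auto
qed

definition pair_value :: "'q \<Rightarrow> 'q \<Rightarrow> basis \<Rightarrow> 'q" where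
  "pair_value A B x = (case x of gen_a \<Rightarrow> A | gen_b \<Rightarrow> B)"

lemma pair_value_simps [simp]: "pair_value A B gen_a = A" "pair_value A B gen_b = B"
  by (simp_all add: pair_value_def)

lemma pair_value_closed: "A \<in> C \<Longrightarrow> B \<in> C \<Longrightarrow> range (pair_value A B) \<subseteq> C"
  by (simp add: range_basis)

text \<open>
  The relations of the group of \<open>s\<close>, for images \<open>A\<close>, \<open>B\<close> of the basis of
  the left copy and \<open>A'\<close>, \<open>B'\<close> of that of the right copy, are \<open>conj_pow Q A B n
  (s n) = conj_pow Q A' B' n (s n)\<close>.
\<close>

definition conj_pow :: "('q, 'z) monoid_scheme \<Rightarrow> 'q \<Rightarrow> 'q \<Rightarrow> nat \<Rightarrow> nat \<Rightarrow> 'q" where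
  "conj_pow Q A B n k = B [^]\<^bsub>Q\<^esub> n \<otimes>\<^bsub>Q\<^esub> A [^]\<^bsub>Q\<^esub> k \<otimes>\<^bsub>Q\<^esub> inv\<^bsub>Q\<^esub> (B [^]\<^bsub>Q\<^esub> n)"

lemma H_gen_conj_pow: "H_gen s n = conj_pow F2 gA gB n (s n)"
  by (simp add: H_gen_def conj_pow_def)

lemma (in group_hom) hom_conj_pow:
  "A \<in> carrier G \<Longrightarrow> B \<in> carrier G \<Longrightarrow> h (conj_pow G A B n k) = conj_pow H (h A) (h B) n k"
  by (simp add: conj_pow_def hom_nat_pow)

lemma (in group) conj_pow_closed [simp]: "A \<in> carrier G \<Longrightarrow> B \<in> carrier G \<Longrightarrow> conj_pow G A B n k \<in> carrier G"
  by (simp add: conj_pow_def)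

lemma (in group) conj_pow_eq_one:
  "A [^] k = \<one> \<Longrightarrow> B \<in> carrier G \<Longrightarrow> conj_pow G A B n k = \<one>"
  by (simp add: conj_pow_def)

lemma (in group) conj_pow_pow:
  assumes "A \<in> carrier G" "B \<in> carrier G"
  shows "conj_pow G A B n k = conj_pow G A B n (Suc 0) [^] k"
proof -
  interpret c: group_hom G G "\<lambda>x. B [^] n \<otimes> x \<otimes> inv (B [^] n)"
    using conj_hom[of "\<lambda>x. x" G "B [^] n"] assms
    by (simp add: group_hom_defs is_group) (simp add: hom_def)
  show ?thesis
    using c.hom_nat_pow[OF assms(1), of k] assms by (simp add: conj_pow_def)
qed

lemma hom_F2_eqI:
  assumes "group Q" "\<alpha> \<in> hom F2 Q" "\<beta> \<in> hom F2 Q" "\<alpha> gA = \<beta> gA" "\<alpha> gB = \<beta> gB" "w \<in> carrier F2"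
  shows "\<alpha> w = \<beta> w"
proof (rule hom_free_group_eqI[OF assms(1-3) _ assms(6)])
  show "\<alpha> (basis_elem x) = \<beta> (basis_elem x)" for x
    using assms(4,5) by (cases x) auto
qed

context multiplying_sequence
begin

lemma G_seq_D: "G_seq s = D"
  by (simp add: G_seq_def)

lemma D_hom_eqI:
  assumes Q: "group Q" and \<Phi>: "\<Phi> \<in> hom D Q" and \<Psi>: "\<Psi> \<in> hom D Q"
    and "\<Phi> (left gA) = \<Psi> (left gA)" "\<Phi> (left gB) = \<Psi> (left gB)"
    and "\<Phi> (right gA) = \<Psi> (right gA)" "\<Phi> (right gB) = \<Psi> (right gB)"
    and g: "g \<in> carrier D"
  shows "\<Phi> g = \<Psi> g"
proof (rule double_hom_eqI[OF Q \<Phi> \<Psi> g])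
  fix x assume x: "x \<in> carrier F2"
  show "\<Phi> (left x) = \<Psi> (left x)"
    using hom_F2_eqI[OF Q hom_compose[OF left.homh \<Phi>] hom_compose[OF left.homh \<Psi>] _ _ x] assms by simp
  show "\<Phi> (right x) = \<Psi> (right x)"
    using hom_F2_eqI[OF Q hom_compose[OF right.homh \<Phi>] hom_compose[OF right.homh \<Psi>] _ _ x] assms by simp
qed

lemma D_hom_relation:
  assumes "group Q" "\<Phi> \<in> hom D Q"
  shows "conj_pow Q (\<Phi> (left gA)) (\<Phi> (left gB)) n (s n) = conj_pow Q (\<Phi> (right gA)) (\<Phi> (right gB)) n (s n)"
proof -
  interpret \<Phi>: group_hom D Q \<Phi> using assms by (simp add: group_hom_defs D.is_group)
  have "\<Phi> (left (H_gen s n)) = \<Phi> (right (H_gen s n))" by (simp add: left_eq_right)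
  then show ?thesis
    by (simp add: H_gen_conj_pow left.hom_conj_pow right.hom_conj_pow \<Phi>.hom_conj_pow)
qed

lemma D_hom_exists:
  assumes Q: "group Q" and carr: "A \<in> carrier Q" "B \<in> carrier Q" "A' \<in> carrier Q" "B' \<in> carrier Q"
    and rel: "\<And>n. conj_pow Q A B n (s n) = conj_pow Q A' B' n (s n)"
  obtains \<Phi> where "\<Phi> \<in> hom D Q" "\<Phi> (left gA) = A" "\<Phi> (left gB) = B" "\<Phi> (right gA) = A'" "\<Phi> (right gB) = B'"
proof -
  interpret Q: group Q by fact
  note range = pair_value_closed[OF carr(1,2)] pair_value_closed[OF carr(3,4)]
  interpret \<alpha>: group_hom F2 Q "Q.word_value (pair_value A B)"
    by (simp add: group_hom_defs F.is_group Q Q.word_value_hom range)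
  interpret \<beta>: group_hom F2 Q "Q.word_value (pair_value A' B')"
    by (simp add: group_hom_defs F.is_group Q Q.word_value_hom range)
  let ?K = "{x \<in> carrier F2. Q.word_value (pair_value A B) x = Q.word_value (pair_value A' B') x}"
  have "subgroup ?K F2"
  proof (rule F.subgroupI)
    have "\<one>\<^bsub>F2\<^esub> \<in> ?K" using \<alpha>.hom_one \<beta>.hom_one by simp
    then show "?K \<noteq> {}" by blast
  qed (auto simp: \<alpha>.hom_mult \<beta>.hom_mult \<alpha>.hom_inv \<beta>.hom_inv)
  moreover have "H_gen s n \<in> ?K" for n
    using rel[of n] range by (simp add: H_gen_conj_pow \<alpha>.hom_conj_pow \<beta>.hom_conj_pow)
  ultimately have "H \<subseteq> ?K" by (rule H_seq_subset)
  then have agree: "Q.word_value (pair_value A B) h = Q.word_value (pair_value A' B') h" if "h \<in> H" for h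
    using that by blast
  obtain \<Phi> where \<Phi>: "\<Phi> \<in> hom D Q" "\<And>x. x \<in> carrier F2 \<Longrightarrow> \<Phi> (left x) = Q.word_value (pair_value A B) x"
    "\<And>x. x \<in> carrier F2 \<Longrightarrow> \<Phi> (right x) = Q.word_value (pair_value A' B') x"
    using double_universal[OF Q \<alpha>.homh \<beta>.homh agree] by blast
  show thesis
    by (rule that[OF \<Phi>(1)]) (simp_all add: \<Phi> range)
qed

lemma finitely_generated_G_seq: "finitely_generated_group (G_seq s)"
proof -
  let ?S = "left ` range basis_elem \<union> right ` range basis_elem"
  have sub: "?S \<subseteq> carrier D" by auto
  have left_S: "left x \<in> generate D ?S" if "x \<in> carrier F2" for x
  proof -
    have "left x \<in> left ` generate F2 (range basis_elem)" using that by (simp add: generate_free_group)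
    also have "\<dots> = generate D (left ` range basis_elem)" by (rule left.generate_img [symmetric]) auto
    also have "\<dots> \<subseteq> generate D ?S" by (rule D.mono_generate) blast
    finally show ?thesis .
  qed
  have right_S: "right x \<in> generate D ?S" if "x \<in> carrier F2" for x
  proof -
    have "right x \<in> right ` generate F2 (range basis_elem)" using that by (simp add: generate_free_group)
    also have "\<dots> = generate D (right ` range basis_elem)" by (rule right.generate_img [symmetric]) auto
    also have "\<dots> \<subseteq> generate D ?S" by (rule D.mono_generate) blast
    finally show ?thesis .
  qed
  have "g \<in> generate D ?S" if "g \<in> carrier D" for g
    using that
  proof (induction rule: double_induct)
    case one
    show ?case by (rule generate.one)
  next
    case (left x g)
    show ?case by (rule generate.eng[OF left_S[OF left(1)] left(3)])
  next
    case (right x g)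
    show ?case by (rule generate.eng[OF right_S[OF right(1)] right(3)])
  qed
  moreover have "generate D ?S \<subseteq> carrier D" by (rule D.generate_incl[OF sub])
  ultimately have "generate D ?S = carrier D" by blast
  moreover have "finite ?S" by (simp add: range_basis)
  ultimately show ?thesis
    unfolding finitely_generated_group_def G_seq_D using sub D.is_group by blast
qed

text \<open>
  Let \<open>A\<close>, \<open>B\<close> and \<open>A'\<close>, \<open>B'\<close> be the images of the bases of
  the two copies. Roots in a free group are unique, so \<open>A = A'\<close> by the first relation. By the next
  two relations \<open>A\<close> commutes with \<open>C = B\<inverse> B'\<close> and with its conjugate by
  \<open>B\<close>; unless \<open>A\<close> or \<open>C\<close> is trivial, this forces \<open>A\<close> to be
  central in the image.
\<close>

lemma surjection_to_F2:
  assumes \<rho>: "\<rho> \<in> hom D F2" and surj: "\<rho> ` carrier D = carrier F2"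
  shows "\<rho> (left gA) = \<rho> (right gA)"
    and "\<rho> (left gA) = \<one>\<^bsub>F2\<^esub> \<or> \<rho> (left gB) = \<rho> (right gB)"
proof -
  interpret \<rho>: group_hom D F2 \<rho>
    using \<rho> by (simp add: group_hom_defs D.is_group F.is_group)
  define A A' B B' where defs: "A = \<rho> (left gA)" "A' = \<rho> (right gA)" "B = \<rho> (left gB)" "B' = \<rho> (right gB)"
  have carr: "A \<in> carrier F2" "A' \<in> carrier F2" "B \<in> carrier F2" "B' \<in> carrier F2"
    by (simp_all add: defs)
  have rel: "conj_pow F2 A B n (s n) = conj_pow F2 A' B' n (s n)" for n
    using D_hom_relation[OF F.is_group \<rho>] by (simp add: defs)
  have "A [^]\<^bsub>F2\<^esub> s 0 = A' [^]\<^bsub>F2\<^esub> s 0"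
    using rel[of 0] carr by (simp add: conj_pow_def)
  then have AA': "A = A'" using F2_unique_roots carr pos by blast
  then show "\<rho> (left gA) = \<rho> (right gA)" by (simp add: defs)
  have "A = \<one>\<^bsub>F2\<^esub> \<or> B = B'"
  proof (rule ccontr)
    assume "\<not> (A = \<one>\<^bsub>F2\<^esub> \<or> B = B')"
    then have A1: "A \<noteq> \<one>\<^bsub>F2\<^esub>" and BB': "B \<noteq> B'" by auto
    define C where "C = inv\<^bsub>F2\<^esub> B \<cdot> B'"
    have C: "C \<in> carrier F2" and B': "B' = B \<cdot> C"
      using carr by (simp_all add: C_def F.m_assoc [symmetric])
    have comm: "A \<cdot> (inv\<^bsub>F2\<^esub> (B [^]\<^bsub>F2\<^esub> n) \<cdot> B' [^]\<^bsub>F2\<^esub> n) =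
        (inv\<^bsub>F2\<^esub> (B [^]\<^bsub>F2\<^esub> n) \<cdot> B' [^]\<^bsub>F2\<^esub> n) \<cdot> A" for n :: nat
    proof (rule F2_commute_pow[OF _ _ _ pos[of n]])
      let ?b = "B [^]\<^bsub>F2\<^esub> n" and ?b' = "B' [^]\<^bsub>F2\<^esub> n" and ?a = "A [^]\<^bsub>F2\<^esub> s n"
      have cl: "?b \<in> carrier F2" "?b' \<in> carrier F2" "?a \<in> carrier F2" using carr by auto
      have "?b \<cdot> ?a \<cdot> inv\<^bsub>F2\<^esub> ?b = ?b' \<cdot> ?a \<cdot> inv\<^bsub>F2\<^esub> ?b'"
        using rel[of n] by (simp add: conj_pow_def AA')
      then have "inv\<^bsub>F2\<^esub> ?b \<cdot> (?b \<cdot> ?a \<cdot> inv\<^bsub>F2\<^esub> ?b) \<cdot> ?b' =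
          inv\<^bsub>F2\<^esub> ?b \<cdot> (?b' \<cdot> ?a \<cdot> inv\<^bsub>F2\<^esub> ?b') \<cdot> ?b'" by simp
      moreover have "inv\<^bsub>F2\<^esub> ?b \<cdot> (?b \<cdot> ?a \<cdot> inv\<^bsub>F2\<^esub> ?b) \<cdot> ?b' =
          ?a \<cdot> (inv\<^bsub>F2\<^esub> ?b \<cdot> ?b')"
        using cl by (simp add: F.m_assoc [symmetric])
      moreover have "inv\<^bsub>F2\<^esub> ?b \<cdot> (?b' \<cdot> ?a \<cdot> inv\<^bsub>F2\<^esub> ?b') \<cdot> ?b' =
          inv\<^bsub>F2\<^esub> ?b \<cdot> ?b' \<cdot> ?a"
        using cl by (simp add: F.m_assoc)
      ultimately show "?a \<cdot> (inv\<^bsub>F2\<^esub> ?b \<cdot> ?b') = inv\<^bsub>F2\<^esub> ?b \<cdot> ?b' \<cdot> ?a" by simp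
    qed (use carr in auto)
    have AC: "A \<cdot> C = C \<cdot> A"
      using comm[of 1] carr by (simp add: C_def)
    let ?E = "inv\<^bsub>F2\<^esub> B \<cdot> C \<cdot> B"
    have E: "?E \<in> carrier F2" using carr C by simp
    have "inv\<^bsub>F2\<^esub> (B [^]\<^bsub>F2\<^esub> (2::nat)) \<cdot> B' [^]\<^bsub>F2\<^esub> (2::nat) = ?E \<cdot> C"
      using carr C unfolding B' by (simp add: numeral_2_eq_2 F.inv_mult_group F.m_assoc)
        (simp add: F.m_assoc [symmetric])
    then have AEC: "A \<cdot> (?E \<cdot> C) = ?E \<cdot> C \<cdot> A"
      using comm[of 2] by simp
    have CEC: "C \<cdot> (?E \<cdot> C) = ?E \<cdot> C \<cdot> C"
      by (rule F2_commute_trans[OF carr(1) C _ A1 AC AEC]) (use E C in simp)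
    then have "C \<cdot> ?E \<cdot> C = ?E \<cdot> C \<cdot> C"
      using E C F.m_assoc[of C ?E C] by metis
    then have CE: "C \<cdot> ?E = ?E \<cdot> C"
      using E C F.right_cancel[of C "C \<cdot> ?E" "?E \<cdot> C"] F.m_closed by blast
    have CB: "C \<cdot> B = B \<cdot> C"
      by (rule F2_commute_conj[OF C carr(3) CE])
    have C1: "C \<noteq> \<one>\<^bsub>F2\<^esub>" using BB' B' carr by auto
    have AB: "A \<cdot> B = B \<cdot> A"
      by (rule F2_commute_trans[OF C carr(1,3) C1 AC[symmetric] CB])
    have AB': "A \<cdot> B' = B' \<cdot> A"
      using carr C AB AC unfolding B' by (metis F.m_assoc)
    \<comment> \<open>conjugation by \<open>A\<close> is trivial on the generators, hence on the image\<close>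
    have central: "A \<cdot> \<rho> g \<cdot> inv\<^bsub>F2\<^esub> A = \<rho> g" if "g \<in> carrier D" for g
    proof (rule D_hom_eqI[OF F.is_group F.conj_hom[OF \<rho> carr(1)] \<rho> _ _ _ _ that])
      have *: "A \<cdot> X \<cdot> inv\<^bsub>F2\<^esub> A = X" if "A \<cdot> X = X \<cdot> A" "X \<in> carrier F2" for X
        using that carr(1) by (simp add: F.m_assoc)
      show "A \<cdot> \<rho> (left gA) \<cdot> inv\<^bsub>F2\<^esub> A = \<rho> (left gA)"
        "A \<cdot> \<rho> (left gB) \<cdot> inv\<^bsub>F2\<^esub> A = \<rho> (left gB)"
        "A \<cdot> \<rho> (right gA) \<cdot> inv\<^bsub>F2\<^esub> A = \<rho> (right gA)"
        "A \<cdot> \<rho> (right gB) \<cdot> inv\<^bsub>F2\<^esub> A = \<rho> (right gB)"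
        unfolding defs [symmetric] using * AB AB' AA' carr by auto
    qed
    have comm_all: "A \<cdot> x = x \<cdot> A" if "x \<in> carrier F2" for x
    proof -
      obtain g where "g \<in> carrier D" "x = \<rho> g" using \<open>x \<in> carrier F2\<close> surj by blast
      then have "A \<cdot> x \<cdot> inv\<^bsub>F2\<^esub> A = x" using central by simp
      then show ?thesis
        using that carr(1) F.inv_solve_right[of x "A \<cdot> x" A] by simp
    qed
    have "gA \<cdot> gB = gB \<cdot> gA"
      by (rule F2_commute_trans[OF carr(1) _ _ A1 comm_all comm_all]) auto
    with F2_noncommutative show False by blast
  qed
  then show "\<rho> (left gA) = \<one>\<^bsub>F2\<^esub> \<or> \<rho> (left gB) = \<rho> (right gB)" by (simp add: defs)
qed

text \<open>
  The homomorphism onto the free group on the two stable letters, that is, on the images of \<open>b\<close>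
  from the two copies; the elements \<open>a\<close> and \<open>b\<close> of the target stand for these.
\<close>

definition stable :: "(basis letter list + basis letter list) list set \<Rightarrow> basis letter list" where
  "stable = (SOME \<sigma>. \<sigma> \<in> hom D F2 \<and> \<sigma> (left gA) = \<one>\<^bsub>F2\<^esub> \<and> \<sigma> (left gB) = gA \<and>
    \<sigma> (right gA) = \<one>\<^bsub>F2\<^esub> \<and> \<sigma> (right gB) = gB)"

lemma stable: "stable \<in> hom D F2" "stable (left gA) = \<one>\<^bsub>F2\<^esub>" "stable (left gB) = gA"
  "stable (right gA) = \<one>\<^bsub>F2\<^esub>" "stable (right gB) = gB"
proof -
  have "conj_pow F2 \<one>\<^bsub>F2\<^esub> gA n (s n) = conj_pow F2 \<one>\<^bsub>F2\<^esub> gB n (s n)" for n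
    by (simp add: F.conj_pow_eq_one)
  then have "\<exists>\<sigma>. \<sigma> \<in> hom D F2 \<and> \<sigma> (left gA) = \<one>\<^bsub>F2\<^esub> \<and> \<sigma> (left gB) = gA \<and>
      \<sigma> (right gA) = \<one>\<^bsub>F2\<^esub> \<and> \<sigma> (right gB) = gB"
    by (metis D_hom_exists F.is_group F.one_closed basis_elem_closed)
  from someI_ex[OF this] show "stable \<in> hom D F2" "stable (left gA) = \<one>\<^bsub>F2\<^esub>" "stable (left gB) = gA"
    "stable (right gA) = \<one>\<^bsub>F2\<^esub>" "stable (right gB) = gB"
    unfolding stable_def by blast+
qed

sublocale stable: group_hom D F2 stable
  by (simp add: group_hom_defs D.is_group F.is_group stable(1))

definition section_stable :: "basis letter list \<Rightarrow> (basis letter list + basis letter list) list set" where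
  "section_stable = D.word_value (pair_value (left gB) (right gB))"

sublocale section_stable: group_hom F2 D section_stable
  by (simp add: group_hom_defs D.is_group F.is_group section_stable_def
      D.word_value_hom pair_value_closed)

lemma section_stable: "section_stable gA = left gB" "section_stable gB = right gB"
  by (simp_all add: section_stable_def pair_value_closed)

lemma stable_surj: "stable ` carrier D = carrier F2"
proof -
  have "stable (section_stable x) = x" if "x \<in> carrier F2" for x
    using hom_F2_eqI[OF F.is_group hom_compose[OF section_stable.homh stable(1)] _ _ _ that, of "\<lambda>x. x"]
    by (simp add: section_stable stable) (simp add: hom_def)
  then have "carrier F2 \<subseteq> stable ` carrier D"
    by (metis image_eqI section_stable.hom_closed subsetI)
  then show ?thesis by auto
qed

text \<open>
  Modulo \<open>V\<close>, the homomorphism \<open>\<psi>\<close> agrees on the generators with the one that is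
  obtained by passing through \<open>stable\<close> and its section. So the kernel is the normal closure of the
  two images of \<open>a\<close>.
\<close>

lemma stable_kernel:
  assumes Q: "group Q" and \<psi>: "\<psi> \<in> hom D Q" and V: "V \<lhd> Q"
    and A: "\<psi> (left gA) \<in> V" "\<psi> (right gA) \<in> V" and g: "g \<in> carrier D" "stable g = \<one>\<^bsub>F2\<^esub>"
  shows "\<psi> g \<in> V"
proof -
  interpret Q: group Q by fact
  interpret V: normal V Q by fact
  interpret \<psi>: group_hom D Q \<psi> using \<psi> by (simp add: group_hom_defs D.is_group Q)
  let ?c = "\<lambda>x. V #>\<^bsub>Q\<^esub> x"
  have V_one: "?c x = V" if "x \<in> V" for x
    using that Q.coset_join2[of x V] V.is_subgroup V.subset by auto
  have c: "?c \<in> hom Q (Q Mod V)" by (rule V.r_coset_hom_Mod)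
  have "(?c \<circ> \<psi>) g = (?c \<circ> (\<psi> \<circ> (section_stable \<circ> stable))) g"
  proof (rule D_hom_eqI[OF V.factorgroup_is_group _ _ _ _ _ _ g(1)])
    show "?c \<circ> \<psi> \<in> hom D (Q Mod V)" using \<psi> c by (rule hom_compose)
    have "section_stable \<circ> stable \<in> hom D D" using stable(1) section_stable.homh by (rule hom_compose)
    then have "\<psi> \<circ> (section_stable \<circ> stable) \<in> hom D Q" using \<psi> by (rule hom_compose)
    then show "?c \<circ> (\<psi> \<circ> (section_stable \<circ> stable)) \<in> hom D (Q Mod V)" using c by (rule hom_compose)
  qed (use A in \<open>simp_all add: stable section_stable V_one V.one_closed\<close>)
  then have "?c (\<psi> g) = V" using g(2) by (simp add: V_one V.one_closed)
  then show ?thesis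
    using Q.rcos_self[of "\<psi> g" V] V.is_subgroup g(1) by auto
qed

end

section \<open>Counting homomorphisms into finite wreath products\<close>

text \<open>
  The homomorphisms from the group of \<open>s\<close> to \<open>Q\<close> that send both images of
  \<open>a\<close> into \<open>V\<close>, given by the images of the generators.
\<close>

definition solutions :: "(nat \<Rightarrow> nat) \<Rightarrow> ('q, 'z) monoid_scheme \<Rightarrow> 'q set \<Rightarrow> ('q \<times> 'q \<times> 'q \<times> 'q) set" where
  "solutions s Q V = {(A, B, A', B'). A \<in> V \<and> B \<in> carrier Q \<and> A' \<in> V \<and> B' \<in> carrier Q \<and>
    (\<forall>n. conj_pow Q A B n (s n) = conj_pow Q A' B' n (s n))}"

definition test_group :: "nat \<Rightarrow> nat \<Rightarrow> (((nat \<Rightarrow> nat) \<Rightarrow> int) \<times> (nat \<Rightarrow> nat)) monoid" where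
  "test_group k n = wreath (integer_mod_group k) (perm_group {..Suc n})"

definition test_base :: "nat \<Rightarrow> nat \<Rightarrow> (((nat \<Rightarrow> nat) \<Rightarrow> int) \<times> (nat \<Rightarrow> nat)) set" where
  "test_base k n = wreath_base (integer_mod_group k) (perm_group {..Suc n})"

locale test_wreath = wreath_product "integer_mod_group k" "perm_group {..Suc n}" for k n
begin

lemma base_exponent:
  assumes "A \<in> test_base k n" "k dvd e"
  shows "A [^]\<^bsub>test_group k n\<^esub> e = \<one>\<^bsub>test_group k n\<^esub>"
proof -
  let ?W = "wreath (integer_mod_group k) (perm_group {..Suc n})"
  have "A [^]\<^bsub>test_group k n\<^esub> k = \<one>\<^bsub>test_group k n\<^esub>"
    unfolding test_group_def
  proof (rule base_ext)
    show "A [^]\<^bsub>?W\<^esub> k \<in> wreath_base (integer_mod_group k) (perm_group {..Suc n})"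
      using base_eval_pow[of A id k] assms(1) by (simp add: test_base_def permutes_id)
    show "\<one>\<^bsub>?W\<^esub> \<in> wreath_base (integer_mod_group k) (perm_group {..Suc n})"
      by (rule subgroup.one_closed[OF base_subgroup])
    fix x assume x: "x \<in> carrier (perm_group {..Suc n})"
    then have "fst (A [^]\<^bsub>?W\<^esub> k) x = fst A x [^]\<^bsub>integer_mod_group k\<^esub> k"
      using base_eval_pow[of A x k] assms(1) by (simp add: test_base_def)
    then show "fst (A [^]\<^bsub>?W\<^esub> k) x =
        fst \<one>\<^bsub>?W\<^esub> x"
      using x by (simp add: base_eval_one)
  qed
  moreover obtain r where "e = k * r" using assms(2) by blast
  moreover have "A \<in> carrier (test_group k n)"
    using assms(1) base_subset by (auto simp: test_base_def test_group_def)
  ultimately show ?thesis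
    using W.nat_pow_pow[of A k r] W.nat_pow_one by (simp add: test_group_def)
qed

text \<open>
  The element \<open>A\<close> of the base is supported at the point 0, and \<open>B\<close> is the cycle
  \<open>(0 1 \<dots> n + 1)\<close>, so that \<open>B ^ m A B ^ (- m)\<close> is supported at \<open>m\<close>.
  The pair \<open>A'\<close>, \<open>B'\<close> arises from it by conjugation with the transposition of
  \<open>n\<close> and \<open>n + 1\<close>, which is noticed at \<open>m = n\<close> for the first time. As the
  wreath product is the regular one, "supported at \<open>i\<close>" means that the value at a permutation
  \<open>\<rho>\<close> vanishes unless \<open>\<rho>\<close> maps 0 to \<open>i\<close>.
\<close>

lemma test_solution:
  obtains A B A' B' where "A \<in> test_base k n" "B \<in> carrier (test_group k n)"
    "A' \<in> test_base k n" "B' \<in> carrier (test_group k n)"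
    "\<And>m e. m < n \<Longrightarrow> conj_pow (test_group k n) A B m e = conj_pow (test_group k n) A' B' m e"
    "\<And>e. \<not> k dvd e \<Longrightarrow> conj_pow (test_group k n) A B n e \<noteq> conj_pow (test_group k n) A' B' n e"
proof -
  let ?Z = "integer_mod_group k" and ?R = "perm_group {..Suc n}"
  let ?W = "wreath ?Z ?R"
  interpret top: group_hom ?R ?W "wreath_top ?Z ?R"
    by (simp add: group_hom_defs R.is_group W.is_group wreath_top_hom)
  define p where "p \<sigma> = (if \<sigma> 0 = 0 then 1 mod int k else 0)" for \<sigma> :: "nat \<Rightarrow> nat"
  define \<beta> where "\<beta> i = (if i \<le> n then Suc i else if i = Suc n then 0 else i)" for i
  define \<tau> where "\<tau> = Transposition.transpose n (Suc n)"
  define e where "e \<sigma> = wreath_translate ?Z ?R p \<sigma>" for \<sigma>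
  have p: "p \<in> carrier ?R \<rightarrow> carrier ?Z"
    by (auto simp: p_def carrier_integer_mod_group)
  have "bij_betw \<beta> {..Suc n} {..Suc n}"
  proof (rule bij_betwI')
    show "\<beta> x = \<beta> y \<longleftrightarrow> x = y" if "x \<in> {..Suc n}" "y \<in> {..Suc n}" for x y
      using that by (auto simp: \<beta>_def)
    show "\<beta> x \<in> {..Suc n}" if "x \<in> {..Suc n}" for x using that by (auto simp: \<beta>_def)
    show "\<exists>x\<in>{..Suc n}. y = \<beta> x" if "y \<in> {..Suc n}" for y
      using that by (cases y) (auto simp: \<beta>_def intro: bexI[of _ "Suc n"] bexI[of _ "y - 1"])
  qed
  then have \<beta>: "\<beta> permutes {..Suc n}" by (rule bij_imp_permutes) (auto simp: \<beta>_def)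
  have \<tau>: "\<tau> permutes {..Suc n}" unfolding \<tau>_def by (rule permutes_swap_id) auto
  have pow: "q [^]\<^bsub>?R\<^esub> m = q ^^ m" for q and m :: nat
    by (induction m) (auto simp: funpow_swap1 fun_eq_iff)
  have \<beta>_pow: "(\<beta> ^^ m) permutes {..Suc n}" for m
    using R.nat_pow_closed[of \<beta> m] \<beta> by (simp add: pow)
  have \<beta>_zero: "(\<beta> ^^ m) 0 = m" if "m \<le> n" for m
    using that by (induction m) (auto simp: \<beta>_def)
  have e_base: "e \<sigma> \<in> wreath_base ?Z ?R" if "\<sigma> permutes {..Suc n}" for \<sigma>
    unfolding e_def using that by (intro translate_base[OF p]) simp
  then have e: "e \<sigma> \<in> carrier ?W" if "\<sigma> permutes {..Suc n}" for \<sigma>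
    using that base_subset by blast
  have e_cong: "e \<sigma> = e \<sigma>'" if "\<sigma> permutes {..Suc n}" "\<sigma>' permutes {..Suc n}" "\<sigma> 0 = \<sigma>' 0" for \<sigma> \<sigma>'
    unfolding e_def wreath_translate_def using that(3)
    by (auto simp: inv_perm_group p_def intro!: restrict_ext)
  have e_conj: "wreath_top ?Z ?R \<rho> \<otimes>\<^bsub>?W\<^esub> e \<sigma> \<otimes>\<^bsub>?W\<^esub> inv\<^bsub>?W\<^esub> (wreath_top ?Z ?R \<rho>) = e (\<rho> \<circ> \<sigma>)"
    if "\<rho> permutes {..Suc n}" "\<sigma> permutes {..Suc n}" for \<rho> \<sigma>
  proof -
    have "wreath_top ?Z ?R \<rho> \<in> carrier ?W" using that by (intro top.hom_closed) simp
    moreover have "e (\<rho> \<circ> \<sigma>) \<in> carrier ?W" using that by (intro e permutes_compose)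
    ultimately show ?thesis
      using translate_conj[OF p, of \<rho> \<sigma>] that by (simp add: e_def W.m_assoc)
  qed
  define A where "A = e id"
  define B where "B = wreath_top ?Z ?R \<beta>"
  define t where "t = wreath_top ?Z ?R \<tau>"
  define A' where "A' = e \<tau>"
  define B' where "B' = t \<otimes>\<^bsub>?W\<^esub> B \<otimes>\<^bsub>?W\<^esub> inv\<^bsub>?W\<^esub> t"
  have t: "t \<in> carrier ?W" unfolding t_def using \<tau> by (intro top.hom_closed) simp
  have B: "B \<in> carrier ?W" unfolding B_def using \<beta> by (intro top.hom_closed) simp
  have A: "A \<in> carrier ?W" unfolding A_def by (intro e permutes_id)
  have A'_eq: "A' = t \<otimes>\<^bsub>?W\<^esub> A \<otimes>\<^bsub>?W\<^esub> inv\<^bsub>?W\<^esub> t"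
    using e_conj[OF \<tau> permutes_id] by (simp add: A_def A'_def t_def)
  have conj1: "conj_pow ?W A B m (Suc 0) = e (\<beta> ^^ m)" for m
  proof -
    have "B [^]\<^bsub>?W\<^esub> m = wreath_top ?Z ?R (\<beta> ^^ m)"
      using top.hom_nat_pow[of \<beta> m] \<beta> by (simp add: B_def pow)
    then show ?thesis
      using e_conj[OF \<beta>_pow permutes_id, of m] A by (simp add: conj_pow_def A_def)
  qed
  interpret c: group_hom ?W ?W "\<lambda>x. t \<otimes>\<^bsub>?W\<^esub> x \<otimes>\<^bsub>?W\<^esub> inv\<^bsub>?W\<^esub> t"
    using W.conj_hom[of "\<lambda>x. x" ?W t] t
    by (simp add: group_hom_defs W.is_group) (simp add: hom_def)
  have conj2: "conj_pow ?W A' B' m (Suc 0) = e (\<tau> \<circ> (\<beta> ^^ m))" for m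
  proof -
    have "conj_pow ?W A' B' m (Suc 0) =
        t \<otimes>\<^bsub>?W\<^esub> conj_pow ?W A B m (Suc 0) \<otimes>\<^bsub>?W\<^esub> inv\<^bsub>?W\<^esub> t"
      unfolding A'_eq B'_def by (rule c.hom_conj_pow[OF A B, symmetric])
    also have "\<dots> = e (\<tau> \<circ> (\<beta> ^^ m))"
      unfolding conj1 t_def by (rule e_conj[OF \<tau> \<beta>_pow])
    finally show ?thesis .
  qed
  have B': "B' \<in> carrier ?W" using c.hom_closed[OF B] by (simp add: B'_def)
  have A': "A' \<in> carrier ?W" using c.hom_closed[OF A] by (simp add: A'_eq)
  show thesis
  proof (rule that[of A B A' B'])
    show "A \<in> test_base k n" "A' \<in> test_base k n"
      unfolding A_def A'_def test_base_def using \<tau> by (auto intro: e_base permutes_id)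
    show "B \<in> carrier (test_group k n)" "B' \<in> carrier (test_group k n)"
      using B B' by (simp_all add: test_group_def)
    fix m r :: nat assume m: "m < n"
    have "e (\<beta> ^^ m) = e (\<tau> \<circ> (\<beta> ^^ m))"
      using m \<beta>_zero[of m] by (intro e_cong \<beta>_pow permutes_compose \<tau>) (simp add: \<tau>_def)
    then show "conj_pow (test_group k n) A B m r = conj_pow (test_group k n) A' B' m r"
      using A A' B B' W.conj_pow_pow[of A B m r] W.conj_pow_pow[of A' B' m r]
      by (simp add: test_group_def conj1 conj2)
  next
    fix r assume r: "\<not> k dvd r"
    \<comment> \<open>evaluation at \<open>\<beta> ^^ n\<close> distinguishes the two sides\<close>
    let ?x = "\<beta> ^^ n"
    have x: "?x \<in> carrier ?R" using \<beta>_pow by simp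
    have val: "fst (e \<sigma>) ?x = (if \<sigma> 0 = n then 1 mod int k else 0)" if "\<sigma> permutes {..Suc n}" for \<sigma>
    proof -
      have "inv_into UNIV ?x (\<sigma> 0) = 0 \<longleftrightarrow> \<sigma> 0 = n"
        using permutes_inv_eq[OF \<beta>_pow, of n "\<sigma> 0" 0] \<beta>_zero[of n] by auto
      then show ?thesis
        using \<beta>_pow[of n] by (simp add: e_def wreath_translate_def inv_perm_group p_def)
    qed
    have "fst (conj_pow ?W A B n r) ?x = int r mod int k"
    proof -
      have "fst (e ?x [^]\<^bsub>?W\<^esub> r) ?x = (int r * (1 mod int k)) mod int k"
        using base_eval_pow[OF e_base[OF \<beta>_pow[of n]] x, of r] val[OF \<beta>_pow[of n]] \<beta>_zero[of n] by simp
      then show ?thesis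
        using W.conj_pow_pow[OF A B, of n r] by (simp add: conj1 mod_mult_right_eq)
    qed
    moreover have "fst (conj_pow ?W A' B' n r) ?x = 0"
    proof -
      have perm: "\<tau> \<circ> ?x permutes {..Suc n}" by (intro permutes_compose \<beta>_pow \<tau>)
      have "(\<tau> \<circ> ?x) 0 = Suc n" using \<beta>_zero[of n] by (simp add: \<tau>_def)
      then have "fst (e (\<tau> \<circ> ?x) [^]\<^bsub>?W\<^esub> r) ?x = 0"
        using base_eval_pow[OF e_base[OF perm] x, of r] val[OF perm] by simp
      then show ?thesis
        using W.conj_pow_pow[OF A' B', of n r] by (simp add: conj2)
    qed
    moreover have "int r mod int k \<noteq> 0"
      using r by (metis dvd_eq_mod_eq_0 int_dvd_int_iff)
    ultimately show "conj_pow (test_group k n) A B n r \<noteq> conj_pow (test_group k n) A' B' n r"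
      unfolding test_group_def by metis
  qed
qed

lemma test_group_facts:
  shows "group (test_group k n)" "test_base k n \<lhd> test_group k n" "test_base k n \<subseteq> carrier (test_group k n)"
  using W.is_group base_normal base_subset by (simp_all add: test_group_def test_base_def)

lemma finite_test_group: "k > 0 \<Longrightarrow> finite (carrier (test_group k n))"
  unfolding test_group_def
  by (intro finite_wreath finite_perm_group) (auto simp: carrier_integer_mod_group)

end

lemma test_wreath: "test_wreath k n"
  by (simp add: test_wreath_def wreath_product_def group_perm_group)

text \<open>
  The relations with \<open>m \<ge> n\<close> are void, as \<open>k\<close> annihilates the base.
\<close>

lemma solution_divisible:
  assumes "\<And>m. m \<ge> n \<Longrightarrow> k dvd t m"
    and sol: "A \<in> test_base k n" "B \<in> carrier (test_group k n)" "A' \<in> test_base k n" "B' \<in> carrier (test_group k n)"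
    and "\<And>m. m < n \<Longrightarrow> conj_pow (test_group k n) A B m (t m) = conj_pow (test_group k n) A' B' m (t m)"
  shows "(A, B, A', B') \<in> solutions t (test_group k n) (test_base k n)"
proof -
  let ?Q = "test_group k n" and ?V = "test_base k n"
  interpret test_wreath k n by (rule test_wreath)
  interpret Q: group ?Q by (rule test_group_facts)
  have "conj_pow ?Q A B m (t m) = conj_pow ?Q A' B' m (t m)" for m
  proof (cases "m < n")
    case False
    then have "k dvd t m" using assms(1) by simp
    then show ?thesis
      using sol base_exponent by (simp add: Q.conj_pow_eq_one)
  qed (use assms in simp)
  then show ?thesis using sol by (simp add: solutions_def)
qed

lemma solutions_psubset:
  assumes "\<And>m. m < n \<Longrightarrow> s m = t m" "\<And>m. m \<ge> n \<Longrightarrow> k dvd t m" "\<not> k dvd s n"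
  shows "solutions s (test_group k n) (test_base k n) \<subset> solutions t (test_group k n) (test_base k n)"
proof -
  let ?Q = "test_group k n" and ?V = "test_base k n"
  interpret test_wreath k n by (rule test_wreath)
  have "solutions s ?Q ?V \<subseteq> solutions t ?Q ?V"
  proof safe
    fix A B A' B' assume "(A, B, A', B') \<in> solutions s ?Q ?V"
    then show "(A, B, A', B') \<in> solutions t ?Q ?V"
      by (intro solution_divisible assms(2)) (auto simp: solutions_def assms(1) [symmetric])
  qed
  moreover obtain A B A' B' where sol: "A \<in> ?V" "B \<in> carrier ?Q"
    "A' \<in> ?V" "B' \<in> carrier ?Q"
    "\<And>m e. m < n \<Longrightarrow> conj_pow ?Q A B m e = conj_pow ?Q A' B' m e"
    "\<And>e. \<not> k dvd e \<Longrightarrow> conj_pow ?Q A B n e \<noteq> conj_pow ?Q A' B' n e"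
    by (rule test_solution) (rule that)
  moreover have "(A, B, A', B') \<in> solutions t ?Q ?V"
    by (rule solution_divisible) (use assms sol in auto)
  moreover have "(A, B, A', B') \<notin> solutions s ?Q ?V"
    using sol(6)[OF assms(3)] by (auto simp: solutions_def)
  ultimately show ?thesis by blast
qed

text \<open>
  Homomorphisms are pulled back along \<open>\<phi>\<close>, which is injective as \<open>\<phi>\<close> is
  surjective. The assumption on \<open>\<phi>\<close> ensures that the images of \<open>a\<close> still go to
  \<open>V\<close>, because the kernel of the map to the stable letters does.
\<close>

lemma card_solutions_le:
  fixes Q :: "('q, 'z) monoid_scheme"
  assumes s: "multiplying_sequence s" and t: "multiplying_sequence t"
    and \<phi>: "\<phi> \<in> iso (G_seq s) (G_seq t)"
    and ker: "multiplying_sequence.stable t (\<phi> (group_double.left F2 (H_seq s) gA)) = \<one>\<^bsub>F2\<^esub>"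
      "multiplying_sequence.stable t (\<phi> (group_double.right F2 (H_seq s) gA)) = \<one>\<^bsub>F2\<^esub>"
    and Q: "group Q" "finite (carrier Q)" "V \<lhd> Q"
  shows "card (solutions t Q V) \<le> card (solutions s Q V)"
proof -
  interpret S: multiplying_sequence s by (rule s)
  interpret T: multiplying_sequence t by (rule t)
  interpret Q: group Q by (rule Q(1))
  interpret V: normal V Q by (rule Q(3))
  have \<phi>_hom: "\<phi> \<in> hom S.D T.D" and \<phi>_surj: "\<phi> ` carrier S.D = carrier T.D"
    using \<phi> by (auto simp: iso_def bij_betw_def S.G_seq_D T.G_seq_D)
  have V: "V \<subseteq> carrier Q" by (rule V.subset)
  define val where "val \<psi> = (\<psi> (S.left gA), \<psi> (S.left gB), \<psi> (S.right gA), \<psi> (S.right gB))"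
    for \<psi> :: "_ \<Rightarrow> 'q"
  define val' where "val' \<psi> = (\<psi> (T.left gA), \<psi> (T.left gB), \<psi> (T.right gA), \<psi> (T.right gB))"
    for \<psi> :: "_ \<Rightarrow> 'q"
  have "\<exists>\<psi>. \<psi> \<in> hom T.D Q \<and> val' \<psi> = x" if "x \<in> solutions t Q V" for x
  proof -
    obtain A B A' B' where x: "x = (A, B, A', B')" by (cases x)
    have carr: "A \<in> carrier Q" "B \<in> carrier Q" "A' \<in> carrier Q" "B' \<in> carrier Q"
      and rel: "conj_pow Q A B n (t n) = conj_pow Q A' B' n (t n)" for n
      using \<open>x \<in> solutions t Q V\<close> V by (auto simp: x solutions_def)
    obtain \<psi> where "\<psi> \<in> hom T.D Q" "\<psi> (T.left gA) = A" "\<psi> (T.left gB) = B"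
      "\<psi> (T.right gA) = A'" "\<psi> (T.right gB) = B'"
      by (rule T.D_hom_exists[OF Q(1) carr rel]) (rule that)
    then show ?thesis by (auto simp: val'_def x)
  qed
  then obtain \<Psi> where \<Psi>: "\<And>x. x \<in> solutions t Q V \<Longrightarrow> \<Psi> x \<in> hom T.D Q \<and> val' (\<Psi> x) = x"
    by metis
  have comp: "\<Psi> x \<circ> \<phi> \<in> hom S.D Q" if "x \<in> solutions t Q V" for x
    using \<phi>_hom \<Psi>[OF that] hom_compose by blast
  have "inj_on (\<lambda>x. val (\<Psi> x \<circ> \<phi>)) (solutions t Q V)"
  proof (rule inj_onI)
    fix x y assume x: "x \<in> solutions t Q V" and y: "y \<in> solutions t Q V"
      and eq: "val (\<Psi> x \<circ> \<phi>) = val (\<Psi> y \<circ> \<phi>)"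
    have agree: "(\<Psi> x \<circ> \<phi>) g = (\<Psi> y \<circ> \<phi>) g" if "g \<in> carrier S.D" for g
      by (rule S.D_hom_eqI[OF Q(1) comp[OF x] comp[OF y] _ _ _ _ that])
        (use eq in \<open>simp_all add: val_def\<close>)
    have "\<Psi> x g = \<Psi> y g" if g: "g \<in> carrier T.D" for g
    proof -
      obtain g' where "g' \<in> carrier S.D" "g = \<phi> g'" using g \<phi>_surj by blast
      then show ?thesis using agree by simp
    qed
    then have "val' (\<Psi> x) = val' (\<Psi> y)" by (simp add: val'_def)
    then show "x = y" using \<Psi>[OF x] \<Psi>[OF y] by simp
  qed
  moreover have "(\<lambda>x. val (\<Psi> x \<circ> \<phi>)) ` solutions t Q V \<subseteq> solutions s Q V"
  proof (rule image_subsetI)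
    fix x assume x: "x \<in> solutions t Q V"
    have hom: "\<Psi> x \<in> hom T.D Q" and vals: "val' (\<Psi> x) = x" using \<Psi>[OF x] by auto
    interpret c: group_hom S.D Q "\<Psi> x \<circ> \<phi>"
      using comp[OF x] by (simp add: group_hom_defs S.D.is_group Q(1))
    have "\<Psi> x (T.left gA) \<in> V" "\<Psi> x (T.right gA) \<in> V"
      using x vals [symmetric] by (auto simp: val'_def solutions_def)
    note kernel = T.stable_kernel[OF Q(1) hom Q(3) this]
    have "\<phi> (S.left gA) \<in> carrier T.D" "\<phi> (S.right gA) \<in> carrier T.D"
      using \<phi>_surj by auto
    then have "(\<Psi> x \<circ> \<phi>) (S.left gA) \<in> V" "(\<Psi> x \<circ> \<phi>) (S.right gA) \<in> V"
      using kernel ker by auto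
    moreover have "(\<Psi> x \<circ> \<phi>) (S.left gB) \<in> carrier Q" "(\<Psi> x \<circ> \<phi>) (S.right gB) \<in> carrier Q"
      using c.hom_closed by auto
    ultimately show "val (\<Psi> x \<circ> \<phi>) \<in> solutions s Q V"
      using S.D_hom_relation[OF Q(1) comp[OF x]] by (simp add: val_def solutions_def)
  qed
  moreover have "finite (solutions s Q V)"
  proof (rule finite_subset)
    show "solutions s Q V \<subseteq> carrier Q \<times> carrier Q \<times> carrier Q \<times> carrier Q"
      using V by (auto simp: solutions_def)
  qed (use Q(2) in simp)
  ultimately show ?thesis by (rule card_inj_on_le)
qed

section \<open>Distinguishing the groups\<close>

text \<open>
  The abelianization of the kernel of the folding map has no torsion, in the following form: a homomorphism from
  that kernel into the functions from \<open>R\<close> to the integers modulo \<open>k\<close> lifts, at each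
  coordinate \<open>r\<close>, to a homomorphism \<open>\<chi>\<close> into the integers, because its values on
  the differences can be lifted independently. So it does not separate elements with the same \<open>m\<close>th
  power.
\<close>

lemma (in multiplying_sequence) kernel_fold_unique_roots:
  fixes R :: "('r, 'z) monoid_scheme" and m :: nat
  assumes R: "group R" and \<psi>: "\<psi> \<in> hom D (wreath (integer_mod_group k) R)"
    and base: "\<And>g. g \<in> carrier D \<Longrightarrow> fold g = \<one>\<^bsub>F2\<^esub> \<Longrightarrow> \<psi> g \<in> wreath_base (integer_mod_group k) R"
    and u: "u \<in> carrier D" "fold u = \<one>\<^bsub>F2\<^esub>" and v: "v \<in> carrier D" "fold v = \<one>\<^bsub>F2\<^esub>"
    and pow: "u [^]\<^bsub>D\<^esub> m = v [^]\<^bsub>D\<^esub> m" "m > 0" and k: "k > 0"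
  shows "\<psi> u = \<psi> v"
proof -
  interpret V: wreath_product "integer_mod_group k" R
    using R by (simp add: wreath_product_def)
  interpret \<psi>: group_hom D "wreath (integer_mod_group k) R" \<psi>
    using \<psi> by (simp add: group_hom_defs D.is_group V.W.is_group)
  interpret ZF: wreath_product integer_group F2
    by (simp add: wreath_product_def F.is_group)
  have diff_ker: "fold (diff x) = \<one>\<^bsub>F2\<^esub>" for x
    by (simp add: diff_def fold)
  have word_ker: "fold (D.word_value diff w) = \<one>\<^bsub>F2\<^esub>" for w
    by (induction w) (auto simp: D.letter_value_def diff_ker)
  show ?thesis
  proof (rule V.base_ext[OF base[OF u] base[OF v]])
    fix r assume r: "r \<in> carrier R"
    define p where "p x = fst (\<psi> (diff x)) r" for x
    have p_inv: "p (x \<cdot> h) = p x" if "x \<in> carrier F2" "h \<in> H" for x h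
      using that by (simp add: p_def diff_coset)
    have "p \<one>\<^bsub>F2\<^esub> = 0"
      using diff_H[of "\<one>\<^bsub>F2\<^esub>"] H.one_closed r by (simp add: p_def V.base_eval_one)
    then have p_one: "p \<one>\<^bsub>F2\<^esub> = \<one>\<^bsub>integer_group\<^esub>" by simp
    have p_closed: "p \<in> carrier F2 \<rightarrow> carrier integer_group" by simp
    have id_hom: "(\<lambda>x. x) \<in> hom F2 F2" by (simp add: hom_def)
    obtain \<Psi> where \<Psi>: "\<Psi> \<in> hom D (wreath integer_group F2)"
      "\<And>w. \<Psi> (D.word_value diff w) \<in> wreath_base integer_group F2"
      "\<And>w. fst (\<Psi> (D.word_value diff w)) \<one>\<^bsub>F2\<^esub> =
        ZZ.P.word_value (\<lambda>x. if x \<in> carrier F2 then p x else \<one>\<^bsub>integer_group\<^esub>) w"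
      by (rule twisted_double_hom[where p = p, OF ZZ.P.is_group F.is_group id_hom p_closed p_inv p_one], assumption+)
        (rule that)
    interpret \<Psi>: group_hom D "wreath integer_group F2" \<Psi>
      using \<Psi>(1) by (simp add: group_hom_defs D.is_group ZF.W.is_group)
    define \<chi> where "\<chi> g = fst (\<Psi> g) \<one>\<^bsub>F2\<^esub>" for g
    \<comment> \<open>\<open>\<chi>\<close> lifts the \<open>r\<close>-coordinate of \<open>\<psi>\<close>\<close>
    have lift: "fst (\<psi> (D.word_value diff w)) r = \<chi> (D.word_value diff w) mod int k" for w
    proof (induction w)
      case Nil
      show ?case using r by (simp add: \<chi>_def V.base_eval_one ZF.base_eval_one)
    next
      case (Cons l w)
      let ?l = "D.letter_value diff l" and ?w = "D.word_value diff w"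
      have l_ker: "fold ?l = \<one>\<^bsub>F2\<^esub>" by (simp add: D.letter_value_def diff_ker)
      have "p x \<in> carrier (integer_mod_group k)" for x
        unfolding p_def using r by (intro V.base_eval_closed base diff_ker) auto
      then have p_mod: "p x mod int k = p x" for x
        using k by (simp add: carrier_integer_mod_group)
      have \<chi>_l: "\<chi> ?l = (if snd l \<in> carrier F2 then if fst l then p (snd l) else - p (snd l) else 0)"
        using \<Psi>(3)[of "[l]"] by (simp add: \<chi>_def ZZ.P.letter_value_def)
      have "p x = 0" if "x \<notin> carrier F2" for x
        using that r by (simp add: p_def diff_def V.base_eval_one)
      moreover have "fst (\<psi> ?l) r = (if fst l then p (snd l) else - p (snd l) mod int k)"
        using r base[OF diff_closed diff_ker, of "snd l"] V.base_eval_closed[OF base[OF diff_closed diff_ker, of "snd l"] r]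
        by (simp add: D.letter_value_def V.base_eval_inv p_def)
      ultimately have "fst (\<psi> ?l) r = \<chi> ?l mod int k"
        unfolding \<chi>_l using p_mod by auto
      moreover have "fst (\<psi> (?l \<otimes>\<^bsub>D\<^esub> ?w)) r = (fst (\<psi> ?l) r + fst (\<psi> ?w) r) mod int k"
        using V.base_eval_mult[OF base[OF _ l_ker] base[OF _ word_ker] r] by simp
      moreover have "\<chi> (?l \<otimes>\<^bsub>D\<^esub> ?w) = \<chi> ?l + \<chi> ?w"
      proof -
        have "?l = D.word_value diff [l]" by simp
        then have "\<Psi> ?l \<in> wreath_base integer_group F2" using \<Psi>(2) by metis
        then show ?thesis
          using ZF.base_eval_mult[OF _ \<Psi>(2)] by (simp add: \<chi>_def)
      qed
      ultimately show ?case
        using Cons.IH by (simp add: mod_add_eq)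
    qed
    obtain wu where wu: "u = D.word_value diff wu" by (rule kernel_fold_word[OF u])
    obtain wv where wv: "v = D.word_value diff wv" by (rule kernel_fold_word[OF v])
    have \<chi>_pow: "fst (\<Psi> (D.word_value diff w [^]\<^bsub>D\<^esub> m)) \<one>\<^bsub>F2\<^esub> = int m * \<chi> (D.word_value diff w)" for w
      using ZF.base_eval_pow[OF \<Psi>(2)[of w], of "\<one>\<^bsub>F2\<^esub>" m] by (simp add: \<Psi>.hom_nat_pow \<chi>_def)
    have "int m * \<chi> u = int m * \<chi> v"
      using \<chi>_pow[of wu] \<chi>_pow[of wv] pow(1) unfolding wu wv by (simp only:)
    then have "\<chi> u = \<chi> v" using pow(2) by simp
    then show "fst (\<psi> u) r = fst (\<psi> v) r"
      using lift[of wu] lift[of wv] by (simp add: wu wv)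
  qed
qed

text \<open>
  Suppose that \<open>\<phi>\<close> carries the kernel of the folding map onto that of the map to the stable
  letters. In the latter, the conjugates of the two images of \<open>a\<close> by the \<open>n\<close>th powers
  of the images of \<open>b\<close> have the same \<open>t n\<close>th power, but if \<open>t n > 1\<close> they
  are separated by a homomorphism that maps this kernel into the base of a wreath product.
\<close>

lemma no_kernel_exchange:
  assumes s: "multiplying_sequence s" and t: "multiplying_sequence t"
    and \<phi>: "\<phi> \<in> iso (G_seq s) (G_seq t)"
    and ker: "\<And>g. g \<in> carrier (G_seq s) \<Longrightarrow> group_double.fold F2 (H_seq s) g = \<one>\<^bsub>F2\<^esub> \<Longrightarrow>
      multiplying_sequence.stable t (\<phi> g) = \<one>\<^bsub>F2\<^esub>"
    and ker': "\<And>g. g \<in> carrier (G_seq s) \<Longrightarrow> multiplying_sequence.stable t (\<phi> g) = \<one>\<^bsub>F2\<^esub> \<Longrightarrow>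
      group_double.fold F2 (H_seq s) g = \<one>\<^bsub>F2\<^esub>"
  shows False
proof -
  interpret S: multiplying_sequence s by (rule s)
  interpret T: multiplying_sequence t by (rule t)
  have \<phi>_hom: "\<phi> \<in> hom S.D T.D" and \<phi>_bij: "bij_betw \<phi> (carrier S.D) (carrier T.D)"
    using \<phi> unfolding iso_def S.G_seq_D T.G_seq_D by simp_all
  interpret \<phi>: group_hom S.D T.D \<phi>
    using \<phi>_hom by (simp add: group_hom_defs S.D.is_group T.D.is_group)
  obtain n where n: "t n > 1" using T.unbounded[of 0 1] by blast
  define k where "k = t n"
  interpret test_wreath k n by (rule test_wreath)
  let ?Q = "test_group k n"
  interpret Q: group ?Q by (rule test_group_facts)
  obtain A B A' B' where sol: "A \<in> test_base k n" "B \<in> carrier ?Q" "A' \<in> test_base k n" "B' \<in> carrier ?Q"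
    "\<And>m e. m < n \<Longrightarrow> conj_pow ?Q A B m e = conj_pow ?Q A' B' m e"
    "\<And>e. \<not> k dvd e \<Longrightarrow> conj_pow ?Q A B n e \<noteq> conj_pow ?Q A' B' n e"
    by (rule test_solution) (rule that)
  have carr: "A \<in> carrier ?Q" "A' \<in> carrier ?Q" using sol test_group_facts by auto
  have "(A, B, A', B') \<in> solutions t ?Q (test_base k n)"
    by (rule solution_divisible) (use sol T.dvd in \<open>auto simp: k_def\<close>)
  then have rel: "conj_pow ?Q A B m (t m) = conj_pow ?Q A' B' m (t m)" for m
    by (simp add: solutions_def)
  obtain \<psi> where \<psi>: "\<psi> \<in> hom T.D ?Q" "\<psi> (T.left gA) = A" "\<psi> (T.left gB) = B"
    "\<psi> (T.right gA) = A'" "\<psi> (T.right gB) = B'"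
    by (rule T.D_hom_exists[OF Q.is_group carr(1) sol(2) carr(2) sol(4) rel]) (rule that)
  interpret \<psi>: group_hom T.D ?Q \<psi>
    using \<psi>(1) by (simp add: group_hom_defs T.D.is_group Q.is_group)
  define u where "u = T.left (conj_pow F2 gA gB n 1)"
  define v where "v = T.right (conj_pow F2 gA gB n 1)"
  have uv: "u \<in> carrier T.D" "v \<in> carrier T.D" by (simp_all add: u_def v_def)
  have "u [^]\<^bsub>T.D\<^esub> k = T.left (H_gen t n)" "v [^]\<^bsub>T.D\<^esub> k = T.right (H_gen t n)"
    using F.conj_pow_pow[of gA gB n "t n"]
    by (simp_all add: u_def v_def k_def H_gen_conj_pow T.left.hom_nat_pow T.right.hom_nat_pow)
  then have pow: "u [^]\<^bsub>T.D\<^esub> k = v [^]\<^bsub>T.D\<^esub> k" by (simp add: T.left_eq_right)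
  have stable_uv: "T.stable u = \<one>\<^bsub>F2\<^esub>" "T.stable v = \<one>\<^bsub>F2\<^esub>"
    by (simp_all add: u_def v_def T.left.hom_conj_pow T.right.hom_conj_pow T.stable.hom_conj_pow
        T.stable F.conj_pow_eq_one)
  have "u \<in> \<phi> ` carrier S.D"
    using uv(1) unfolding bij_betw_imp_surj_on[OF \<phi>_bij] .
  then obtain u' where u': "u' \<in> carrier S.D" "\<phi> u' = u"
    by (rule imageE) simp
  have "v \<in> \<phi> ` carrier S.D"
    using uv(2) unfolding bij_betw_imp_surj_on[OF \<phi>_bij] .
  then obtain v' where v': "v' \<in> carrier S.D" "\<phi> v' = v"
    by (rule imageE) simp
  have "\<phi> (u' [^]\<^bsub>S.D\<^esub> k) = \<phi> (v' [^]\<^bsub>S.D\<^esub> k)"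
    using pow u' v' by (simp add: \<phi>.hom_nat_pow)
  then have pow': "u' [^]\<^bsub>S.D\<^esub> k = v' [^]\<^bsub>S.D\<^esub> k"
    by (rule inj_onD[OF bij_betw_imp_inj_on[OF \<phi>_bij]]) (simp_all add: u'(1) v'(1))
  have "(\<psi> \<circ> \<phi>) u' = (\<psi> \<circ> \<phi>) v'"
  proof (rule S.kernel_fold_unique_roots[OF R.is_group _ _ u'(1) _ v'(1) _ pow'])
    show "\<psi> \<circ> \<phi> \<in> hom S.D (wreath (integer_mod_group k) (perm_group {..Suc n}))"
      using hom_compose[OF \<phi>_hom \<psi>(1)] by (simp add: test_group_def)
    show "S.fold u' = \<one>\<^bsub>F2\<^esub>" "S.fold v' = \<one>\<^bsub>F2\<^esub>"
      using ker' u' v' stable_uv by (simp_all add: S.G_seq_D)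
    show "k > 0" "k > 0" using n by (simp_all add: k_def)
    fix g assume g: "g \<in> carrier S.D" "S.fold g = \<one>\<^bsub>F2\<^esub>"
    have "\<psi> (\<phi> g) \<in> test_base k n"
    proof (rule T.stable_kernel[OF Q.is_group \<psi>(1) test_group_facts(2)])
      show "T.stable (\<phi> g) = \<one>\<^bsub>F2\<^esub>" using ker g by (simp add: S.G_seq_D)
    qed (use g(1) sol(1,3) \<psi> in simp_all)
    then show "(\<psi> \<circ> \<phi>) g \<in> wreath_base (integer_mod_group k) (perm_group {..Suc n})"
      by (simp add: test_base_def)
  qed
  then have "\<psi> u = \<psi> v" using u' v' by simp
  then have "conj_pow ?Q A B n 1 = conj_pow ?Q A' B' n 1"
    by (simp add: u_def v_def T.left.hom_conj_pow T.right.hom_conj_pow \<psi>.hom_conj_pow \<psi>)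
  moreover have "\<not> k dvd 1" using n by (simp add: k_def)
  ultimately show False using sol(6) by blast
qed

text \<open>
  An isomorphism composed with the map to the stable letters is a surjection onto a free group, to which the
  classification applies. If it does not kill the images of \<open>a\<close>, it factors through the folding
  map. Classifying the folding map composed with the inverse isomorphism in the same way, one finds that either
  the two kernels correspond to each other, or the kernel of one folding map lies in that of the map to the
  stable letters of the same group; the latter is absurd.
\<close>

lemma iso_kills_a:
  assumes s: "multiplying_sequence s" and t: "multiplying_sequence t"
    and \<phi>: "\<phi> \<in> iso (G_seq s) (G_seq t)"
  shows "multiplying_sequence.stable t (\<phi> (group_double.left F2 (H_seq s) gA)) = \<one>\<^bsub>F2\<^esub>"
    and "multiplying_sequence.stable t (\<phi> (group_double.right F2 (H_seq s) gA)) = \<one>\<^bsub>F2\<^esub>"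
proof -
  interpret S: multiplying_sequence s by (rule s)
  interpret T: multiplying_sequence t by (rule t)
  have \<phi>_hom: "\<phi> \<in> hom S.D T.D" and \<phi>_bij: "bij_betw \<phi> (carrier S.D) (carrier T.D)"
    using \<phi> unfolding iso_def S.G_seq_D T.G_seq_D by simp_all
  interpret \<phi>: group_hom S.D T.D \<phi>
    using \<phi>_hom by (simp add: group_hom_defs S.D.is_group T.D.is_group)
  have \<phi>_surj: "\<phi> ` carrier S.D = carrier T.D" using \<phi>_bij by (rule bij_betw_imp_surj_on)
  define \<rho> where "\<rho> = T.stable \<circ> \<phi>"
  have \<rho>: "\<rho> \<in> hom S.D F2" unfolding \<rho>_def using \<phi>_hom T.stable(1) by (rule hom_compose)
  have "\<rho> ` carrier S.D = carrier F2"
    unfolding \<rho>_def image_comp [symmetric] \<phi>_surj by (rule T.stable_surj)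
  note cases_\<rho> = S.surjection_to_F2[OF \<rho> this]
  have "\<rho> (S.left gA) = \<one>\<^bsub>F2\<^esub>"
  proof (rule ccontr)
    assume "\<rho> (S.left gA) \<noteq> \<one>\<^bsub>F2\<^esub>"
    with cases_\<rho> have eqs: "\<rho> (S.left gA) = \<rho> (S.right gA)" "\<rho> (S.left gB) = \<rho> (S.right gB)" by auto
    \<comment> \<open>hence \<open>\<rho>\<close> factors through the folding map\<close>
    have factor: "\<rho> g = \<rho> (S.left (S.fold g))" if "g \<in> carrier S.D" for g
    proof -
      have "\<rho> \<circ> (S.left \<circ> S.fold) \<in> hom S.D F2"
        using hom_compose[OF hom_compose[OF S.fold(1) S.left.homh] \<rho>] .
      then have "\<rho> g = (\<rho> \<circ> (S.left \<circ> S.fold)) g"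
        by (rule S.D_hom_eqI[OF F.is_group \<rho> _ _ _ _ _ that])
          (simp_all only: eqs S.fold(2,3) o_apply basis_elem_closed)
      then show ?thesis by simp
    qed
    have ker: "T.stable (\<phi> g) = \<one>\<^bsub>F2\<^esub>" if "g \<in> carrier S.D" "S.fold g = \<one>\<^bsub>F2\<^esub>" for g
    proof -
      have "\<rho> g = \<rho> \<one>\<^bsub>S.D\<^esub>" using factor[OF that(1)] that(2) by simp
      then show ?thesis by (simp add: \<rho>_def)
    qed
    define \<phi>' where "\<phi>' = inv_into (carrier S.D) \<phi>"
    have \<phi>'_iso: "\<phi>' \<in> iso T.D S.D"
      unfolding \<phi>'_def using \<phi> by (intro S.D.iso_set_sym) (simp add: S.G_seq_D T.G_seq_D)
    then have \<phi>'_hom: "\<phi>' \<in> hom T.D S.D" and \<phi>'_surj: "\<phi>' ` carrier T.D = carrier S.D"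
      by (auto simp: iso_def bij_betw_def)
    have inv1: "\<phi>' (\<phi> g) = g" if "g \<in> carrier S.D" for g
      unfolding \<phi>'_def using \<phi>_bij that by (rule bij_betw_inv_into_left)
    have inv2: "\<phi> (\<phi>' g) = g" if "g \<in> carrier T.D" for g
      unfolding \<phi>'_def using \<phi>_bij that by (rule bij_betw_inv_into_right)
    have \<phi>'_closed: "\<phi>' g \<in> carrier S.D" if "g \<in> carrier T.D" for g
      using \<phi>'_surj that by blast
    define \<rho>' where "\<rho>' = S.fold \<circ> \<phi>'"
    have \<rho>': "\<rho>' \<in> hom T.D F2" unfolding \<rho>'_def using \<phi>'_hom S.fold(1) by (rule hom_compose)
    interpret \<rho>': group_hom T.D F2 \<rho>'
      using \<rho>' by (simp add: group_hom_defs T.D.is_group F.is_group)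
    have "S.fold ` carrier S.D = carrier F2"
    proof -
      have "x \<in> S.fold ` carrier S.D" if "x \<in> carrier F2" for x
        using that S.fold(2)[OF that] by (metis S.left.hom_closed image_eqI)
      then show ?thesis by auto
    qed
    then have "\<rho>' ` carrier T.D = carrier F2"
      unfolding \<rho>'_def image_comp [symmetric] \<phi>'_surj .
    note cases_\<rho>' = T.surjection_to_F2[OF \<rho>' this]
    show False
    proof (cases "\<rho>' (T.left gA) = \<one>\<^bsub>F2\<^esub>")
      case True
      \<comment> \<open>\<open>\<rho>'\<close> kills both images of \<open>a\<close>, hence the kernel of the map to the stable letters\<close>
      have ker': "S.fold g = \<one>\<^bsub>F2\<^esub>" if "g \<in> carrier S.D" "T.stable (\<phi> g) = \<one>\<^bsub>F2\<^esub>" for g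
      proof -
        have "{\<one>\<^bsub>F2\<^esub>} \<lhd> F2" by (rule F.one_is_normal)
        from T.stable_kernel[OF F.is_group \<rho>' this _ _ _ that(2)] that(1) True cases_\<rho>'(1)
        have "\<rho>' (\<phi> g) = \<one>\<^bsub>F2\<^esub>" by simp
        then show ?thesis using inv1[OF that(1)] by (simp add: \<rho>'_def)
      qed
      show False
        by (rule no_kernel_exchange[OF s t \<phi>]) (simp_all add: S.G_seq_D ker ker')
    next
      case False
      let ?z = "T.left gB \<otimes>\<^bsub>T.D\<^esub> inv\<^bsub>T.D\<^esub> (T.right gB)"
      have "\<rho>' (T.left gB) = \<rho>' (T.right gB)" using False cases_\<rho>'(2) by blast
      then have "\<rho>' ?z = \<one>\<^bsub>F2\<^esub>" by simp
      then have "S.fold (\<phi>' ?z) = \<one>\<^bsub>F2\<^esub>" by (simp add: \<rho>'_def)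
      then have "T.stable ?z = \<one>\<^bsub>F2\<^esub>"
        using ker[of "\<phi>' ?z"] \<phi>'_closed inv2 by simp
      then have "gA \<cdot> inv\<^bsub>F2\<^esub> gB = \<one>\<^bsub>F2\<^esub>" by (simp add: T.stable)
      then have "gA = gB" using F.inv_solve_right[of "\<one>\<^bsub>F2\<^esub>" gA gB] by simp
      then show False by (simp add: basis_elem_def)
    qed
  qed
  then show "T.stable (\<phi> (S.left gA)) = \<one>\<^bsub>F2\<^esub>" "T.stable (\<phi> (S.right gA)) = \<one>\<^bsub>F2\<^esub>"
    using cases_\<rho>(1) by (simp_all add: \<rho>_def)
qed

text \<open>
  Pullback along \<open>\<phi>\<close> yields at least as many solutions for \<open>s\<close> as for
  \<open>t\<close>, but those for \<open>s\<close> are a proper part of those for \<open>t\<close>.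
\<close>

lemma not_iso_if_not_dvd:
  assumes s: "multiplying_sequence s" and t: "multiplying_sequence t"
    and \<phi>: "\<phi> \<in> iso (G_seq s) (G_seq t)"
    and eq: "\<And>m. m < n \<Longrightarrow> s m = t m" and "\<not> t n dvd s n"
  shows False
proof -
  interpret T: multiplying_sequence t by (rule t)
  interpret test_wreath "t n" n by (rule test_wreath)
  let ?Q = "test_group (t n) n" and ?V = "test_base (t n) n"
  have fin: "finite (carrier ?Q)" by (rule finite_test_group) (rule T.pos)
  have "card (solutions t ?Q ?V) \<le> card (solutions s ?Q ?V)"
    by (rule card_solutions_le[OF s t \<phi> iso_kills_a[OF s t \<phi>] test_group_facts(1) fin test_group_facts(2)])
  moreover have "card (solutions s ?Q ?V) < card (solutions t ?Q ?V)"
  proof (rule psubset_card_mono)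
    show "finite (solutions t ?Q ?V)"
      by (rule finite_subset[of _ "carrier ?Q \<times> carrier ?Q \<times> carrier ?Q \<times> carrier ?Q"])
        (use fin test_group_facts(3) in \<open>auto simp: solutions_def\<close>)
    show "solutions s ?Q ?V \<subset> solutions t ?Q ?V"
      by (rule solutions_psubset) (use assms T.dvd in auto)
  qed
  ultimately show False by simp
qed

theorem corollary5p3:
  shows "(\<forall>s. multiplying s \<longrightarrow> finitely_generated_group (G_seq s) \<and> residually_finite (G_seq s)) \<and>
    (\<forall>s t. multiplying s \<longrightarrow> multiplying t \<longrightarrow> s \<noteq> t \<longrightarrow> \<not> G_seq s \<cong> G_seq t)"
proof (intro conjI allI impI notI)
  fix s assume "multiplying s"
  then interpret multiplying_sequence s by unfold_locales
  show "finitely_generated_group (G_seq s)" by (rule finitely_generated_G_seq)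
  show "residually_finite (G_seq s)" by (rule residually_finite_G_seq)
next
  fix s t :: "nat \<Rightarrow> nat"
  assume "multiplying s" "multiplying t" "s \<noteq> t" "G_seq s \<cong> G_seq t"
  then have s: "multiplying_sequence s" and t: "multiplying_sequence t"
    by (simp_all add: multiplying_sequence_def)
  obtain \<phi> where \<phi>: "\<phi> \<in> iso (G_seq s) (G_seq t)"
    using \<open>G_seq s \<cong> G_seq t\<close> by (auto simp: is_iso_def)
  then have \<phi>': "inv_into (carrier (G_seq s)) \<phi> \<in> iso (G_seq t) (G_seq s)"
    by (rule group.iso_set_sym[OF group_G_seq])
  define n where "n = (LEAST n. s n \<noteq> t n)"
  have "\<exists>n. s n \<noteq> t n" using \<open>s \<noteq> t\<close> by auto
  then have "s n \<noteq> t n" unfolding n_def by (rule LeastI_ex)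
  have eq: "s m = t m" if "m < n" for m
    using not_less_Least[OF that[unfolded n_def]] by simp
  from \<open>s n \<noteq> t n\<close> consider "\<not> t n dvd s n" | "\<not> s n dvd t n"
    using dvd_antisym by blast
  then show False
  proof cases
    case 1
    then show False using not_iso_if_not_dvd[OF s t \<phi> eq] by blast
  next
    case 2
    then show False using not_iso_if_not_dvd[OF t s \<phi>' eq[symmetric]] by blast
  qed
qed

end
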